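(* Every almost positive diagram of the unknot is a (iterated) connected sum of diagrams of the following three kinds: (a) the one-crossing diagram with a positive crossing; (b) the one-crossing diagram with a negative crossing; (c) unknotted twist knot diagrams; where the summands of kinds (b) and (c) together appear exactly once (i.e. exactly one summand is of kind (b) or (c), and all others are of kind (a)).
   Context: Knot diagrams are oriented and considered up to isotopy on $S^2$. A crossing is positive or negative in the usual right-handed convention. A knot diagram is almost positive if all of its crossings are positive except exactly one. The connected sum $A\#B$ of diagrams is the usual one: cut both diagrams at an edge and join them by two parallel arcs without creating crossings. Unknotted twist knot diagrams: for $k\ge1$, consider the standard alternating diagram, with $k+2$ crossings, of the twist knot with Conway notation $(k,2)$ (i.e. of $3_1,4_1,5_2,6_1,7_2,8_1,\dots$), consisting of a row of $k$ half-twist crossings closed up by a clasp of two crossings. Switching one of the two clasp crossings yields a diagram of the unknot which, after taking the mirror image if necessary, has exactly one negative crossing (a crossing of the clasp). The resulting almost positive diagrams are the unknotted twist knot diagrams. *)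

theory Defs
  imports Main "HOL-Combinatorics.Orbits"
begin

text \<open>
  Oriented knot diagrams on the oriented sphere, up to isotopy, are encoded by their signed Gauss
  codes: follow the knot once around from a base point and record, at each passage through a
  crossing, the name of the crossing, whether the passage is over or under, and the sign of the
  crossing. A diagram on the sphere is determined up to isotopy by its signed Gauss code, which is
  itself determined up to the choice of the base point and the names of the crossings
  (\<open>isotopic\<close> below). The empty code is the diagram without crossings.
\<close>

datatype level = Over | Under

datatype handedness = Positive | Negative

fun other_level :: "level \<Rightarrow> level" where
  "other_level Over = Under"
| "other_level Under = Over"

fun other_hand :: "handedness \<Rightarrow> handedness" where
  "other_hand Positive = Negative"
| "other_hand Negative = Positive"

type_synonym passage = "nat \<times> level \<times> handedness"

type_synonym gauss_code = "passage list"

definition crossings :: "gauss_code \<Rightarrow> nat set" where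
  "crossings D = fst ` set D"

definition well_formed :: "gauss_code \<Rightarrow> bool" where
  "well_formed D \<longleftrightarrow> distinct D \<and>
     (\<forall>(c, l, e) \<in> set D. (c, other_level l, e) \<in> set D \<and>
                          (\<forall>l'. (c, l', other_hand e) \<notin> set D))"


text \<open>
  Not every code comes from a diagram on the sphere. A code determines a 4-valent graph with a
  rotation system, hence a closed oriented surface containing it; the code is realised on the
  sphere iff that surface has genus 0. The half-edges \<open>Incoming p\<close> and \<open>Outgoing p\<close> are those along
  which the \<open>p\<close>-th passage enters and leaves its crossing.
\<close>

datatype half_edge = Incoming nat | Outgoing nat

definition half_edges :: "gauss_code \<Rightarrow> half_edge set" where
  "half_edges D = Incoming ` {..<length D} \<union> Outgoing ` {..<length D}"

definition partner :: "gauss_code \<Rightarrow> nat \<Rightarrow> nat" where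
  "partner D p = (THE q. q < length D \<and> q \<noteq> p \<and> fst (D ! q) = fst (D ! p))"

fun opposite_end :: "gauss_code \<Rightarrow> half_edge \<Rightarrow> half_edge" where
  "opposite_end D (Outgoing p) = Incoming (Suc p mod length D)"
| "opposite_end D (Incoming p) = Outgoing ((p + length D - 1) mod length D)"

text \<open>
  The counterclockwise order of the half-edges at a positive (right-handed) crossing is: outgoing
  over, outgoing under, incoming over, incoming under. At a negative crossing the two under
  half-edges are exchanged.
\<close>

fun next_ccw :: "gauss_code \<Rightarrow> half_edge \<Rightarrow> half_edge" where
  "next_ccw D (Outgoing p) =
     (if (fst (snd (D ! p)) = Over) = (snd (snd (D ! p)) = Positive)
      then Outgoing (partner D p) else Incoming (partner D p))"
| "next_ccw D (Incoming p) =
     (if (fst (snd (D ! p)) = Over) = (snd (snd (D ! p)) = Positive)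
      then Incoming (partner D p) else Outgoing (partner D p))"

definition faces :: "gauss_code \<Rightarrow> half_edge set set" where
  "faces D = orbit (next_ccw D \<circ> opposite_end D) ` half_edges D"

text \<open>
  With \<open>n\<close> crossings there are \<open>2 n\<close> edges and the graph is connected, so genus 0 means that there
  are \<open>n + 2\<close> faces. The circle without crossings has no half-edges and is listed separately.
\<close>

definition knot_diagram :: "gauss_code \<Rightarrow> bool" where
  "knot_diagram D \<longleftrightarrow>
     well_formed D \<and> (D = [] \<or> card (faces D) = card (crossings D) + 2)"

definition rename_crossings :: "(nat \<Rightarrow> nat) \<Rightarrow> gauss_code \<Rightarrow> gauss_code" where
  "rename_crossings f D = map (\<lambda>(c, l, e). (f c, l, e)) D"

definition isotopic :: "gauss_code \<Rightarrow> gauss_code \<Rightarrow> bool" where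
  "isotopic D E \<longleftrightarrow>
     (\<exists>f n. inj_on f (crossings D) \<and> E = rotate n (rename_crossings f D))"

definition negative_crossings :: "gauss_code \<Rightarrow> nat set" where
  "negative_crossings D = {c. \<exists>l. (c, l, Negative) \<in> set D}"

definition almost_positive :: "gauss_code \<Rightarrow> bool" where
  "almost_positive D \<longleftrightarrow> card (negative_crossings D) = 1"


text \<open>
  Reidemeister moves, each in one direction. They are only ever applied between codes that are
  both \<open>knot_diagram\<close>s (see \<open>same_knot\<close>); then a kink as in \<open>R1\<close> bounds a face, and so does the pair
  of edges in \<open>R2_parallel\<close> and \<open>R2_antiparallel\<close>, because the graph is connected and the two
  crossings have opposite signs. For three edges this is not automatic, so that \<open>R3\<close> requires the
  edges joining the passages \<open>x1, y1\<close>, \<open>x2, y2\<close> and \<open>x3, y3\<close> to bound a triangular face; the first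
  of them lies above the two others.
\<close>

definition triangular_face :: "gauss_code \<Rightarrow> nat set \<Rightarrow> bool" where
  "triangular_face D P \<longleftrightarrow>
     (\<exists>F \<in> faces D. card F = 3 \<and> (\<forall>p \<in> P. Outgoing p \<in> F \<or> Incoming (Suc p) \<in> F))"

inductive reidemeister :: "gauss_code \<Rightarrow> gauss_code \<Rightarrow> bool" where
  R0: "isotopic D E \<Longrightarrow> reidemeister D E"
| R1: "reidemeister ([(a, l, e), (a, other_level l, e)] @ u) u"
| R2_parallel:
    "reidemeister
       ([(a, l, e), (b, l, other_hand e)] @ u @
        [(a, other_level l, e), (b, other_level l, other_hand e)] @ v)
       (u @ v)"
| R2_antiparallel:
    "reidemeister
       ([(a, l, e), (b, l, other_hand e)] @ u @
        [(b, other_level l, other_hand e), (a, other_level l, e)] @ v)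
       (u @ v)"
| R3:
    "D = [x1, y1] @ u @ [x2, y2] @ v @ [x3, y3] @ w \<Longrightarrow>
     triangular_face D {0, length u + 2, length u + length v + 4} \<Longrightarrow>
     fst (snd x1) = Over \<Longrightarrow> fst (snd y1) = Over \<Longrightarrow>
     reidemeister D ([y1, x1] @ u @ [y2, x2] @ v @ [y3, x3] @ w)"

definition same_knot :: "gauss_code \<Rightarrow> gauss_code \<Rightarrow> bool" where
  "same_knot =
     (\<lambda>D E. knot_diagram D \<and> knot_diagram E \<and> (reidemeister D E \<or> reidemeister E D))\<^sup>*\<^sup>*"

definition unknot_diagram :: "gauss_code \<Rightarrow> bool" where
  "unknot_diagram D \<longleftrightarrow> knot_diagram D \<and> same_knot D []"


text \<open>
  Cutting a diagram at an edge turns its cyclic code into a word starting right after that edge;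
  joining two cut diagrams concatenates the words. Since codes may be rotated, every pair of edges
  is covered. On the sphere the result does not depend on anything but the edges.
\<close>

definition connected_sum :: "gauss_code \<Rightarrow> gauss_code \<Rightarrow> gauss_code \<Rightarrow> bool" where
  "connected_sum A B D \<longleftrightarrow>
     (\<exists>A' B'. isotopic A A' \<and> isotopic B B' \<and> crossings A' \<inter> crossings B' = {} \<and>
              isotopic (A' @ B') D)"

inductive iterated_connected_sum :: "gauss_code list \<Rightarrow> gauss_code \<Rightarrow> bool" where
  single: "isotopic A D \<Longrightarrow> iterated_connected_sum [A] D"
| join: "iterated_connected_sum As A \<Longrightarrow> iterated_connected_sum Bs B \<Longrightarrow> connected_sum A B D \<Longrightarrow>
     iterated_connected_sum (As @ Bs) D"

definition one_crossing_diagram :: "handedness \<Rightarrow> gauss_code \<Rightarrow> bool" where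
  "one_crossing_diagram e D \<longleftrightarrow> isotopic [(0, Over, e), (0, Under, e)] D"


text \<open>
  The standard alternating diagram with Conway notation \<open>(k, 2)\<close>: \<open>0, \<dots>, k - 1\<close> are the crossings
  of the row of half-twists, \<open>k\<close> and \<open>Suc k\<close> those of the clasp. Following the knot, one runs
  through the row, then along one arc of the clasp, back through the row, and along the other
  arc of the clasp. The two arcs of the clasp run in parallel if \<open>k\<close> is odd and antiparallel if
  \<open>k\<close> is even. As the diagram is alternating on the sphere, the sign \<open>e\<close> of the crossings in the
  row determines that of the crossings in the clasp. The two values of \<open>e\<close> give mirror images
  (reflection in a line of the projection plane).
\<close>

definition twist_knot_word :: "nat \<Rightarrow> nat list" where
  "twist_knot_word k =
     [0..<k] @ (if odd k then [k, Suc k] else [Suc k, k]) @ rev [0..<k] @ [k, Suc k]"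

definition twist_knot_diagram :: "nat \<Rightarrow> handedness \<Rightarrow> gauss_code" where
  "twist_knot_diagram k e =
     map (\<lambda>p. let c = twist_knot_word k ! p in
              (c, if even p then Over else Under, if c < k \<or> odd k then e else other_hand e))
         [0..<2 * k + 4]"

definition switch_crossing :: "nat \<Rightarrow> gauss_code \<Rightarrow> gauss_code" where
  "switch_crossing a D =
     map (\<lambda>(c, l, e). if c = a then (c, other_level l, other_hand e) else (c, l, e)) D"

text \<open>
  The diagram may carry either orientation; reversing the orientation reverses the code and
  preserves levels and signs. Requiring exactly one negative crossing selects the handedness
  \<open>e = Positive\<close>, and the negative crossing then belongs to the clasp.
\<close>

definition unknotted_twist_knot_diagram :: "gauss_code \<Rightarrow> bool" where
  "unknotted_twist_knot_diagram D \<longleftrightarrow> almost_positive D \<and>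
     (\<exists>k\<ge>1. \<exists>e. \<exists>c \<in> {k, Suc k}.
        isotopic (switch_crossing c (twist_knot_diagram k e)) D \<or>
        isotopic (rev (switch_crossing c (twist_knot_diagram k e))) D)"

end

theory Submission
  imports Defs "HOL-Library.FuncSet" "HOL-Library.Multiset"
begin

text \<open>
  The result follows from the vanishing of one invariant, the Casson invariant (the coefficient of
  \<open>z\<^sup>2\<close> in the Conway polynomial), together with the fact that closed curves on the sphere have
  intersection number zero.

  Polyak and Viro express the Casson invariant as a sum over pairs of crossings that are met in the
  order \<open>a b a b\<close> from a base point, at prescribed levels; a pair counts with the product of its signs.
  That this is an invariant (\<open>casson_unknot\<close>) is checked for each Reidemeister move, and for moving the
  base point, where planarity is needed. Put the base point just before the overpass of the negative
  crossing \<open>c\<close>. For one of the two forms of the formula no pair with \<open>c\<close> is counted, so each counted pair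
  contributes \<open>1\<close>, and as the sum is zero no pair is counted. Starting at the underpass of \<open>c\<close>, the other
  form gives a second condition of this kind.

  Planarity is encoded by the Euler characteristic of the surface. A counting argument turns it into
  the existence of potentials for all flows on the diagram (\<open>flow_has_potential_mod\<close>), and therefore
  into the vanishing of intersection numbers (\<open>loop_intersection_flow\<close>), which is applied to the whole
  knot and to the loops into which a crossing divides it.

  The rest is combinatorics of the chords of the Gauss diagram. Passages of two interlaced positive
  crossings come in the cyclic order over, over, under, under, and one draws an arrow from the crossing
  of the first passage to that of the second. Intersection with the knot computes the difference
  between the numbers of outgoing and incoming arrows; intersection of two loops says that two
  crossings interlaced with \<open>c\<close> but not with each other have, counted with signs, one common neighbour
  besides \<open>c\<close>. With the two conditions from the Casson invariant this forces a single crossing \<open>d\<close>, the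
  hub, to be interlaced with all other crossings that are interlaced with \<open>c\<close>, and there are no further
  interlaced pairs of positive crossings
  (\<open>hub_exists\<close>, \<open>rising_arrows\<close>, \<open>falling_arrows\<close>, \<open>local_isolated\<close>). Hence \<open>c\<close> and \<open>d\<close> form a clasp, the
  crossings interlaced with both form a row, and intersection with the loop of \<open>c\<close> shows that the row
  alternates (\<open>row_alternates\<close>): these crossings carry the code of an unknotted twist knot diagram, or
  of a single negative kink if nothing is interlaced. The remaining crossings are interlaced with
  nothing, so they can be split off one by one as positive kinks (\<open>kink_extension_nested\<close>).
\<close>

section \<open>Letters, passages and half-edges\<close>

definition crossing_sign :: "handedness \<Rightarrow> int" where
  "crossing_sign e = (if e = Positive then 1 else - 1)"

lemma other_level_simps [simp]:
  "other_level (other_level l) = l" "other_level l \<noteq> l" "l \<noteq> other_level l"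
  by (cases l; simp)+

lemma other_hand_simps [simp]:
  "other_hand (other_hand e) = e" "other_hand e \<noteq> e" "e \<noteq> other_hand e"
  by (cases e; simp)+

lemma level_neq_iff: "l' \<noteq> l \<longleftrightarrow> l' = other_level l"
  by (cases l; cases l'; simp)

lemma hand_neq_iff: "e' \<noteq> e \<longleftrightarrow> e' = other_hand e"
  by (cases e; cases e'; simp)

lemma well_formed_distinct: "well_formed D \<Longrightarrow> distinct D"
  by (simp add: well_formed_def)

lemma well_formed_mate: "well_formed D \<Longrightarrow> (c, l, e) \<in> set D \<Longrightarrow> (c, other_level l, e) \<in> set D"
  by (auto simp: well_formed_def)

lemma well_formed_same_sign:
  assumes "well_formed D" "(c, l, e) \<in> set D" "(c, l', e') \<in> set D"
  shows "e' = e"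
proof (rule ccontr)
  assume "e' \<noteq> e"
  then have "e' = other_hand e" by (simp add: hand_neq_iff)
  with assms show False by (fastforce simp: well_formed_def)
qed

lemma partner_unique:
  assumes wf: "well_formed D" and p: "p < length D" and c: "D ! p = (c, l, e)"
  shows "\<exists>!q. q < length D \<and> q \<noteq> p \<and> fst (D ! q) = fst (D ! p)"
    and "q < length D \<Longrightarrow> q \<noteq> p \<Longrightarrow> fst (D ! q) = c \<Longrightarrow> D ! q = (c, other_level l, e)"
proof -
  have inD: "(c, l, e) \<in> set D" using p c by (metis nth_mem)
  have key: "D ! q = (c, other_level l, e)" if q: "q < length D" "q \<noteq> p" "fst (D ! q) = c" for q
  proof -
    obtain l' e' where q': "D ! q = (c, l', e')" using q(3) by (cases "D ! q") auto
    have "(c, l', e') \<in> set D" using q(1) q' by (metis nth_mem)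
    then have e: "e' = e" using well_formed_same_sign[OF wf inD] by blast
    have "D ! q \<noteq> D ! p"
      using q p well_formed_distinct[OF wf] by (simp add: nth_eq_iff_index_eq)
    then have "l' \<noteq> l" using q' c e by auto
    then show ?thesis using q' e by (simp add: level_neq_iff)
  qed
  then show "q < length D \<Longrightarrow> q \<noteq> p \<Longrightarrow> fst (D ! q) = c \<Longrightarrow> D ! q = (c, other_level l, e)" .
  obtain q where q: "q < length D" "D ! q = (c, other_level l, e)"
    using well_formed_mate[OF wf inD] by (metis in_set_conv_nth)
  show "\<exists>!q. q < length D \<and> q \<noteq> p \<and> fst (D ! q) = fst (D ! p)"
  proof (rule ex1I[of _ q])
    show "q < length D \<and> q \<noteq> p \<and> fst (D ! q) = fst (D ! p)" using q c by auto
    fix r assume r: "r < length D \<and> r \<noteq> p \<and> fst (D ! r) = fst (D ! p)"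
    then have "D ! r = D ! q" using key[of r] q c by auto
    then show "r = q" using r q(1) well_formed_distinct[OF wf] by (simp add: nth_eq_iff_index_eq)
  qed
qed

lemma partner_props:
  assumes wf: "well_formed D" and p: "p < length D"
  shows "partner D p < length D" "partner D p \<noteq> p" "fst (D ! partner D p) = fst (D ! p)"
proof -
  obtain c l e where c: "D ! p = (c, l, e)" by (cases "D ! p") auto
  from theI'[OF partner_unique(1)[OF wf p c]]
  show "partner D p < length D" "partner D p \<noteq> p" "fst (D ! partner D p) = fst (D ! p)"
    by (auto simp: partner_def)
qed

lemma nth_partner:
  assumes "well_formed D" "p < length D" "D ! p = (c, l, e)"
  shows "D ! partner D p = (c, other_level l, e)"
  using partner_unique(2)[OF assms] partner_props[OF assms(1,2)] assms(3) by simp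

lemma partner_eqI:
  assumes "well_formed D" "p < length D" "q < length D" "q \<noteq> p" "fst (D ! q) = fst (D ! p)"
  shows "partner D p = q"
proof -
  obtain c l e where c: "D ! p = (c, l, e)" by (cases "D ! p") auto
  from the1_equality[OF partner_unique(1)[OF assms(1,2) c]] assms(3-5)
  show ?thesis by (auto simp: partner_def)
qed

lemma partner_partner [simp]:
  assumes "well_formed D" "p < length D"
  shows "partner D (partner D p) = p"
  using partner_props[OF assms] assms by (intro partner_eqI) auto

text \<open>
  The other strand crosses this passage from the right to the left. The rotation system depends on
  level and sign through this bit only, and it is what the intersection numbers below count.
\<close>

definition from_right :: "passage \<Rightarrow> bool" where
  "from_right x \<longleftrightarrow> (fst (snd x) = Over) = (snd (snd x) = Positive)"

lemma from_right_Pair: "from_right (c, l, e) \<longleftrightarrow> (l = Over) = (e = Positive)"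
  by (simp add: from_right_def)

lemma from_right_partner:
  assumes "well_formed D" "p < length D"
  shows "from_right (D ! partner D p) \<longleftrightarrow> \<not> from_right (D ! p)"
proof -
  obtain c l e where c: "D ! p = (c, l, e)" by (cases "D ! p") auto
  show ?thesis
    using nth_partner[OF assms c] c by (cases l) (simp_all add: from_right_def)
qed

lemma next_ccw_simps:
  "from_right (D ! p) \<Longrightarrow> next_ccw D (Outgoing p) = Outgoing (partner D p)"
  "from_right (D ! p) \<Longrightarrow> next_ccw D (Incoming p) = Incoming (partner D p)"
  "\<not> from_right (D ! p) \<Longrightarrow> next_ccw D (Outgoing p) = Incoming (partner D p)"
  "\<not> from_right (D ! p) \<Longrightarrow> next_ccw D (Incoming p) = Outgoing (partner D p)"
  by (auto simp: from_right_def)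

declare next_ccw.simps [simp del]

abbreviation face_step :: "gauss_code \<Rightarrow> half_edge \<Rightarrow> half_edge" where
  "face_step D \<equiv> next_ccw D \<circ> opposite_end D"

definition pred_pos :: "gauss_code \<Rightarrow> nat \<Rightarrow> nat" where
  "pred_pos D p = (p + length D - 1) mod length D"

definition succ_pos :: "gauss_code \<Rightarrow> nat \<Rightarrow> nat" where
  "succ_pos D p = Suc p mod length D"

lemma opposite_end_simps:
  "opposite_end D (Outgoing p) = Incoming (succ_pos D p)"
  "opposite_end D (Incoming p) = Outgoing (pred_pos D p)"
  by (simp_all add: pred_pos_def succ_pos_def)

declare opposite_end.simps [simp del]

lemma pred_pos_less: "p < length D \<Longrightarrow> pred_pos D p < length D"
  and succ_pos_less: "p < length D \<Longrightarrow> succ_pos D p < length D"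
  by (auto simp: pred_pos_def succ_pos_def intro!: mod_less_divisor)

lemma succ_pos_if: "p < length D \<Longrightarrow> succ_pos D p = (if Suc p = length D then 0 else Suc p)"
  by (auto simp: succ_pos_def)

lemma pred_pos_if: "p < length D \<Longrightarrow> pred_pos D p = (if p = 0 then length D - 1 else p - 1)"
proof (cases p)
  case 0
  then show "p < length D \<Longrightarrow> ?thesis" by (simp add: pred_pos_def)
next
  case (Suc q)
  assume "p < length D"
  then show ?thesis using Suc by (simp add: pred_pos_def)
qed

lemma succ_pred_pos [simp]: "p < length D \<Longrightarrow> succ_pos D (pred_pos D p) = p"
  by (subst pred_pos_if, assumption, subst succ_pos_if) auto

lemma pred_succ_pos [simp]: "p < length D \<Longrightarrow> pred_pos D (succ_pos D p) = p"
  by (subst succ_pos_if, assumption, subst pred_pos_if) auto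

lemma half_edges_iff [simp]:
  "Outgoing p \<in> half_edges D \<longleftrightarrow> p < length D"
  "Incoming p \<in> half_edges D \<longleftrightarrow> p < length D"
  by (auto simp: half_edges_def)

lemma half_edges_cases:
  assumes "e \<in> half_edges D"
  obtains (out) p where "p < length D" "e = Outgoing p" | (inc) p where "p < length D" "e = Incoming p"
  using assms by (auto simp: half_edges_def)

lemma finite_half_edges [simp]: "finite (half_edges D)"
  by (simp add: half_edges_def)

lemma opposite_end_in: "e \<in> half_edges D \<Longrightarrow> opposite_end D e \<in> half_edges D"
  by (erule half_edges_cases) (simp_all add: opposite_end_simps pred_pos_less succ_pos_less)

lemma opposite_end_opposite_end: "e \<in> half_edges D \<Longrightarrow> opposite_end D (opposite_end D e) = e"
  by (erule half_edges_cases) (simp_all add: opposite_end_simps)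

lemma next_ccw_in: "well_formed D \<Longrightarrow> e \<in> half_edges D \<Longrightarrow> next_ccw D e \<in> half_edges D"
  by (erule half_edges_cases) (auto simp: next_ccw.simps partner_props)

lemma next_ccw_four:
  assumes wf: "well_formed D" and e: "e \<in> half_edges D"
  shows "next_ccw D (next_ccw D (next_ccw D (next_ccw D e))) = e"
  using e
proof (cases rule: half_edges_cases)
  case (out p)
  then show ?thesis
    using wf by (cases "from_right (D ! p)")
      (simp_all add: next_ccw_simps from_right_partner partner_props)
next
  case (inc p)
  then show ?thesis
    using wf by (cases "from_right (D ! p)")
      (simp_all add: next_ccw_simps from_right_partner partner_props)
qed

lemma face_step_in: "well_formed D \<Longrightarrow> e \<in> half_edges D \<Longrightarrow> face_step D e \<in> half_edges D"
  by (simp add: next_ccw_in opposite_end_in)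

lemma inj_on_face_step:
  assumes "well_formed D"
  shows "inj_on (face_step D) (half_edges D)"
proof (rule inj_on_inverseI)
  fix e assume "e \<in> half_edges D"
  then show "(opposite_end D \<circ> next_ccw D \<circ> next_ccw D \<circ> next_ccw D) (face_step D e) = e"
    by (simp add: next_ccw_four[OF assms] opposite_end_in opposite_end_opposite_end)
qed

text \<open>
  The powers of \<open>f\<close> cannot map \<open>x\<close> to infinitely many elements of \<open>S\<close>; a repetition can be cancelled
  down to \<open>x\<close> itself because the powers are injective. Orbits are needed for maps that are
  permutations of the half-edges only and arbitrary elsewhere.
\<close>

lemma self_in_orbit_finite:
  assumes fin: "finite S" and inj: "inj_on f S" and cl: "f ` S \<subseteq> S" and x: "x \<in> S"
  shows "x \<in> orbit f x"
proof -
  have pow: "(f ^^ n) y \<in> S" if "y \<in> S" for n y using that cl by (induction n) auto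
  have inj_pow: "inj_on (f ^^ n) S" for n
  proof (induction n)
    case (Suc n)
    have "inj_on (f \<circ> f ^^ n) S"
      using Suc pow by (intro comp_inj_on) (auto intro: inj_on_subset[OF inj])
    then show ?case by (simp add: comp_def)
  qed simp
  have "\<not> inj (\<lambda>n. (f ^^ n) x)"
  proof
    assume "inj (\<lambda>n. (f ^^ n) x)"
    moreover have "finite (range (\<lambda>n. (f ^^ n) x))"
      using pow[OF x] by (intro finite_subset[OF _ fin]) auto
    ultimately show False using finite_imageD infinite_UNIV_nat by blast
  qed
  then obtain i j where ij: "i < j" "(f ^^ i) x = (f ^^ j) x"
    unfolding inj_def by (auto simp: nat_neq_iff)
  have "(f ^^ j) x = (f ^^ i) ((f ^^ (j - i)) x)"
    using \<open>i < j\<close> by (simp flip: funpow_add comp_apply[of "f ^^ i"])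
  then have "(f ^^ i) x = (f ^^ i) ((f ^^ (j - i)) x)" using ij by simp
  then have "x = (f ^^ (j - i)) x"
    using inj_pow[of i] x pow[OF x] by (simp add: inj_on_eq_iff)
  with \<open>i < j\<close> show ?thesis unfolding orbit_altdef
    by (intro CollectI exI[of _ "j - i"]) simp
qed

lemma orbit_step_eq:
  assumes "finite S" "inj_on f S" "f ` S \<subseteq> S" "x \<in> S"
  shows "orbit f (f x) = orbit f x"
proof
  show "orbit f (f x) \<subseteq> orbit f x"
    by (auto intro: orbit_trans orbit.base)
  have "x \<in> orbit f (f x)"
    using self_in_orbit_finite[OF assms] by (rule orbit_swap) (rule orbit.base)
  then show "orbit f x \<subseteq> orbit f (f x)" by (auto intro: orbit_trans)
qed

section \<open>Flows, potentials and the Euler characteristic\<close>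

text \<open>
  Integer 1-cycles: \<open>y p\<close> is the weight of the edge that leaves passage \<open>p\<close>, and the condition is
  Kirchhoff's law at a crossing.
\<close>

definition flow :: "gauss_code \<Rightarrow> (nat \<Rightarrow> int) \<Rightarrow> bool" where
  "flow D y \<longleftrightarrow> (\<forall>p < length D.
     (y p - y (pred_pos D p)) + (y (partner D p) - y (pred_pos D (partner D p))) = 0)"

text \<open>
  Functions of the faces, seen from the half-edges on their boundaries: \<open>opposite_end D e\<close> and
  \<open>next_ccw D e\<close> follow each other along the boundary of one face.
\<close>

definition potential :: "gauss_code \<Rightarrow> (half_edge \<Rightarrow> int) \<Rightarrow> bool" where
  "potential D g \<longleftrightarrow> (\<forall>e \<in> half_edges D. g (next_ccw D e) = g (opposite_end D e))"

definition drop_across :: "gauss_code \<Rightarrow> (half_edge \<Rightarrow> int) \<Rightarrow> nat \<Rightarrow> int" where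
  "drop_across D g p = g (Outgoing p) - g (Incoming (succ_pos D p))"

text \<open>
  The change, at passage \<open>p\<close>, of a potential with flow \<open>y\<close> along the right-hand side of the knot: the
  faces before and after the crossing are separated by the half-edge of the other strand on the
  right, which is incoming iff that strand crosses from the right (see \<open>potential_step\<close>).
\<close>

definition turn :: "gauss_code \<Rightarrow> (nat \<Rightarrow> int) \<Rightarrow> nat \<Rightarrow> int" where
  "turn D y p = (if from_right (D ! p) then y (pred_pos D (partner D p)) else - y (partner D p))"

lemma potential_relations:
  assumes wf: "well_formed D" and g: "potential D g" and p: "p < length D"
  defines "q \<equiv> partner D p"
  assumes r: "from_right (D ! p)"
  shows "g (Incoming q) = g (Outgoing (pred_pos D p))"
    and "g (Outgoing p) = g (Outgoing (pred_pos D q))"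
    and "g (Outgoing q) = g (Incoming (succ_pos D p))"
    and "g (Incoming p) = g (Incoming (succ_pos D q))"
proof -
  have q: "q < length D" "partner D q = p" "\<not> from_right (D ! q)"
    using partner_props[OF wf p] from_right_partner[OF wf p] r wf p by (simp_all add: q_def)
  have step: "g (next_ccw D e) = g (opposite_end D e)" if "e \<in> half_edges D" for e
    using g that by (simp add: potential_def)
  show "g (Incoming q) = g (Outgoing (pred_pos D p))"
    using step[of "Incoming p"] p r by (simp add: next_ccw_simps opposite_end_simps q_def)
  show "g (Outgoing p) = g (Outgoing (pred_pos D q))"
    using step[of "Incoming q"] q by (simp add: next_ccw_simps opposite_end_simps)
  show "g (Outgoing q) = g (Incoming (succ_pos D p))"
    using step[of "Outgoing p"] p r by (simp add: next_ccw_simps opposite_end_simps q_def)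
  show "g (Incoming p) = g (Incoming (succ_pos D q))"
    using step[of "Outgoing q"] q by (simp add: next_ccw_simps opposite_end_simps)
qed

lemma drop_across_pred:
  "p < length D \<Longrightarrow> drop_across D g (pred_pos D p) = g (Outgoing (pred_pos D p)) - g (Incoming p)"
  by (simp add: drop_across_def)

text \<open>
  The four drops met while going around a crossing cancel.
\<close>

lemma flow_drop_across:
  assumes wf: "well_formed D" and g: "potential D g"
  shows "flow D (drop_across D g)"
  unfolding flow_def
proof (intro allI impI)
  have main: "(drop_across D g p - drop_across D g (pred_pos D p)) +
      (drop_across D g (partner D p) - drop_across D g (pred_pos D (partner D p))) = 0"
    if p: "p < length D" and r: "from_right (D ! p)" for p
    using potential_relations[OF wf g p r] partner_props[OF wf p] p
    by (simp add: drop_across_pred) (simp add: drop_across_def)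
  fix p assume p: "p < length D"
  show "(drop_across D g p - drop_across D g (pred_pos D p)) +
      (drop_across D g (partner D p) - drop_across D g (pred_pos D (partner D p))) = 0"
  proof (cases "from_right (D ! p)")
    case True
    then show ?thesis using main p by blast
  next
    case False
    then show ?thesis
      using main[of "partner D p"] partner_props[OF wf p] from_right_partner[OF wf p] wf p by simp
  qed
qed

lemma potential_step:
  assumes wf: "well_formed D" and g: "potential D g" and p: "p < length D"
  shows "g (Outgoing p) = g (Outgoing (pred_pos D p)) + turn D (drop_across D g) p"
proof (cases "from_right (D ! p)")
  case True
  then show ?thesis
    using potential_relations[OF wf g p True] partner_props[OF wf p]
    by (simp add: turn_def drop_across_pred)
next
  case False
  define q where "q = partner D p"
  have q: "q < length D" "partner D q = p" "from_right (D ! q)"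
    using partner_props[OF wf p] from_right_partner[OF wf p] False wf p by (simp_all add: q_def)
  show ?thesis
    using potential_relations[OF wf g q(1,3)] q False
    by (simp add: turn_def q_def[symmetric] drop_across_def)
qed

text \<open>
  At the corner of the loop from passage \<open>i\<close> to passage \<open>j\<close> of the same crossing, the faces on the
  right of the last and of the first edge coincide, or are opposite at the crossing, according to
  the direction in which the loop turns.
\<close>

lemma potential_corner:
  assumes wf: "well_formed D" and g: "potential D g" and i: "i < length D"
  defines "j \<equiv> partner D i"
  shows "g (Outgoing (pred_pos D j)) - g (Outgoing i) =
    (if from_right (D ! j) then drop_across D g (pred_pos D j) - drop_across D g i else 0)"
proof -
  have j: "j < length D" "partner D j = i" "from_right (D ! j) \<longleftrightarrow> \<not> from_right (D ! i)"
    using partner_props[OF wf i] from_right_partner[OF wf i] wf i by (simp_all add: j_def)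
  show ?thesis
  proof (cases "from_right (D ! i)")
    case True
    then show ?thesis using potential_relations[OF wf g i True] j by (simp add: j_def)
  next
    case False
    then show ?thesis
      using potential_relations[OF wf g j(1)] j by (simp add: drop_across_pred) (simp add: drop_across_def)
  qed
qed

lemma sum_telescope_pred:
  fixes G :: "nat \<Rightarrow> int"
  assumes "\<And>p. i < p \<Longrightarrow> p < j \<Longrightarrow> G p = G (p - 1) + t p" "i < j"
  shows "(\<Sum>p\<in>{i<..<j}. t p) = G (j - 1) - G i"
  using assms
proof (induction j)
  case (Suc j)
  show ?case
  proof (cases "i = j")
    case True
    then have "{i<..<Suc j} = {}" by auto
    then show ?thesis using True by simp
  next
    case False
    then have "{i<..<Suc j} = insert j {i<..<j}" using Suc.prems by auto
    then show ?thesis using Suc False by simp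
  qed
qed simp

text \<open>
  The sum counts the signed intersections of the flow with the loop cut off at a crossing, pushed to
  its right. It telescopes because the flow comes from a potential.
\<close>

lemma loop_intersection_potential:
  assumes wf: "well_formed D" and g: "potential D g" and ij: "i < j" "j < length D" "partner D i = j"
  shows "(\<Sum>p\<in>{i<..<j}. turn D (drop_across D g) p) =
    (if from_right (D ! j) then drop_across D g (j - 1) - drop_across D g i else 0)"
proof -
  have "(\<Sum>p\<in>{i<..<j}. turn D (drop_across D g) p) = g (Outgoing (j - 1)) - g (Outgoing i)"
    using potential_step[OF wf g] ij
    by (intro sum_telescope_pred[where G = "\<lambda>p. g (Outgoing p)"]) (auto simp: pred_pos_if)
  also have "\<dots> = (if from_right (D ! j) then drop_across D g (j - 1) - drop_across D g i else 0)"
    using potential_corner[OF wf g, of i] ij by (simp add: pred_pos_if)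
  finally show ?thesis .
qed

definition face_value :: "gauss_code \<Rightarrow> (half_edge set \<Rightarrow> int) \<Rightarrow> half_edge \<Rightarrow> int" where
  "face_value D f e = f (orbit (face_step D) e)"

lemma potential_face_value:
  assumes wf: "well_formed D"
  shows "potential D (face_value D f)"
  unfolding potential_def face_value_def
proof
  fix e assume e: "e \<in> half_edges D"
  have "orbit (face_step D) (face_step D (opposite_end D e)) = orbit (face_step D) (opposite_end D e)"
    using e face_step_in[OF wf] inj_on_face_step[OF wf]
    by (intro orbit_step_eq[of "half_edges D"]) (auto simp: opposite_end_in simp del: comp_apply)
  then show "f (orbit (face_step D) (next_ccw D e)) = f (orbit (face_step D) (opposite_end D e))"
    by (simp add: opposite_end_opposite_end[OF e])
qed

definition over_passages :: "gauss_code \<Rightarrow> nat set" where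
  "over_passages D = {p. p < length D \<and> fst (snd (D ! p)) = Over}"

lemma finite_over_passages [simp]: "finite (over_passages D)"
  by (simp add: over_passages_def)

lemma card_over_passages:
  assumes wf: "well_formed D"
  shows "card (over_passages D) = card (crossings D)"
proof (rule bij_betw_same_card[of "\<lambda>p. fst (D ! p)"], rule bij_betwI')
  fix p q assume p: "p \<in> over_passages D" and q: "q \<in> over_passages D"
  obtain c l e where c: "D ! p = (c, l, e)" by (cases "D ! p") auto
  show "fst (D ! p) = fst (D ! q) \<longleftrightarrow> p = q"
  proof (rule iffI, rule ccontr)
    assume "fst (D ! p) = fst (D ! q)" "p \<noteq> q"
    then have "D ! q = (c, other_level l, e)"
      using p q c by (intro partner_unique(2)[OF wf _ c]) (auto simp: over_passages_def)
    then show False using p q c by (simp add: over_passages_def)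
  qed simp
next
  fix p assume "p \<in> over_passages D"
  then show "fst (D ! p) \<in> crossings D" by (auto simp: over_passages_def crossings_def)
next
  fix c assume "c \<in> crossings D"
  then obtain l e where "(c, l, e) \<in> set D" by (auto simp: crossings_def)
  then have "(c, Over, e) \<in> set D" using well_formed_mate[OF wf] by (cases l) fastforce+
  then obtain p where "p < length D" "D ! p = (c, Over, e)" by (metis in_set_conv_nth)
  then show "\<exists>p\<in>over_passages D. c = fst (D ! p)"
    by (intro bexI[of _ p]) (auto simp: over_passages_def)
qed

definition jump :: "gauss_code \<Rightarrow> (nat \<Rightarrow> int) \<Rightarrow> nat \<Rightarrow> int" where
  "jump D y p = y p - y (pred_pos D p)"

text \<open>
  Kirchhoff's law ties the jump at an underpass to that at the overpass of the same crossing, so that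
  the overpasses and one edge determine a flow.
\<close>

lemma flow_eqI_mod:
  assumes wf: "well_formed D" and x: "flow D x" and y: "flow D y" and 0: "x 0 mod m = y 0 mod m"
    and over: "\<And>p. p \<in> over_passages D \<Longrightarrow> jump D x p mod m = jump D y p mod m"
    and p: "p < length D"
  shows "x p mod m = y p mod m"
proof -
  have jump: "jump D x p mod m = jump D y p mod m" if p: "p < length D" for p
  proof (cases "p \<in> over_passages D")
    case False
    obtain c l e where c: "D ! p = (c, l, e)" by (cases "D ! p") auto
    have "l = Under" using False p c by (cases l) (auto simp: over_passages_def)
    then have "partner D p \<in> over_passages D"
      using nth_partner[OF wf p c] partner_props[OF wf p] by (simp add: over_passages_def)
    then have "(- jump D x (partner D p)) mod m = (- jump D y (partner D p)) mod m"
      using over by (intro mod_minus_cong) blast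
    moreover have "jump D x p = - jump D x (partner D p)" "jump D y p = - jump D y (partner D p)"
      using x y p by (auto simp: flow_def jump_def)
    ultimately show ?thesis by simp
  qed (use over in blast)
  from p show ?thesis
  proof (induction p)
    case (Suc p)
    have "(x p + jump D x (Suc p)) mod m = (y p + jump D y (Suc p)) mod m"
      using Suc jump[of "Suc p"] by (intro mod_add_cong) auto
    then show ?case using Suc.prems by (simp add: jump_def pred_pos_if)
  qed (use 0 in simp)
qed

lemma turn_cong_mod:
  assumes wf: "well_formed D" and p: "p < length D"
    and "\<And>p. p < length D \<Longrightarrow> x p mod m = y p mod m"
  shows "turn D x p mod m = turn D y p mod m"
  using assms partner_props[OF wf p] by (auto simp: turn_def pred_pos_less intro: mod_minus_cong)

lemma potential_eqI_mod:
  assumes wf: "well_formed D" and g: "potential D g" "potential D h"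
    and 0: "g (Outgoing 0) mod m = h (Outgoing 0) mod m"
    and drop: "\<And>p. p < length D \<Longrightarrow> drop_across D g p mod m = drop_across D h p mod m"
    and e: "e \<in> half_edges D"
  shows "g e mod m = h e mod m"
proof -
  have out: "g (Outgoing p) mod m = h (Outgoing p) mod m" if "p < length D" for p
    using that
  proof (induction p)
    case (Suc p)
    have "(g (Outgoing p) + turn D (drop_across D g) (Suc p)) mod m =
          (h (Outgoing p) + turn D (drop_across D h) (Suc p)) mod m"
      using Suc drop by (intro mod_add_cong turn_cong_mod[OF wf]) auto
    then show ?case
      using potential_step[OF wf g(1) Suc.prems] potential_step[OF wf g(2) Suc.prems] Suc.prems
      by (simp add: pred_pos_if)
  qed (use 0 in simp)
  from e show ?thesis
  proof (cases rule: half_edges_cases)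
    case (inc p)
    have "(g (Outgoing (pred_pos D p)) - drop_across D g (pred_pos D p)) mod m =
          (h (Outgoing (pred_pos D p)) - drop_across D h (pred_pos D p)) mod m"
      using inc by (intro mod_diff_cong out drop) (auto simp: pred_pos_less)
    then show ?thesis using inc by (simp add: drop_across_pred)
  qed (use out in simp)
qed

text \<open>
  This is where genus 0 is used: the first homology of the sphere vanishes. The proof counts instead
  of computing ranks. A function from the \<open>n + 2\<close> faces to the residues modulo \<open>m\<close> is determined by
  its value at one half-edge, the drop across one edge, and the jump of the drop at each of the \<open>n\<close>
  crossings; these data range over a set with the same number \<open>m ^ (n + 2)\<close> of elements, so every
  choice of data occurs, in particular the data of a prescribed flow.
\<close>

lemma flow_has_potential_mod:
  assumes D: "knot_diagram D" "D \<noteq> []" and y: "flow D y" and m: "m > 0"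
  obtains g where "potential D g" "\<And>p. p < length D \<Longrightarrow> drop_across D g p mod m = y p mod m"
proof -
  have wf: "well_formed D" and euler: "card (faces D) = card (crossings D) + 2"
    using D by (auto simp: knot_diagram_def)
  define R where "R = {0..<m}"
  define H where "H = faces D \<rightarrow>\<^sub>E R"
  define T where "T = R \<times> R \<times> (over_passages D \<rightarrow>\<^sub>E R)"
  define data where "data = (\<lambda>g. (g (Outgoing 0) mod m, drop_across D g 0 mod m,
      \<lambda>p\<in>over_passages D. jump D (drop_across D g) p mod m))"
  have fin: "finite (faces D)" "finite R" by (simp_all add: faces_def R_def)
  have finT: "finite T" unfolding T_def using fin by (intro finite_cartesian_product finite_PiE) auto
  have cards: "card H = card T"
    using euler card_over_passages[OF wf] fin
    by (simp add: H_def T_def card_PiE card_cartesian_product)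
  have maps: "(data \<circ> face_value D) ` H \<subseteq> T"
    using m by (auto simp: data_def T_def R_def)
  have "inj_on (data \<circ> face_value D) H"
  proof (rule inj_onI)
    fix f h assume f: "f \<in> H" and h: "h \<in> H"
      and eq: "(data \<circ> face_value D) f = (data \<circ> face_value D) h"
    let ?g = "face_value D f" and ?h = "face_value D h"
    have pot: "potential D ?g" "potential D ?h" using potential_face_value[OF wf] by blast+
    have flows: "flow D (drop_across D ?g)" "flow D (drop_across D ?h)"
      using flow_drop_across[OF wf] pot by blast+
    have jumps: "jump D (drop_across D ?g) p mod m = jump D (drop_across D ?h) p mod m"
      if "p \<in> over_passages D" for p
    proof -
      have "(\<lambda>p\<in>over_passages D. jump D (drop_across D ?g) p mod m) p =
            (\<lambda>p\<in>over_passages D. jump D (drop_across D ?h) p mod m) p"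
        using eq by (simp add: data_def)
      then show ?thesis using that by simp
    qed
    have first: "?g (Outgoing 0) mod m = ?h (Outgoing 0) mod m"
      and second: "drop_across D ?g 0 mod m = drop_across D ?h 0 mod m"
      using eq by (simp_all add: data_def)
    have "?g e mod m = ?h e mod m" if "e \<in> half_edges D" for e
      by (rule potential_eqI_mod[OF wf pot first flow_eqI_mod[OF wf flows second jumps] that])
    moreover have "f F \<in> R" "h F \<in> R" if "F \<in> faces D" for F
      using f h that by (auto simp: H_def)
    ultimately have "f F = h F" if "F \<in> faces D" for F
      using that by (fastforce simp: faces_def face_value_def R_def)
    then show "f = h" using f h unfolding H_def by (intro PiE_ext) auto
  qed
  then have "card ((data \<circ> face_value D) ` H) = card T" using cards by (simp only: card_image)
  then have "(data \<circ> face_value D) ` H = T" by (rule card_subset_eq[OF finT maps])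
  moreover have "(0, y 0 mod m, \<lambda>p\<in>over_passages D. jump D y p mod m) \<in> T"
    using m by (auto simp: T_def R_def)
  ultimately obtain f where "data (face_value D f) = (0, y 0 mod m, \<lambda>p\<in>over_passages D. jump D y p mod m)"
    by (auto elim!: imageE simp del: Pair_inject)
  note f = this[unfolded data_def prod.inject]
  have pot: "potential D (face_value D f)" by (rule potential_face_value[OF wf])
  have "jump D (drop_across D (face_value D f)) p mod m = jump D y p mod m"
    if "p \<in> over_passages D" for p
    using f that by (metis (no_types, lifting) restrict_apply')
  note jumps = this
  have second: "drop_across D (face_value D f) 0 mod m = y 0 mod m" using f by simp
  show thesis
    using that[OF pot flow_eqI_mod[OF wf flow_drop_across[OF wf pot] y second jumps]] .
qed

text \<open>
  On the sphere a loop of the knot and any flow have intersection number zero. An integer is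
  determined by its residue modulo a number that exceeds its absolute value, so the potentials
  modulo \<open>m\<close> suffice.
\<close>

theorem loop_intersection_flow:
  assumes D: "knot_diagram D" and y: "flow D y" and ij: "i < j" "j < length D" "partner D i = j"
  shows "(\<Sum>p\<in>{i<..<j}. turn D y p) = (if from_right (D ! j) then y (j - 1) - y i else 0)"
    (is "?l = ?r")
proof -
  have wf: "well_formed D" and "D \<noteq> []" using D ij by (auto simp: knot_diagram_def)
  define m where "m = \<bar>?l - ?r\<bar> + 1"
  have "m > 0" by (simp add: m_def)
  then obtain g where g: "potential D g"
    and drop: "\<And>p. p < length D \<Longrightarrow> drop_across D g p mod m = y p mod m"
    using flow_has_potential_mod[OF D \<open>D \<noteq> []\<close> y] by blast
  have "?l mod m = (\<Sum>p\<in>{i<..<j}. turn D y p mod m) mod m" by (simp add: mod_sum_eq)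
  also have "(\<Sum>p\<in>{i<..<j}. turn D y p mod m) = (\<Sum>p\<in>{i<..<j}. turn D (drop_across D g) p mod m)"
    using ij drop by (intro sum.cong turn_cong_mod[OF wf]) auto
  also have "\<dots> mod m = (\<Sum>p\<in>{i<..<j}. turn D (drop_across D g) p) mod m" by (simp add: mod_sum_eq)
  also have "\<dots> = ?r mod m"
    unfolding loop_intersection_potential[OF wf g ij]
    using drop[of "j - 1"] drop[of i] ij by (auto intro: mod_diff_cong)
  finally have "m dvd ?l - ?r" by (simp add: mod_eq_dvd_iff)
  then show ?thesis
    using zdvd_imp_le[of m "\<bar>?l - ?r\<bar>"] by (cases "?l = ?r") (auto simp: m_def)
qed

section \<open>Intersection numbers of loops\<close>

definition passage_sign :: "passage \<Rightarrow> int" where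
  "passage_sign x = (if from_right x then 1 else - 1)"

text \<open>
  The flow here is the whole knot: a loop and the knot have intersection number zero.
\<close>

lemma loop_balanced:
  assumes D: "knot_diagram D" and ij: "i < j" "j < length D" "partner D i = j"
  shows "(\<Sum>p\<in>{i<..<j}. passage_sign (D ! p)) = 0"
proof -
  have "flow D (\<lambda>_. 1)" by (simp add: flow_def)
  from loop_intersection_flow[OF D this ij]
  show ?thesis by (simp add: turn_def passage_sign_def cong: if_cong)
qed

text \<open>
  The flow of the loop between the two passages \<open>k < m\<close> of a crossing.
\<close>

definition arc :: "nat \<Rightarrow> nat \<Rightarrow> nat \<Rightarrow> int" where
  "arc k m p = of_bool (k \<le> p \<and> p < m)"

lemma arc_pred: "k < m \<Longrightarrow> m < length D \<Longrightarrow> p < length D \<Longrightarrow>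
    arc k m (pred_pos D p) = of_bool (k < p \<and> p \<le> m)"
  by (auto simp: arc_def pred_pos_if)

lemma flow_arc:
  assumes wf: "well_formed D" and km: "k < m" "m < length D" "partner D k = m"
  shows "flow D (arc k m)"
proof -
  have jump: "arc k m p - arc k m (pred_pos D p) = of_bool (p = k) - of_bool (p = m)"
    if "p < length D" for p
    using km that by (auto simp: arc_pred) (auto simp: arc_def)
  have mk: "partner D m = k" using wf km partner_partner[OF wf, of k] by simp
  show ?thesis
    unfolding flow_def
  proof (intro allI impI)
    fix p assume p: "p < length D"
    have ends: "partner D p = k \<longleftrightarrow> p = m" "partner D p = m \<longleftrightarrow> p = k"
      using km(3) mk partner_partner[OF wf p] by metis+
    show "arc k m p - arc k m (pred_pos D p) +
        (arc k m (partner D p) - arc k m (pred_pos D (partner D p))) = 0"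
      unfolding jump[OF p] jump[OF partner_props(1)[OF wf p]] ends by simp
  qed
qed

lemma turn_arc:
  assumes wf: "well_formed D" and km: "k < m" "m < length D" "partner D k = m" and p: "p < length D"
  shows "turn D (arc k m) p =
    passage_sign (D ! p) * of_bool (k < partner D p \<and> partner D p < m)
    + (of_bool (p = k \<and> from_right (D ! k)) - of_bool (p = m \<and> \<not> from_right (D ! m)))"
proof -
  have mk: "partner D m = k" using wf km partner_partner[OF wf, of k] by simp
  consider "p = k" | "p = m" | "p \<noteq> k" "p \<noteq> m" "partner D p \<noteq> k" "partner D p \<noteq> m"
    using km(3) mk partner_partner[OF wf p] by metis
  then show ?thesis
  proof cases
    case 1
    then show ?thesis using km by (auto simp: turn_def arc_pred) (auto simp: arc_def)
  next
    case 2
    then show ?thesis using km mk by (auto simp: turn_def arc_pred) (auto simp: arc_def)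
  next
    case 3
    then show ?thesis
      using km partner_props(1)[OF wf p] by (auto simp: turn_def arc_pred passage_sign_def) (auto simp: arc_def)
  qed
qed

text \<open>
  The correction terms come from the two corners when one loop passes through the corner of the
  other.
\<close>

lemma loop_loop_intersection:
  assumes D: "knot_diagram D" and ij: "i < j" "j < length D" "partner D i = j"
    and km: "k < m" "m < length D" "partner D k = m"
  shows "(\<Sum>p\<in>{i<..<j}. passage_sign (D ! p) * of_bool (k < partner D p \<and> partner D p < m)) =
    (if from_right (D ! j) then arc k m (j - 1) - arc k m i else 0)
    - of_bool (i < k \<and> k < j \<and> from_right (D ! k)) + of_bool (i < m \<and> m < j \<and> \<not> from_right (D ! m))"
proof -
  have wf: "well_formed D" using D by (simp add: knot_diagram_def)
  have single: "(\<Sum>p\<in>{i<..<j}. of_bool (p = q \<and> Q)) = (of_bool (i < q \<and> q < j \<and> Q) :: int)" for q Q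
    by (cases Q) (simp_all add: of_bool_def)
  have "(\<Sum>p\<in>{i<..<j}. turn D (arc k m) p) =
    (\<Sum>p\<in>{i<..<j}. passage_sign (D ! p) * of_bool (k < partner D p \<and> partner D p < m))
    + (\<Sum>p\<in>{i<..<j}. of_bool (p = k \<and> from_right (D ! k)) - of_bool (p = m \<and> \<not> from_right (D ! m)))"
    using turn_arc[OF wf km] ij by (subst sum.distrib[symmetric], intro sum.cong) auto
  also have "(\<Sum>p\<in>{i<..<j}. of_bool (p = k \<and> from_right (D ! k)) - of_bool (p = m \<and> \<not> from_right (D ! m))) =
      (of_bool (i < k \<and> k < j \<and> from_right (D ! k)) - of_bool (i < m \<and> m < j \<and> \<not> from_right (D ! m)) :: int)"
    by (simp only: sum_subtractf single)
  finally show ?thesis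
    using loop_intersection_flow[OF D flow_arc[OF wf km] ij] by simp
qed

lemma disjoint_loops_intersection:
  assumes D: "knot_diagram D" and ij: "i < j" "j < length D" "partner D i = j"
    and km: "k < m" "m < length D" "partner D k = m"
    and nc: "j < k \<or> m < i \<or> (i < k \<and> m < j) \<or> (k < i \<and> j < m)"
  shows "(\<Sum>p\<in>{i<..<j}. passage_sign (D ! p) * of_bool (k < partner D p \<and> partner D p < m)) = 0"
proof -
  have wf: "well_formed D" using D by (simp add: knot_diagram_def)
  have "from_right (D ! m) \<longleftrightarrow> \<not> from_right (D ! k)"
    using from_right_partner[OF wf, of k] km by simp
  then show ?thesis
    using ij km nc unfolding loop_loop_intersection[OF D ij km] by (auto simp: arc_def)
qed

lemma crossing_loops_intersection:
  assumes D: "knot_diagram D" and ij: "i < j" "j < length D" "partner D i = j"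
    and km: "k < m" "m < length D" "partner D k = m"
    and c: "i < k" "k < j" "j < m"
  shows "(\<Sum>p\<in>{i<..<j}. passage_sign (D ! p) * of_bool (k < partner D p \<and> partner D p < m))
    + of_bool (from_right (D ! k)) = of_bool (from_right (D ! j))"
  using ij km c unfolding loop_loop_intersection[OF D ij km] by (auto simp: arc_def)

section \<open>Rotating a code\<close>

lemma orbit_image_commute:
  assumes "\<And>e. e \<in> S \<Longrightarrow> f e \<in> S \<and> g (r e) = r (f e)" and e: "e \<in> S"
  shows "orbit g (r e) = r ` orbit f e"
proof -
  have "(f ^^ n) e \<in> S \<and> (g ^^ n) (r e) = r ((f ^^ n) e)" for n
    by (induction n) (use assms in auto)
  then show ?thesis by (auto simp: orbit_altdef)
qed

lemma well_formed_cong: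
  assumes "set D = set E" "distinct E" "well_formed D"
  shows "well_formed E"
  using assms by (simp add: well_formed_def)

lemma knot_diagram_rotate1:
  assumes D: "knot_diagram D"
  shows "knot_diagram (rotate1 D)"
proof (cases "D = []")
  case False
  define E where "E = rotate1 D"
  have wf: "well_formed D" and euler: "card (faces D) = card (crossings D) + 2"
    using D False by (auto simp: knot_diagram_def)
  have wfE: "well_formed E"
    by (rule well_formed_cong[OF _ _ wf]) (auto simp: E_def well_formed_distinct[OF wf])
  have len: "length E = length D" by (simp add: E_def)
  have nth: "E ! p = D ! succ_pos D p" if "p < length D" for p
    using that by (simp add: E_def nth_rotate1 succ_pos_def)
  have inj: "succ_pos D p = succ_pos D q \<longleftrightarrow> p = q" if "p < length D" "q < length D" for p q
    using that pred_succ_pos by metis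
  have partner: "partner D (succ_pos D p) = succ_pos D (partner E p)" if "p < length D" for p
    using that partner_props[OF wfE, of p] nth[of p] nth[of "partner E p"] inj[of "partner E p" p]
    by (intro partner_eqI[OF wf]) (simp_all add: succ_pos_less len)
  have pos: "succ_pos E p = succ_pos D p" "pred_pos E p = pred_pos D p" for p
    by (simp_all add: succ_pos_def pred_pos_def len)
  have HE: "half_edges E = half_edges D" by (simp add: half_edges_def len)
  \<comment> \<open>the half-edges of the rotated code, named by their positions in the original one\<close>
  define r where "r e = (case e of Incoming p \<Rightarrow> Incoming (succ_pos D p) | Outgoing p \<Rightarrow> Outgoing (succ_pos D p))" for e
  have r_simps: "r (Incoming p) = Incoming (succ_pos D p)" "r (Outgoing p) = Outgoing (succ_pos D p)" for p
    by (simp_all add: r_def)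
  have r_in: "r e \<in> half_edges D" if "e \<in> half_edges D" for e
    using that by (cases rule: half_edges_cases) (simp_all add: r_simps succ_pos_less)
  have r_onto: "\<exists>e'\<in>half_edges D. e = r e'" if "e \<in> half_edges D" for e
    using that
  proof (cases rule: half_edges_cases)
    case (out p)
    then show ?thesis by (intro bexI[of _ "Outgoing (pred_pos D p)"]) (simp_all add: r_simps pred_pos_less)
  next
    case (inc p)
    then show ?thesis by (intro bexI[of _ "Incoming (pred_pos D p)"]) (simp_all add: r_simps pred_pos_less)
  qed
  have inj_r: "inj_on r (half_edges D)"
    by (rule inj_onI, elim half_edges_cases) (auto simp: r_simps inj)
  have opp: "opposite_end D (r e) = r (opposite_end E e)" if "e \<in> half_edges D" for e
    using that by (cases rule: half_edges_cases) (simp_all add: r_simps opposite_end_simps pos)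
  have nxt: "next_ccw D (r e) = r (next_ccw E e)" if "e \<in> half_edges D" for e
    using that
    by (cases rule: half_edges_cases) (auto simp: r_simps next_ccw.simps nth partner)
  have commute: "face_step E e \<in> half_edges D \<and> face_step D (r e) = r (face_step E e)"
    if "e \<in> half_edges D" for e
    using that face_step_in[OF wfE, of e] opposite_end_in[of e E]
    by (simp add: HE opp nxt)
  have orb: "orbit (face_step D) (r e) = r ` orbit (face_step E) e" if "e \<in> half_edges D" for e
    using commute that by (rule orbit_image_commute[where S = "half_edges D"])
  have "faces D = (`) r ` faces E"
    unfolding faces_def HE using orb r_onto r_in by (auto simp: image_iff) (metis+)
  moreover have "inj_on ((`) r) (faces E)"
  proof (rule inj_on_subset[OF inj_on_image_Pow[OF inj_r]])
    have "orbit (face_step E) e \<subseteq> half_edges D" if "e \<in> half_edges D" for e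
    proof
      fix x assume "x \<in> orbit (face_step E) e"
      then show "x \<in> half_edges D" by induction (use commute that in blast)+
    qed
    then show "faces E \<subseteq> Pow (half_edges D)" unfolding faces_def HE by blast
  qed
  ultimately have "card (faces E) = card (faces D)" by (simp add: card_image)
  moreover have "crossings E = crossings D" by (simp add: crossings_def E_def)
  ultimately show ?thesis using wfE euler by (simp add: knot_diagram_def E_def)
qed (use D in simp)

lemma knot_diagram_rotate: "knot_diagram D \<Longrightarrow> knot_diagram (rotate n D)"
  by (induction n) (simp_all add: knot_diagram_rotate1)

lemma rotate_back:
  obtains m where "rotate m (rotate n D) = D"
proof
  have "(length D - n mod length D + n) mod length D = 0" if "D \<noteq> []"
  proof -
    have "n mod length D < length D" using that by simp
    then have "length D - n mod length D + n = length D + length D * (n div length D)"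
      using mult_div_mod_eq[of "length D" n] by linarith
    then show ?thesis by simp
  qed
  then show "rotate (length D - n mod length D) (rotate n D) = D"
    unfolding rotate_rotate by (cases "D = []") (simp, rule rotate_id, simp only: not_False_eq_True)
qed

section \<open>The Casson invariant\<close>

definition restrict_to :: "nat set \<Rightarrow> gauss_code \<Rightarrow> gauss_code" where
  "restrict_to S D = filter (\<lambda>x. fst x \<in> S) D"

lemma restrict_to_simps [simp]:
  "restrict_to S [] = []"
  "restrict_to S (x # D) = (if fst x \<in> S then x # restrict_to S D else restrict_to S D)"
  "restrict_to S (D @ E) = restrict_to S D @ restrict_to S E"
  by (simp_all add: restrict_to_def)

lemma restrict_to_empty: "S \<inter> crossings D = {} \<Longrightarrow> restrict_to S D = []"
  by (auto simp: restrict_to_def crossings_def filter_empty_conv)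

text \<open>
  The contribution of the ordered pair \<open>(a, b)\<close> to the formula of Polyak and Viro, as a function of the
  four letters of the word that belong to the two crossings. Looking at these four letters alone
  makes most of the invariance a matter of comparing filtered words.
\<close>

definition interlacing :: "level \<Rightarrow> nat \<Rightarrow> nat \<Rightarrow> gauss_code \<Rightarrow> int" where
  "interlacing l a b W = (if a = b then 0 else \<Sum>e\<in>{Positive, Negative}. \<Sum>f\<in>{Positive, Negative}.
     if W = [(a, l, e), (b, other_level l, f), (a, other_level l, e), (b, l, f)]
     then crossing_sign e * crossing_sign f else 0)"

lemma interlacing_self [simp]: "interlacing l a a W = 0"
  by (simp add: interlacing_def)

text \<open>
  The formula of Polyak and Viro for the coefficient of \<open>z\<^sup>2\<close> in the Conway polynomial, with the base
  point at the beginning of the word. The two choices of \<open>l\<close> are mirror images of each other and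
  give the same number for a diagram on the sphere, but different constraints when it vanishes.
\<close>

definition casson :: "level \<Rightarrow> gauss_code \<Rightarrow> int" where
  "casson l D = (\<Sum>a\<in>crossings D. \<Sum>b\<in>crossings D. interlacing l a b (restrict_to {a, b} D))"

lemma finite_crossings [simp]: "finite (crossings D)"
  by (simp add: crossings_def)

lemma interlacing_nonzeroD:
  assumes "interlacing l a b W \<noteq> 0"
  obtains e f where "W = [(a, l, e), (b, other_level l, f), (a, other_level l, e), (b, l, f)]"
  using assms by (auto simp: interlacing_def split: if_splits)

lemma interlacing_restrict_outside:
  assumes "a \<notin> crossings D \<or> b \<notin> crossings D"
  shows "interlacing l a b (restrict_to {a, b} D) = 0"
proof (rule ccontr)
  assume "interlacing l a b (restrict_to {a, b} D) \<noteq> 0"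
  then obtain e f where
    "restrict_to {a, b} D = [(a, l, e), (b, other_level l, f), (a, other_level l, e), (b, l, f)]"
    by (rule interlacing_nonzeroD)
  then have "{a, b} \<subseteq> fst ` set (restrict_to {a, b} D)" by simp
  then have "{a, b} \<subseteq> crossings D" by (auto simp: crossings_def restrict_to_def)
  with assms show False by blast
qed

lemma casson_superset:
  assumes "finite S" "crossings D \<subseteq> S"
  shows "casson l D = (\<Sum>a\<in>S. \<Sum>b\<in>S. interlacing l a b (restrict_to {a, b} D))"
proof -
  have "casson l D = (\<Sum>a\<in>crossings D. \<Sum>b\<in>S. interlacing l a b (restrict_to {a, b} D))"
    unfolding casson_def
    by (intro sum.cong refl sum.mono_neutral_left assms) (auto intro: interlacing_restrict_outside)
  also have "\<dots> = (\<Sum>a\<in>S. \<Sum>b\<in>S. interlacing l a b (restrict_to {a, b} D))"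
    by (intro sum.mono_neutral_left assms) (auto intro!: sum.neutral interlacing_restrict_outside)
  finally show ?thesis .
qed

lemma casson_Nil [simp]: "casson l [] = 0"
  by (simp add: casson_def crossings_def)

section \<open>Reidemeister moves\<close>

lemma crossings_simps [simp]:
  "crossings [] = {}" "crossings (x # D) = insert (fst x) (crossings D)"
  "crossings (D @ E) = crossings D \<union> crossings E"
  by (auto simp: crossings_def)

lemma crossings_iff: "c \<in> crossings D \<longleftrightarrow> (\<exists>l e. (c, l, e) \<in> set D)"
  by (force simp: crossings_def)

lemma well_formed_third:
  assumes "well_formed D" "(c, l, e) \<in> set D" "(c, l', e') \<in> set D"
  shows "(c, l', e') = (c, l, e) \<or> (c, l', e') = (c, other_level l, e)"
  using well_formed_same_sign[OF assms] by (auto simp: level_neq_iff[symmetric])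

lemma casson_kink:
  assumes wf: "well_formed ([(a, l', e), (a, other_level l', e)] @ u)"
  shows "casson l ([(a, l', e), (a, other_level l', e)] @ u) = casson l u"
proof -
  let ?D = "[(a, l', e), (a, other_level l', e)] @ u"
  have a: "a \<notin> crossings u"
  proof
    assume "a \<in> crossings u"
    then obtain l'' e'' where x: "(a, l'', e'') \<in> set u" by (auto simp: crossings_def)
    then have "(a, l'', e'') = (a, l', e) \<or> (a, l'', e'') = (a, other_level l', e)"
      using well_formed_third[OF wf, of a l' e l'' e''] by simp
    then show False using x well_formed_distinct[OF wf] by auto
  qed
  have "interlacing l x y (restrict_to {x, y} ?D) = interlacing l x y (restrict_to {x, y} u)" for x y
  proof (cases "x = a \<or> y = a")
    case True
    then have "interlacing l x y (restrict_to {x, y} u) = 0"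
      using a by (intro interlacing_restrict_outside) auto
    moreover have "interlacing l x y (restrict_to {x, y} ?D) = 0"
      using True by (auto simp: interlacing_def)
    ultimately show ?thesis by simp
  qed simp
  then show ?thesis
    by (subst (1 2) casson_superset[of "insert a (crossings u)"]) auto
qed

lemma sum_sum_insert2:
  fixes g :: "nat \<Rightarrow> nat \<Rightarrow> int"
  assumes "finite T" "a \<notin> T" "b \<notin> T" "a \<noteq> b"
  shows "(\<Sum>x\<in>insert a (insert b T). \<Sum>y\<in>insert a (insert b T). g x y) =
    (\<Sum>x\<in>T. \<Sum>y\<in>T. g x y) + (\<Sum>y\<in>T. (g a y + g b y) + (g y a + g y b))
    + (g a a + g a b + g b a + g b b)"
  using assms by (simp add: sum.distrib algebra_simps)

text \<open>
  Two parallel crossings of opposite signs that meet a third crossing in the same way contribute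
  opposite terms.
\<close>

lemma interlacing_cancel:
  assumes y: "\<And>x. x \<in> set fu \<union> set fv \<Longrightarrow> fst x = y" and "y \<noteq> a" "y \<noteq> b"
  shows "interlacing l a y ((a, l', e) # fu @ (a, l'', e) # fv)
       + interlacing l b y ((b, l', other_hand e) # fu @ (b, l'', other_hand e) # fv) = 0"
    and "interlacing l y a ((a, l', e) # fu @ (a, l'', e) # fv)
       + interlacing l y b ((b, l', other_hand e) # fu @ (b, l'', other_hand e) # fv) = 0"
proof -
  have split: "fu = [] \<or> (\<exists>x. fu = [x]) \<or> (\<exists>x x' r. fu = x # x' # r)"
    by (cases fu; cases "tl fu") auto
  then show "interlacing l a y ((a, l', e) # fu @ (a, l'', e) # fv)
       + interlacing l b y ((b, l', other_hand e) # fu @ (b, l'', other_hand e) # fv) = 0"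
  proof (elim disjE exE)
    fix x x' r assume fu: "fu = x # x' # r"
    then show ?thesis using y[of x] y[of x'] assms(2,3) by (cases e) (auto simp: interlacing_def)
  qed (use assms(2,3) in \<open>cases e; auto simp: interlacing_def crossing_sign_def\<close>)+
  show "interlacing l y a ((a, l', e) # fu @ (a, l'', e) # fv)
       + interlacing l y b ((b, l', other_hand e) # fu @ (b, l'', other_hand e) # fv) = 0"
    using assms(2,3) by (auto simp: interlacing_def)
qed

text \<open>
  The two crossings themselves give the words \<open>a b a b\<close>, at levels \<open>l' l'\<close> and then the other level
  twice, or \<open>a b b a\<close>; neither is counted.
\<close>

lemma casson_R2:
  assumes wf: "well_formed D"
    and D: "D = [(a, l', e), (b, l', other_hand e)] @ u @ [A, B] @ v"
    and AB: "A = (a, other_level l', e) \<and> B = (b, other_level l', other_hand e) \<or>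
      B = (a, other_level l', e) \<and> A = (b, other_level l', other_hand e)"
  shows "casson l D = casson l (u @ v)"
proof -
  have a: "x \<noteq> a" "x \<noteq> b" if "x \<in> crossings (u @ v)" for x
  proof -
    obtain l0 e0 where x: "(x, l0, e0) \<in> set (u @ v)"
      using \<open>x \<in> crossings (u @ v)\<close> unfolding crossings_iff by blast
    have dist: "distinct D" by (rule well_formed_distinct[OF wf])
    show "x \<noteq> a"
    proof
      assume "x = a"
      then have "(x, l0, e0) = (a, l', e) \<or> (x, l0, e0) = (a, other_level l', e)"
        using well_formed_third[OF wf, of a l' e l0 e0] x by (auto simp: D)
      then show False using x dist AB by (auto simp: D)
    qed
    show "x \<noteq> b"
    proof
      assume "x = b"
      then have "(x, l0, e0) = (b, l', other_hand e) \<or> (x, l0, e0) = (b, other_level l', other_hand e)"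
        using well_formed_third[OF wf, of b l' "other_hand e" l0 e0] x by (auto simp: D)
      then show False using x dist AB by (auto simp: D)
    qed
  qed
  define T where "T = crossings (u @ v)"
  have T: "finite T" "a \<notin> T" "b \<notin> T" using a by (auto simp: T_def)
  have ab: "a \<noteq> b"
    using well_formed_same_sign[OF wf, of a l' e l' "other_hand e"] by (auto simp: D)
  have fAB: "fst A = a \<and> fst B = b \<or> fst A = b \<and> fst B = a" using AB by auto
  define g where "g x y = interlacing l x y (restrict_to {x, y} D)" for x y
  define h where "h x y = interlacing l x y (restrict_to {x, y} (u @ v))" for x y
  have crD: "crossings D = insert a (insert b T)"
    using fAB by (auto simp: D T_def)
  have gh: "g x y = h x y" if "x \<in> T" "y \<in> T" for x y
    using that T fAB by (auto simp: g_def h_def D)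
  have cancel: "g a y + g b y = 0" "g y a + g y b = 0" if y: "y \<in> T" for y
  proof -
    have "y \<noteq> a" "y \<noteq> b" using y T by auto
    let ?fu = "restrict_to {y} u" and ?fv = "restrict_to {y} v"
    have ra: "restrict_to {a, y} w = restrict_to {y} w" "restrict_to {b, y} w = restrict_to {y} w"
      if "w = u \<or> w = v" for w
    proof -
      have "fst x \<noteq> a \<and> fst x \<noteq> b" if "x \<in> set w" for x
        using a[of "fst x"] that \<open>w = u \<or> w = v\<close> by (auto simp: crossings_def)
      then show "restrict_to {a, y} w = restrict_to {y} w" "restrict_to {b, y} w = restrict_to {y} w"
        unfolding restrict_to_def by (intro filter_cong refl; auto)+
    qed
    have Wa: "restrict_to {a, y} D = (a, l', e) # ?fu @ (a, other_level l', e) # ?fv"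
      using AB ab \<open>y \<noteq> a\<close> \<open>y \<noteq> b\<close> by (auto simp: D ra)
    have Wb: "restrict_to {b, y} D = (b, l', other_hand e) # ?fu @ (b, other_level l', other_hand e) # ?fv"
      using AB ab \<open>y \<noteq> a\<close> \<open>y \<noteq> b\<close> by (auto simp: D ra)
    have fst_y: "\<And>x. x \<in> set ?fu \<union> set ?fv \<Longrightarrow> fst x = y" by (auto simp: restrict_to_def)
    note cancel = interlacing_cancel[OF fst_y \<open>y \<noteq> a\<close> \<open>y \<noteq> b\<close>,
        where l = l and l' = l' and e = e and l'' = "other_level l'"]
    show "g a y + g b y = 0" using cancel(1) unfolding g_def Wa Wb .
    show "g y a + g y b = 0"
      using cancel(2) unfolding g_def insert_commute[of y a "{}"] insert_commute[of y b "{}"] Wa Wb .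
  qed
  have ruv: "restrict_to {a, b} u = []" "restrict_to {a, b} v = []"
    using T by (auto intro!: restrict_to_empty simp: T_def)
  have "g a b = 0" "g b a = 0"
    using AB ab ruv unfolding g_def insert_commute[of b a "{}"] by (auto simp: D interlacing_def)
  moreover have "g a a = 0" "g b b = 0" by (simp_all add: g_def)
  moreover have "casson l D = (\<Sum>x\<in>insert a (insert b T). \<Sum>y\<in>insert a (insert b T). g x y)"
    using T by (subst casson_superset[of "insert a (insert b T)"]) (simp_all add: crD g_def)
  ultimately have "casson l D = (\<Sum>x\<in>T. \<Sum>y\<in>T. g x y)"
    unfolding sum_sum_insert2[OF T ab] using cancel by simp
  also have "\<dots> = (\<Sum>x\<in>T. \<Sum>y\<in>T. h x y)" using gh by simp
  also have "\<dots> = casson l (u @ v)" by (simp add: casson_def h_def T_def)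
  finally show ?thesis .
qed

section \<open>Moving the base point\<close>

lemma two_element_list:
  assumes "distinct xs" "set xs = {A, B}" "A \<noteq> B"
  shows "xs = [A, B] \<or> xs = [B, A]"
proof -
  have "length xs = 2" using assms distinct_card[OF assms(1)] by simp
  then obtain x y where "xs = [x, y]"
    by (metis One_nat_def Suc_1 length_0_conv length_Suc_conv)
  then show ?thesis using assms by (auto simp: doubleton_eq_iff)
qed

lemma restrict_to_single:
  assumes wf: "well_formed D" and y: "y \<in> crossings D"
  obtains l e where "restrict_to {y} D = [(y, l, e), (y, other_level l, e)]"
proof -
  obtain l e where yle: "(y, l, e) \<in> set D" using y unfolding crossings_iff by blast
  have "set (restrict_to {y} D) = {(y, l, e), (y, other_level l, e)}"
  proof (rule set_eqI)
    fix x show "x \<in> set (restrict_to {y} D) \<longleftrightarrow> x \<in> {(y, l, e), (y, other_level l, e)}"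
      using well_formed_third[OF wf yle, of "fst (snd x)" "snd (snd x)"] yle well_formed_mate[OF wf yle]
      by (cases x) (auto simp: restrict_to_def)
  qed
  moreover have "distinct (restrict_to {y} D)"
    using well_formed_distinct[OF wf] by (simp add: restrict_to_def)
  ultimately have "restrict_to {y} D = [(y, l, e), (y, other_level l, e)] \<or>
      restrict_to {y} D = [(y, other_level l, e), (y, l, e)]"
    by (intro two_element_list) auto
  then show thesis using that[of l e] that[of "other_level l" e] by auto
qed

lemma sum_restrict_to:
  fixes g :: "passage \<Rightarrow> int"
  assumes "finite T" "crossings v \<subseteq> T"
  shows "(\<Sum>y\<in>T. sum_list (map g (restrict_to {y} v))) = sum_list (map g v)"
  using assms(2)
proof (induction v)
  case (Cons x v)
  have "(\<Sum>y\<in>T. sum_list (map g (restrict_to {y} (x # v)))) =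
        (\<Sum>y\<in>T. (if fst x = y then g x else 0) + sum_list (map g (restrict_to {y} v)))"
    by (intro sum.cong) auto
  also have "\<dots> = g x + sum_list (map g v)"
    using Cons assms(1) by (simp add: sum.distrib)
  finally show ?case by simp
qed simp

lemma loop_balanced_list:
  assumes D: "knot_diagram ([x] @ v @ [y] @ w)" and xy: "fst x = fst y"
  shows "sum_list (map passage_sign v) = 0"
proof -
  let ?D = "[x] @ v @ [y] @ w" and ?j = "Suc (length v)"
  have wf: "well_formed ?D" using D by (simp add: knot_diagram_def)
  have nth: "?D ! ?j = y" "?D ! 0 = x" by (simp_all add: nth_append)
  have part: "partner ?D 0 = ?j" using xy nth by (intro partner_eqI[OF wf]) auto
  have "(\<Sum>p\<in>{0<..<?j}. passage_sign (?D ! p)) = 0"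
    using loop_balanced[OF D _ _ part] by simp
  also have "{0<..<?j} = Suc ` {..<length v}"
  proof (rule set_eqI)
    fix p show "p \<in> {0<..<?j} \<longleftrightarrow> p \<in> Suc ` {..<length v}" by (cases p) auto
  qed
  also have "(\<Sum>p\<in>Suc ` {..<length v}. passage_sign (?D ! p)) = (\<Sum>p<length v. passage_sign (v ! p))"
    by (subst sum.reindex) (auto simp: nth_append)
  also have "\<dots> = sum_list (map passage_sign v)"
    by (simp add: sum_list_sum_nth atLeast0LessThan)
  finally show ?thesis .
qed

text \<open>
  Moving the base point over one passage of \<open>a\<close> replaces the pairs in which \<open>a\<close> comes first by those in
  which it comes last. The difference sees only the passages of \<open>y\<close> inside the loop at \<open>a\<close>.
\<close>

lemma base_point_change:
  assumes y: "y \<noteq> a" and f: "fv @ fw = [(y, l', f), (y, other_level l', f)]"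
  shows "interlacing l a y ((a, l, e) # fv @ (a, other_level l, e) # fw)
       - interlacing l y a (fv @ (a, other_level l, e) # fw @ [(a, l, e)])
       = crossing_sign e * (if l = Under then 1 else - 1) * sum_list (map passage_sign fv)"
proof -
  have "fv = [] \<and> fw = [(y, l', f), (y, other_level l', f)] \<or>
        fv = [(y, l', f)] \<and> fw = [(y, other_level l', f)] \<or>
        fv = [(y, l', f), (y, other_level l', f)] \<and> fw = []"
    using f by (cases fv; cases "tl fv") auto
  then show ?thesis
    using y by (elim disjE; cases l; cases l'; cases e; cases f)
      (simp_all add: interlacing_def crossing_sign_def passage_sign_def from_right_def)
qed

text \<open>
  Summed over all crossings, the changes in \<open>base_point_change\<close> give the intersection number of the
  loop at the first crossing with the knot, which is zero for a diagram on the sphere.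
\<close>

lemma casson_rotate1:
  assumes D: "knot_diagram D"
  shows "casson l (rotate1 D) = casson l D"
proof (cases D)
  case (Cons x t)
  have wf: "well_formed D" using D by (simp add: knot_diagram_def)
  obtain a lv e where x: "x = (a, lv, e)" by (cases x)
  define T where "T = crossings D - {a}"
  have T: "finite T" "a \<notin> T" by (simp_all add: T_def)
  have cr: "crossings D = insert a T" "crossings (t @ [x]) = insert a T"
    by (auto simp: T_def Cons x)
  define g where "g p q = interlacing l p q (restrict_to {p, q} D)" for p q
  define h where "h p q = interlacing l p q (restrict_to {p, q} (t @ [x]))" for p q
  have split: "(\<Sum>p\<in>insert a T. \<Sum>q\<in>insert a T. k p q) =
      (\<Sum>p\<in>T. \<Sum>q\<in>T. k p q) + (\<Sum>y\<in>T. k a y + k y a) + k a a" for k :: "nat \<Rightarrow> nat \<Rightarrow> int"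
    using T by (simp add: sum.distrib)
  have gh: "g p q = h p q" if "p \<in> T" "q \<in> T" for p q
    using that T(2) by (auto simp: g_def h_def Cons x)
  have "g y a = 0" if "y \<in> T" for y
    using that T(2) by (auto simp: g_def Cons x interlacing_def)
  moreover have "h a y = 0" if "y \<in> T" for y
  proof (rule ccontr)
    assume "h a y \<noteq> 0"
    then obtain e' f' where "restrict_to {a, y} (t @ [x]) =
        [(a, l, e'), (y, other_level l, f'), (a, other_level l, e'), (y, l, f')]"
      unfolding h_def by (rule interlacing_nonzeroD)
    then have "last (restrict_to {a, y} (t @ [x])) = (y, l, f')" by simp
    then show False using that T(2) by (auto simp: x)
  qed
  moreover have "(\<Sum>y\<in>T. g a y - h y a) = 0"
  proof (cases "lv = l")
    case False
    have "g a y = 0" for y using False by (auto simp: g_def Cons x interlacing_def)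
    moreover have "h y a = 0" for y
    proof (rule ccontr)
      assume "h y a \<noteq> 0"
      then obtain e' f' where "restrict_to {y, a} (t @ [x]) =
          [(y, l, e'), (a, other_level l, f'), (y, other_level l, e'), (a, l, f')]"
        unfolding h_def by (rule interlacing_nonzeroD)
      then have "last (restrict_to {y, a} (t @ [x])) = (a, l, f')" by simp
      then show False using False by (auto simp: x)
    qed
    ultimately show ?thesis by simp
  next
    case True
    have "(a, other_level l, e) \<in> set D" using well_formed_mate[OF wf, of a l e] by (simp add: Cons x True)
    then have "(a, other_level l, e) \<in> set t" by (auto simp: Cons x True)
    then obtain v w where t: "t = v @ (a, other_level l, e) # w" by (meson split_list)
    have Deq: "D = [(a, l, e)] @ v @ [(a, other_level l, e)] @ w" by (simp add: Cons x True t)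
    have a: "a \<notin> crossings v" "a \<notin> crossings w"
    proof -
      have "(a, l0, e0) \<in> {(a, l, e), (a, other_level l, e)}" if "(a, l0, e0) \<in> set v \<union> set w" for l0 e0
        using well_formed_third[OF wf, of a l e l0 e0] that by (auto simp: Deq)
      then have "(a, l0, e0) \<notin> set v \<union> set w" for l0 e0
        using well_formed_distinct[OF wf] by (fastforce simp: Deq)
      then show "a \<notin> crossings v" "a \<notin> crossings w" by (simp_all add: crossings_iff)
    qed
    have diff: "g a y - h y a =
        crossing_sign e * (if l = Under then 1 else - 1) * sum_list (map passage_sign (restrict_to {y} v))"
      if y: "y \<in> T" for y
    proof -
      have ya: "y \<noteq> a" "y \<in> crossings D" using y by (auto simp: T_def)
      have r: "restrict_to {a, y} z = restrict_to {y} z" if "a \<notin> crossings z" for z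
        using that by (auto simp: restrict_to_def crossings_def intro!: filter_cong)
      obtain l' f where "restrict_to {y} D = [(y, l', f), (y, other_level l', f)]"
        using restrict_to_single[OF wf ya(2)] .
      then have "restrict_to {y} v @ restrict_to {y} w = [(y, l', f), (y, other_level l', f)]"
        using ya by (simp add: Deq)
      note change = base_point_change[OF ya(1) this, of l e]
      have "g a y = interlacing l a y ((a, l, e) # restrict_to {y} v @ (a, other_level l, e) # restrict_to {y} w)"
        using ya a by (simp add: g_def Deq r)
      moreover have "h y a = interlacing l y a (restrict_to {y} v @ (a, other_level l, e) # restrict_to {y} w @ [(a, l, e)])"
        using ya a by (simp add: h_def t x True r insert_commute[of y a])
      ultimately show ?thesis using change by simp
    qed
    have "(\<Sum>y\<in>T. g a y - h y a) = crossing_sign e * (if l = Under then 1 else - 1) *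
        (\<Sum>y\<in>T. sum_list (map passage_sign (restrict_to {y} v)))"
      using diff by (simp add: sum_distrib_left)
    also have "(\<Sum>y\<in>T. sum_list (map passage_sign (restrict_to {y} v))) = sum_list (map passage_sign v)"
      using a T by (intro sum_restrict_to) (auto simp: T_def Deq)
    also have "\<dots> = 0" using D unfolding Deq by (rule loop_balanced_list) simp
    finally show ?thesis by simp
  qed
  moreover have "g a a = 0" "h a a = 0" by (simp_all add: g_def h_def)
  ultimately have "(\<Sum>p\<in>insert a T. \<Sum>q\<in>insert a T. g p q) = (\<Sum>p\<in>insert a T. \<Sum>q\<in>insert a T. h p q)"
    using gh by (simp add: split sum_subtractf)
  then show ?thesis
    unfolding casson_def g_def h_def by (simp add: Cons flip: cr)
qed simp

lemma casson_rotate: "knot_diagram D \<Longrightarrow> casson l (rotate n D) = casson l D"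
  by (induction n) (simp_all add: casson_rotate1 knot_diagram_rotate)

lemma crossings_rename: "crossings (rename_crossings f D) = f ` crossings D"
  by (force simp: crossings_def rename_crossings_def)

lemma casson_rename:
  assumes inj: "inj_on f (crossings D)"
  shows "casson l (rename_crossings f D) = casson l D"
proof -
  have r: "restrict_to {f a, f b} (rename_crossings f D) = rename_crossings f (restrict_to {a, b} D)"
    if "a \<in> crossings D" "b \<in> crossings D" for a b
  proof -
    have iff: "f (fst x) \<in> {f a, f b} \<longleftrightarrow> fst x \<in> {a, b}" if "x \<in> set D" for x
      using inj \<open>a \<in> crossings D\<close> \<open>b \<in> crossings D\<close> that by (auto simp: inj_on_def crossings_def)
    show ?thesis
      unfolding restrict_to_def rename_crossings_def filter_map
      by (intro arg_cong[where f = "map _"] filter_cong refl) (use iff in \<open>auto simp: case_prod_beta\<close>)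
  qed
  have i: "interlacing l (f a) (f b) (rename_crossings f W) = interlacing l a b W"
    if "a \<in> crossings D" "b \<in> crossings D" "set W \<subseteq> set D" for a b W
  proof -
    have "f c = f a \<longleftrightarrow> c = a" "f c = f b \<longleftrightarrow> c = b" if "c \<in> crossings D" for c
      using inj that \<open>a \<in> crossings D\<close> \<open>b \<in> crossings D\<close> by (auto simp: inj_on_def)
    moreover have "fst x \<in> crossings D" if "x \<in> set W" for x
      using that \<open>set W \<subseteq> set D\<close> by (auto simp: crossings_def)
    ultimately have inv: "map (\<lambda>(c, l, e). (inv_into (crossings D) f c, l, e)) (rename_crossings f W) = W"
      using inj by (auto simp: rename_crossings_def case_prod_beta intro!: map_idI)
    have "rename_crossings f W = [(f a, l1, e1), (f b, l2, e2), (f a, l3, e3), (f b, l4, e4)] \<longleftrightarrow>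
        W = [(a, l1, e1), (b, l2, e2), (a, l3, e3), (b, l4, e4)]" for l1 l2 l3 l4 e1 e2 e3 e4
    proof
      assume "rename_crossings f W = [(f a, l1, e1), (f b, l2, e2), (f a, l3, e3), (f b, l4, e4)]"
      from arg_cong[OF this, of "map (\<lambda>(c, l, e). (inv_into (crossings D) f c, l, e))"]
      show "W = [(a, l1, e1), (b, l2, e2), (a, l3, e3), (b, l4, e4)]"
        unfolding inv using inj \<open>a \<in> crossings D\<close> \<open>b \<in> crossings D\<close> by simp
    qed (simp add: rename_crossings_def)
    moreover have "f a = f b \<longleftrightarrow> a = b"
      using inj \<open>a \<in> crossings D\<close> \<open>b \<in> crossings D\<close> by (auto simp: inj_on_def)
    ultimately show ?thesis by (simp add: interlacing_def)
  qed
  have "casson l (rename_crossings f D) =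
      (\<Sum>a\<in>crossings D. \<Sum>b\<in>crossings D. interlacing l (f a) (f b) (restrict_to {f a, f b} (rename_crossings f D)))"
    using inj by (simp add: casson_def crossings_rename sum.reindex)
  also have "\<dots> = casson l D"
    unfolding casson_def using r i by (intro sum.cong refl) (auto simp: restrict_to_def)
  finally show ?thesis .
qed

text \<open>
  Moving the base point needs a diagram on the sphere, so the rotation is undone starting from \<open>E\<close>.
\<close>

lemma casson_isotopic:
  assumes "isotopic D E" and E: "knot_diagram E"
  shows "casson l E = casson l D"
proof -
  obtain f n where f: "inj_on f (crossings D)" and E': "E = rotate n (rename_crossings f D)"
    using assms by (auto simp: isotopic_def)
  obtain m where "rotate m E = rename_crossings f D" using rotate_back[of n "rename_crossings f D"] E' by auto
  then have "casson l (rename_crossings f D) = casson l E" using casson_rotate[OF E, of l m] by simp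
  then show ?thesis using casson_rename[OF f] by simp
qed

section \<open>The triangle move\<close>

fun mate :: "passage \<Rightarrow> passage" where
  "mate (c, l, e) = (c, other_level l, e)"

lemma fst_mate [simp]: "fst (mate z) = fst z"
  by (cases z) simp

lemma nth_partner_mate:
  assumes "well_formed D" "p < length D"
  shows "D ! partner D p = mate (D ! p)"
  using nth_partner[OF assms] by (cases "D ! p") simp

text \<open>
  A triangular face leaves the strand with passages \<open>x\<close>, \<open>y\<close> (running along it if \<open>f\<close> holds, against it
  otherwise) and continues along the strand with passages \<open>x'\<close>, \<open>y'\<close> (in the direction given by \<open>g\<close>).
  This fixes which passages belong to the same crossing, and also how the strands cross there.
\<close>

definition linked :: "bool \<Rightarrow> passage \<Rightarrow> passage \<Rightarrow> bool \<Rightarrow> passage \<Rightarrow> passage \<Rightarrow> bool" where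
  "linked f x y g x' y' \<longleftrightarrow>
     (if g then x' else y') = mate (if f then y else x) \<and>
     (from_right (if f then y else x) \<longleftrightarrow> f \<noteq> g)"

lemma orbit_eq_of_mem:
  assumes "finite S" "inj_on f S" "f ` S \<subseteq> S" "e \<in> S" "x \<in> orbit f e"
  shows "orbit f x = orbit f e \<and> x \<in> S"
  using assms(5)
proof induction
  case base
  then show ?case using orbit_step_eq[OF assms(1-4)] assms(3,4) by auto
next
  case (step x)
  then show ?case using orbit_step_eq[OF assms(1-3), of x] assms(3) by auto
qed

text \<open>
  An orbit with three elements is run through in one of two directions.
\<close>

lemma three_cycle:
  assumes S: "finite S" "inj_on f S" "f ` S \<subseteq> S" "e \<in> S"
    and F: "orbit f e = {d1, d2, d3}" and dist: "d1 \<noteq> d2" "d1 \<noteq> d3" "d2 \<noteq> d3"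
  shows "f d1 = d2 \<and> f d2 = d3 \<and> f d3 = d1 \<or> f d1 = d3 \<and> f d3 = d2 \<and> f d2 = d1"
proof -
  have d: "orbit f d = {d1, d2, d3}" "d \<in> S" if "d \<in> {d1, d2, d3}" for d
    using orbit_eq_of_mem[OF S, of d] that F by auto
  have "f d \<in> {d1, d2, d3}" "f d \<noteq> d" if "d \<in> {d1, d2, d3}" for d
  proof -
    show "f d \<in> {d1, d2, d3}" using orbit.base[of f d] d(1)[OF that] by simp
    show "f d \<noteq> d"
    proof
      assume "f d = d"
      then have "orbit f d = {d}" by (simp add: orbit_eq_singleton_iff)
      then show False using d(1)[OF that] dist by auto
    qed
  qed
  moreover have "f d \<noteq> f d'" if "d \<in> {d1, d2, d3}" "d' \<in> {d1, d2, d3}" "d \<noteq> d'" for d d'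
    using S(2) d(2) that by (meson inj_onD)
  ultimately show ?thesis using dist by (smt (verit) insertCI insertE singletonD)
qed

lemma linked_face_step:
  assumes wf: "well_formed D" and p: "Suc p < length D" and q: "Suc q < length D"
    and step: "face_step D (if f then Outgoing p else Incoming (Suc p)) =
      (if g then Outgoing q else Incoming (Suc q))"
  shows "linked f (D ! p) (D ! Suc p) g (D ! q) (D ! Suc q)"
proof -
  have "succ_pos D p = Suc p" "pred_pos D (Suc p) = p" using p by (simp_all add: succ_pos_if pred_pos_if)
  then have "next_ccw D (if f then Incoming (Suc p) else Outgoing p) =
      (if g then Outgoing q else Incoming (Suc q))"
    using step by (cases f) (simp_all add: opposite_end_simps)
  moreover have "D ! partner D p = mate (D ! p)" "D ! partner D (Suc p) = mate (D ! Suc p)"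
    using nth_partner_mate[OF wf] p by simp_all
  ultimately show ?thesis
    by (cases f; cases g; cases "from_right (D ! p)"; cases "from_right (D ! Suc p)")
      (auto simp: linked_def next_ccw_simps)
qed

lemma triangular_face_linked:
  assumes wf: "well_formed D" and D: "D = [x1, y1] @ u @ [x2, y2] @ v @ [x3, y3] @ w"
    and tri: "triangular_face D {0, length u + 2, length u + length v + 4}"
  obtains f1 f2 f3 where
    "linked f1 x1 y1 f2 x2 y2 \<and> linked f2 x2 y2 f3 x3 y3 \<and> linked f3 x3 y3 f1 x1 y1 \<or>
     linked f1 x1 y1 f3 x3 y3 \<and> linked f3 x3 y3 f2 x2 y2 \<and> linked f2 x2 y2 f1 x1 y1"
proof -
  define p2 p3 where "p2 = length u + 2" and "p3 = length u + length v + 4"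
  have nth: "D ! 0 = x1" "D ! Suc 0 = y1" "D ! p2 = x2" "D ! Suc p2 = y2" "D ! p3 = x3" "D ! Suc p3 = y3"
    by (simp_all add: D nth_append p2_def p3_def)
  have len: "Suc 0 < length D" "Suc p2 < length D" "Suc p3 < length D"
    by (simp_all add: D p2_def p3_def)
  obtain F where F: "F \<in> faces D" "card F = 3"
    and on: "\<And>p. p \<in> {0, p2, p3} \<Longrightarrow> Outgoing p \<in> F \<or> Incoming (Suc p) \<in> F"
    using tri unfolding triangular_face_def p2_def p3_def by blast
  obtain e where e: "e \<in> half_edges D" "F = orbit (face_step D) e" using F by (auto simp: faces_def)
  define side where "side f p = (if f then Outgoing p else Incoming (Suc p))" for f p
  have ex: "\<exists>f. side f p \<in> F" if "p \<in> {0, p2, p3}" for p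
  proof (cases "Outgoing p \<in> F")
    case True
    then show ?thesis by (intro exI[of _ True]) (simp add: side_def)
  next
    case False
    then show ?thesis using on[OF that] by (intro exI[of _ False]) (simp add: side_def)
  qed
  obtain f1 f2 f3 where f: "side f1 0 \<in> F" "side f2 p2 \<in> F" "side f3 p3 \<in> F"
    using ex[of 0] ex[of p2] ex[of p3] by auto
  have dist: "side f1 0 \<noteq> side f2 p2" "side f1 0 \<noteq> side f3 p3" "side f2 p2 \<noteq> side f3 p3"
    by (auto simp: side_def p2_def p3_def)
  have "F = {side f1 0, side f2 p2, side f3 p3}"
  proof (rule card_subset_eq[symmetric])
    show "finite F" using F(2) card.infinite by fastforce
    show "{side f1 0, side f2 p2, side f3 p3} \<subseteq> F" using f by simp
    show "card {side f1 0, side f2 p2, side f3 p3} = card F" using F(2) dist by simp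
  qed
  then have orb: "orbit (face_step D) e = {side f1 0, side f2 p2, side f3 p3}" using e by simp
  have sub: "face_step D ` half_edges D \<subseteq> half_edges D" using face_step_in[OF wf] by blast
  have link: "linked f (D ! p) (D ! Suc p) g (D ! q) (D ! Suc q)"
    if "Suc p < length D" "Suc q < length D" "face_step D (side f p) = side g q" for f g p q
    using that(3) unfolding side_def by (rule linked_face_step[OF wf that(1,2)])
  from three_cycle[OF finite_half_edges inj_on_face_step[OF wf] sub e(1) orb dist]
  have "linked f1 x1 y1 f2 x2 y2 \<and> linked f2 x2 y2 f3 x3 y3 \<and> linked f3 x3 y3 f1 x1 y1 \<or>
     linked f1 x1 y1 f3 x3 y3 \<and> linked f3 x3 y3 f2 x2 y2 \<and> linked f2 x2 y2 f1 x1 y1"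
    using link[OF len(1,2)] link[OF len(2,3)] link[OF len(3,1)]
      link[OF len(1,3)] link[OF len(3,2)] link[OF len(2,1)] unfolding nth by blast
  then show thesis by (rule that)
qed

lemma well_formed_no_third:
  assumes wf: "well_formed D" and D: "mset D = add_mset z (add_mset (mate z) (mset R))"
  shows "fst z \<notin> crossings R"
proof
  obtain c l e where z: "z = (c, l, e)" by (cases z)
  assume "fst z \<in> crossings R"
  then obtain l' e' where x: "(c, l', e') \<in> set R" by (auto simp: crossings_iff z)
  have set_D: "set D = insert z (insert (mate z) (set R))" using arg_cong[OF D, of set_mset] by simp
  have "(c, l', e') = z \<or> (c, l', e') = mate z"
    using well_formed_third[OF wf, of c l e l' e'] x by (auto simp: set_D z)
  then have "z \<in> set R \<or> mate z \<in> set R" using x by auto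
  then have "count (mset D) z \<ge> 2 \<or> count (mset D) (mate z) \<ge> 2"
    by (auto simp: D Suc_le_eq)
  then show False
    using well_formed_distinct[OF wf] by (metis distinct_count_atmost_1 numeral_le_one_iff semiring_norm(69)
      zero_le_one le_zero_eq not_numeral_le_zero)
qed

text \<open>
  The triangle move exchanges neighbouring letters of different crossings, so a pair of crossings
  notices it only if both belong to the triangle.
\<close>

lemma casson_swap_outside:
  assumes D: "D = [x1, y1] @ u @ [x2, y2] @ v @ [x3, y3] @ w"
    and E: "E = [y1, x1] @ u @ [y2, x2] @ v @ [y3, x3] @ w"
    and L: "L = [x1, y1, x2, y2, x3, y3]" and M: "M = [y1, x1, y2, x2, y3, x3]"
    and dist: "fst x1 \<noteq> fst y1" "fst x2 \<noteq> fst y2" "fst x3 \<noteq> fst y3"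
    and disj: "crossings L \<inter> crossings (u @ v @ w) = {}"
  shows "casson l D - casson l E = casson l L - casson l M"
proof -
  define K S where "K = crossings L" and "S = crossings D"
  have K: "crossings M = K" "K \<subseteq> S" "finite S" "crossings E = S" "K = {fst x1, fst y1, fst x2, fst y2, fst x3, fst y3}"
    by (auto simp: K_def S_def L M D E)
  define d where "d p q = interlacing l p q (restrict_to {p, q} D) - interlacing l p q (restrict_to {p, q} E)" for p q
  have empty: "restrict_to {p, q} z = []" if "p \<in> K" "q \<in> K" "z \<in> {u, v, w}" for p q z
    using that disj by (intro restrict_to_empty) (auto simp: K_def)
  have inside: "d p q = interlacing l p q (restrict_to {p, q} L) - interlacing l p q (restrict_to {p, q} M)"
    if "p \<in> K" "q \<in> K" for p q
    using empty[OF that] by (simp add: d_def D E L M)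
  have "restrict_to {p, q} D = restrict_to {p, q} E" if "p \<notin> K \<or> q \<notin> K" for p q
  proof -
    have "\<not> {fst x1, fst y1} \<subseteq> {p, q}" "\<not> {fst x2, fst y2} \<subseteq> {p, q}" "\<not> {fst x3, fst y3} \<subseteq> {p, q}"
      using that dist by (auto simp: K)
    then show ?thesis by (auto simp: D E)
  qed
  then have outside: "d p q = 0" if "p \<notin> K \<or> q \<notin> K" for p q
    using that by (simp add: d_def)
  have "casson l D - casson l E = (\<Sum>p\<in>S. \<Sum>q\<in>S. d p q)"
    unfolding casson_def d_def K(4) S_def[symmetric] by (simp only: sum_subtractf)
  also have "\<dots> = (\<Sum>p\<in>K. \<Sum>q\<in>S. d p q)"
    using K(2,3) outside by (intro sum.mono_neutral_right) auto
  also have "\<dots> = (\<Sum>p\<in>K. \<Sum>q\<in>K. d p q)"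
    using K(2,3) outside by (intro sum.cong refl sum.mono_neutral_right) auto
  also have "\<dots> = (\<Sum>p\<in>K. \<Sum>q\<in>K. interlacing l p q (restrict_to {p, q} L) -
      interlacing l p q (restrict_to {p, q} M))"
    by (intro sum.cong refl inside)
  also have "\<dots> = casson l L - casson l M"
    unfolding casson_def K(1) K_def[symmetric] by (simp only: sum_subtractf)
  finally show ?thesis .
qed

lemma interlacing_word:
  "interlacing l a b [(p1, l1, s1), (p2, l2, s2), (p3, l3, s3), (p4, l4, s4)] =
    (if a \<noteq> b \<and> p1 = a \<and> p2 = b \<and> p3 = a \<and> p4 = b \<and>
        l1 = l \<and> l2 = other_level l \<and> l3 = other_level l \<and> l4 = l \<and> s3 = s1 \<and> s4 = s2
     then crossing_sign s1 * crossing_sign s2 else 0)"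
  by (cases s1; cases s2) (auto simp: interlacing_def)

lemma casson_three:
  assumes "a \<noteq> b" "a \<noteq> c" "b \<noteq> c" "crossings W \<subseteq> {a, b, c}"
  shows "casson l W =
    interlacing l a b (restrict_to {a, b} W) + interlacing l a c (restrict_to {a, c} W)
    + interlacing l b a (restrict_to {b, a} W) + interlacing l b c (restrict_to {b, c} W)
    + interlacing l c a (restrict_to {c, a} W) + interlacing l c b (restrict_to {c, b} W)"
  using assms by (subst casson_superset[of "{a, b, c}"]) auto

definition strand :: "bool \<Rightarrow> passage \<Rightarrow> passage \<Rightarrow> gauss_code" where
  "strand g x y = (if g then [x, y] else [y, x])"

text \<open>
  All triangles up to the names of the crossings: \<open>g1\<close>, \<open>g2\<close>, \<open>g3\<close> give the order of the crossings along
  the three strands, and \<open>t\<close> distinguishes a triangle from its reflection in the plane. These determine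
  in which direction the strands cross; \<open>lc\<close> is the level of the second strand at its crossing with the
  third.
\<close>

lemma casson_triangle_word:
  assumes dist: "a \<noteq> b" "a \<noteq> c" "b \<noteq> c"
    and s: "e1 = Positive \<longleftrightarrow> (g1 = g2) = t" "e2 = Positive \<longleftrightarrow> (g1 \<noteq> g3) = t"
      "(lc = Over) = (e3 = Positive) \<longleftrightarrow> (g2 \<noteq> g3) = t"
  shows "casson l (strand g1 (a, Over, e1) (b, Over, e2) @ strand g2 (a, Under, e1) (c, lc, e3) @
        strand g3 (c, other_level lc, e3) (b, Under, e2)) =
    casson l (strand (\<not> g1) (a, Over, e1) (b, Over, e2) @ strand (\<not> g2) (a, Under, e1) (c, lc, e3) @
        strand (\<not> g3) (c, other_level lc, e3) (b, Under, e2))"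
proof -
  have sub: "crossings (strand g (a, l1, f1) (b, l2, f2) @ strand g' (a, l3, f3) (c, l4, f4) @
      strand g'' (c, l5, f5) (b, l6, f6)) \<subseteq> {a, b, c}"
    for g g' g'' l1 l2 l3 l4 l5 l6 f1 f2 f3 f4 f5 f6 by (auto simp: strand_def)
  have e: "e1 = (if (g1 = g2) = t then Positive else Negative)"
    "e2 = (if (g1 \<noteq> g3) = t then Positive else Negative)"
    "e3 = (if (lc = Over) = ((g2 \<noteq> g3) = t) then Positive else Negative)"
    using s by (cases e1; cases e2; cases e3; auto)+
  show ?thesis
    unfolding casson_three[OF dist sub] e
    by (cases t; cases g1; cases g2; cases g3; cases lc; cases l)
      (simp_all add: strand_def interlacing_word crossing_sign_def dist dist[symmetric])
qed

lemma linked_strands: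
  assumes linked: "linked f1 x1 y1 f2 x2 y2 \<and> linked f2 x2 y2 f3 x3 y3 \<and> linked f3 x3 y3 f1 x1 y1 \<or>
     linked f1 x1 y1 f3 x3 y3 \<and> linked f3 x3 y3 f2 x2 y2 \<and> linked f2 x2 y2 f1 x1 y1"
    and over: "fst (snd x1) = Over" "fst (snd y1) = Over"
  obtains a b c e1 e2 e3 lc g1 g2 g3 t where
    "[x1, y1] = strand g1 (a, Over, e1) (b, Over, e2)"
    "[x2, y2] = strand g2 (a, Under, e1) (c, lc, e3)"
    "[x3, y3] = strand g3 (c, other_level lc, e3) (b, Under, e2)"
    "e1 = Positive \<longleftrightarrow> (g1 = g2) = t" "e2 = Positive \<longleftrightarrow> (g1 \<noteq> g3) = t"
    "(lc = Over) = (e3 = Positive) \<longleftrightarrow> (g2 \<noteq> g3) = t"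
proof -
  have mate_eq: "(c, l, e) = mate z \<longleftrightarrow> z = (c, other_level l, e)"
    "mate z = (c, l, e) \<longleftrightarrow> z = (c, other_level l, e)" for c l e z by (cases z; auto)+
  obtain p e where x1: "x1 = (p, Over, e)" using over(1) by (cases x1) auto
  obtain q f where y1: "y1 = (q, Over, f)" using over(2) by (cases y1) auto
  from linked show thesis
  proof (elim disjE conjE)
    assume l: "linked f1 x1 y1 f2 x2 y2" "linked f2 x2 y2 f3 x3 y3" "linked f3 x3 y3 f1 x1 y1"
    obtain c lc e3 where C: "(if f2 then y2 else x2) = (c, lc, e3)" by (cases "if f2 then y2 else x2")
    show thesis
      using l C
      by (cases f1; cases f2; cases f3;
          intro that[of "\<not> f1" "if f1 then q else p" "if f1 then f else e"
            "if f1 then p else q" "if f1 then e else f" f2 c lc e3 f3 True])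
        (auto simp: linked_def x1 y1 strand_def from_right_Pair mate_eq)
  next
    assume l: "linked f1 x1 y1 f3 x3 y3" "linked f3 x3 y3 f2 x2 y2" "linked f2 x2 y2 f1 x1 y1"
    obtain c lc e3 where C: "(if f2 then x2 else y2) = (c, lc, e3)" by (cases "if f2 then x2 else y2")
    show thesis
      using l C
      by (cases f1; cases f2; cases f3; cases lc; cases e3;
          intro that[of f1 "if f1 then p else q" "if f1 then e else f"
            "if f1 then q else p" "if f1 then f else e" "\<not> f2" c lc e3 "\<not> f3" False])
        (auto simp: linked_def x1 y1 strand_def from_right_Pair mate_eq)
  qed
qed

lemma casson_R3:
  assumes wf: "well_formed D" and D: "D = [x1, y1] @ u @ [x2, y2] @ v @ [x3, y3] @ w"
    and E: "E = [y1, x1] @ u @ [y2, x2] @ v @ [y3, x3] @ w"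
    and tri: "triangular_face D {0, length u + 2, length u + length v + 4}"
    and over: "fst (snd x1) = Over" "fst (snd y1) = Over"
  shows "casson l D = casson l E"
proof -
  obtain f1 f2 f3 where
    "linked f1 x1 y1 f2 x2 y2 \<and> linked f2 x2 y2 f3 x3 y3 \<and> linked f3 x3 y3 f1 x1 y1 \<or>
     linked f1 x1 y1 f3 x3 y3 \<and> linked f3 x3 y3 f2 x2 y2 \<and> linked f2 x2 y2 f1 x1 y1"
    using triangular_face_linked[OF wf D tri] .
  from linked_strands[OF this over] obtain a b c e1 e2 e3 lc g1 g2 g3 t where
    s1: "[x1, y1] = strand g1 (a, Over, e1) (b, Over, e2)" and
    s2: "[x2, y2] = strand g2 (a, Under, e1) (c, lc, e3)" and
    s3: "[x3, y3] = strand g3 (c, other_level lc, e3) (b, Under, e2)" and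
    signs: "e1 = Positive \<longleftrightarrow> (g1 = g2) = t" "e2 = Positive \<longleftrightarrow> (g1 \<noteq> g3) = t"
      "(lc = Over) = (e3 = Positive) \<longleftrightarrow> (g2 \<noteq> g3) = t" .
  have mset_strand: "mset (strand g x y) = {#x, y#}" for g x y by (simp add: strand_def)
  have "mset D = mset [x1, y1] + mset [x2, y2] + mset [x3, y3] + mset (u @ v @ w)"
    by (simp add: D)
  then have msetD: "mset D = {#(a, Over, e1), (b, Over, e2), (a, Under, e1), (c, lc, e3),
      (c, other_level lc, e3), (b, Under, e2)#} + mset (u @ v @ w)"
    unfolding s1 s2 s3 mset_strand by simp
  have "a \<notin> crossings ([(b, Over, e2), (b, Under, e2), (c, lc, e3), (c, other_level lc, e3)] @ u @ v @ w)"
    using well_formed_no_third[OF wf, of "(a, Over, e1)" "[(b, Over, e2), (b, Under, e2), (c, lc, e3), (c, other_level lc, e3)] @ u @ v @ w"] msetD by (simp add: ac_simps add_mset_commute)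
  moreover have "b \<notin> crossings ([(a, Over, e1), (a, Under, e1), (c, lc, e3), (c, other_level lc, e3)] @ u @ v @ w)"
    using well_formed_no_third[OF wf, of "(b, Over, e2)" "[(a, Over, e1), (a, Under, e1), (c, lc, e3), (c, other_level lc, e3)] @ u @ v @ w"] msetD by (simp add: ac_simps add_mset_commute)
  moreover have "c \<notin> crossings ([(a, Over, e1), (a, Under, e1), (b, Over, e2), (b, Under, e2)] @ u @ v @ w)"
    using well_formed_no_third[OF wf, of "(c, lc, e3)" "[(a, Over, e1), (a, Under, e1), (b, Over, e2), (b, Under, e2)] @ u @ v @ w"] msetD by (simp add: ac_simps add_mset_commute)
  ultimately have dist: "a \<noteq> b" "a \<noteq> c" "b \<noteq> c" and out: "{a, b, c} \<inter> crossings (u @ v @ w) = {}"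
    by auto
  have flip: "[y, x] = strand (\<not> g) p q" if "[x, y] = strand g p q" for x y p q g
    using that by (cases g) (auto simp: strand_def)
  have cr: "{fst x1, fst y1} = {a, b}" "{fst x2, fst y2} = {a, c}" "{fst x3, fst y3} = {b, c}"
    using s1 s2 s3 by (auto simp: strand_def split: if_splits)
  have "casson l [x1, y1, x2, y2, x3, y3] = casson l ([x1, y1] @ [x2, y2] @ [x3, y3])" by simp
  also have "\<dots> = casson l ([y1, x1] @ [y2, x2] @ [y3, x3])"
    unfolding s1 s2 s3 flip[OF s1] flip[OF s2] flip[OF s3]
    by (rule casson_triangle_word[OF dist signs])
  finally have "casson l [x1, y1, x2, y2, x3, y3] = casson l [y1, x1, y2, x2, y3, x3]" by simp
  moreover have "crossings [x1, y1, x2, y2, x3, y3] = {fst x1, fst y1} \<union> {fst x2, fst y2} \<union> {fst x3, fst y3}"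
    by auto
  then have "crossings [x1, y1, x2, y2, x3, y3] \<inter> crossings (u @ v @ w) = {}"
    using out unfolding cr by auto
  moreover have "fst x1 \<noteq> fst y1" "fst x2 \<noteq> fst y2" "fst x3 \<noteq> fst y3"
    using cr dist by (auto simp: doubleton_eq_iff)
  ultimately show ?thesis
    using casson_swap_outside[OF D E refl refl, of l] by simp
qed

section \<open>Invariance\<close>

lemma casson_reidemeister:
  assumes "reidemeister D E" and D: "knot_diagram D" and E: "knot_diagram E"
  shows "casson l D = casson l E"
proof -
  have wf: "well_formed D" using D by (simp add: knot_diagram_def)
  from assms(1) show ?thesis
  proof cases
    case R0
    then show ?thesis using casson_isotopic[OF _ E] by simp
  next
    case (R1 a l e)
    then show ?thesis using casson_kink wf by simp
  next
    case (R2_parallel a l e b u v)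
    then show ?thesis using casson_R2[OF wf] by (metis (no_types))
  next
    case (R2_antiparallel a l e b u v)
    then show ?thesis using casson_R2[OF wf] by (metis (no_types))
  next
    case (R3 x1 y1 u x2 y2 v x3 y3 w)
    then show ?thesis using casson_R3[OF wf] by blast
  qed
qed

theorem casson_unknot:
  assumes "unknot_diagram D"
  shows "casson l D = 0"
proof -
  have "same_knot D []" using assms by (simp add: unknot_diagram_def)
  then have "casson l D = casson l []"
    unfolding same_knot_def
  proof (induction rule: rtranclp_induct)
    case (step E F)
    then show ?case using casson_reidemeister[of E F l] casson_reidemeister[of F E l] by auto
  qed simp
  then show ?thesis by simp
qed

section \<open>The digraph of interlaced chords\<close>

text \<open>
  Chords are the positive crossings \<open>S\<close>, given by the positions \<open>ov\<close> and \<open>un\<close> of their passages in a word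
  of length \<open>N\<close>. The negative crossing \<open>c\<close> has its overpass at position \<open>0\<close> and its underpass at
  position \<open>m\<close>. The last two assumptions exclude the pairs that would be counted by \<open>casson Under\<close> with
  the base point before the overpass of \<open>c\<close>, and by \<open>casson Over\<close> with the base point before its
  underpass; the sums modulo \<open>N\<close> are the positions counted from there.
\<close>

locale almost_positive_chords =
  fixes S :: "nat set" and ov un :: "nat \<Rightarrow> nat" and m N :: nat
  assumes finite_S: "finite S"
    and m_pos: "0 < m" "m < N"
    and range: "q \<in> S \<Longrightarrow> 0 < ov q \<and> ov q < N \<and> ov q \<noteq> m \<and> 0 < un q \<and> un q < N \<and> un q \<noteq> m"
    and ov_inj: "p \<in> S \<Longrightarrow> q \<in> S \<Longrightarrow> ov p = ov q \<longleftrightarrow> p = q"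
    and un_inj: "p \<in> S \<Longrightarrow> q \<in> S \<Longrightarrow> un p = un q \<longleftrightarrow> p = q"
    and ov_un: "p \<in> S \<Longrightarrow> q \<in> S \<Longrightarrow> ov p \<noteq> un q"
    and casson_over: "p \<in> S \<Longrightarrow> q \<in> S \<Longrightarrow> \<not> (un q < ov p \<and> ov p < ov q \<and> ov q < un p)"
    and casson_under: "p \<in> S \<Longrightarrow> q \<in> S \<Longrightarrow>
      \<not> ((ov q + (N - m)) mod N < (un p + (N - m)) mod N \<and> (un p + (N - m)) mod N < (un q + (N - m)) mod N \<and>
        (un q + (N - m)) mod N < (ov p + (N - m)) mod N)"
begin

definition inside :: "nat \<Rightarrow> nat \<Rightarrow> bool" where
  "inside x p \<longleftrightarrow> ov x < p \<and> p < un x \<or> un x < p \<and> p < ov x"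

text \<open>
  The passages of two interlaced chords alternate between the chords, so cyclically their levels are
  over, over, under, under. The arrow points from the chord of the first of these passages to that of
  the second. The four cases are the gaps in which the base point may lie.
\<close>

definition arrow :: "nat \<Rightarrow> nat \<Rightarrow> bool" where
  "arrow p q \<longleftrightarrow> ov p < ov q \<and> ov q < un p \<and> un p < un q \<or> ov q < un p \<and> un p < un q \<and> un q < ov p \<or>
     un p < un q \<and> un q < ov p \<and> ov p < ov q \<or> un q < ov p \<and> ov p < ov q \<and> ov q < un p"

text \<open>
  The chords interlaced with \<open>c\<close>. With \<open>c\<close> included in the digraph, the rising chords would have an
  arrow to \<open>c\<close> and the falling ones an arrow from \<open>c\<close>.
\<close>

definition rising :: "nat \<Rightarrow> bool" where "rising x \<longleftrightarrow> un x < m \<and> m < ov x"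

definition falling :: "nat \<Rightarrow> bool" where "falling x \<longleftrightarrow> ov x < m \<and> m < un x"

lemma shift_less:
  assumes "a < N" "b < N" "a \<noteq> m" "b \<noteq> m"
  shows "(a + (N - m)) mod N < (b + (N - m)) mod N \<longleftrightarrow> a < m \<and> b < m \<and> a < b \<or> m < a \<and> (b < m \<or> a < b)"
proof -
  have "(p + (N - m)) mod N = (if p < m then p + N - m else p - m)" if "p < N" for p
    using m_pos that by (auto simp: mod_if)
  then show ?thesis using assms m_pos by auto
qed

text \<open>
  The assumptions on the Casson invariant: the overpass of \<open>c\<close> does not lie in the gap between the two
  underpasses, and the underpass of \<open>c\<close> not in the gap between the two overpasses.
\<close>

lemma arrow_cases:
  assumes p: "p \<in> S" and q: "q \<in> S" and arr: "arrow p q"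
  shows "ov p < ov q \<and> ov q < un p \<and> un p < un q \<and> (m < ov p \<or> ov q < m) \<or>
    ov q < un p \<and> un p < un q \<and> un q < ov p \<and> ov q < m \<and> m < ov p \<or>
    un p < un q \<and> un q < ov p \<and> ov p < ov q \<and> (m < ov p \<or> ov q < m)"
proof -
  have ranges: "ov p < N" "ov q < N" "un p < N" "un q < N" "ov p \<noteq> m" "ov q \<noteq> m" "un p \<noteq> m" "un q \<noteq> m"
    using range[OF p] range[OF q] by simp_all
  have under: "\<not> ((ov q < m \<and> un p < m \<and> ov q < un p \<or> m < ov q \<and> (un p < m \<or> ov q < un p)) \<and>
      (un p < m \<and> un q < m \<and> un p < un q \<or> m < un p \<and> (un q < m \<or> un p < un q)) \<and>
      (un q < m \<and> ov p < m \<and> un q < ov p \<or> m < un q \<and> (ov p < m \<or> un q < ov p)))"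
    using casson_under[OF p q] by (simp only: shift_less ranges not_False_eq_True)
  from arr consider
    "ov p < ov q" "ov q < un p" "un p < un q" | "ov q < un p" "un p < un q" "un q < ov p" |
    "un p < un q" "un q < ov p" "ov p < ov q" | "un q < ov p" "ov p < ov q" "ov q < un p"
    unfolding arrow_def by blast
  then show ?thesis
  proof cases
    case 1
    then have "\<not> (ov p < m \<and> m < ov q)" using under by auto
    then show ?thesis using 1 ranges by linarith
  next
    case 2
    then have "\<not> m < ov q" "\<not> ov p < m" using under by auto
    then show ?thesis using 2 ranges by linarith
  next
    case 3
    then have "\<not> (ov p < m \<and> m < ov q)" using under by auto
    then show ?thesis using 3 ranges by linarith
  next
    case 4
    then show ?thesis using casson_over[OF p q] by simp
  qed
qed

lemma arrow_irrefl [simp]: "\<not> arrow p p"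
  by (auto simp: arrow_def)

lemma arrow_asym: "arrow p q \<Longrightarrow> \<not> arrow q p"
  by (auto simp: arrow_def)

lemma rising_not_falling: "rising p \<Longrightarrow> \<not> falling p"
  by (auto simp: rising_def falling_def)

text \<open>
  Hence arrows between chords of different kinds lead from rising chords to those that miss \<open>c\<close>, and
  from these to falling chords, or directly from rising to falling ones.
\<close>

lemma arrow_into_rising: "p \<in> S \<Longrightarrow> q \<in> S \<Longrightarrow> arrow p q \<Longrightarrow> rising q \<Longrightarrow> rising p"
  using arrow_cases[of p q] range[of p] range[of q] unfolding rising_def by linarith

lemma arrow_from_falling: "p \<in> S \<Longrightarrow> q \<in> S \<Longrightarrow> arrow p q \<Longrightarrow> falling p \<Longrightarrow> falling q"
  using arrow_cases[of p q] range[of p] range[of q] unfolding falling_def by linarith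

lemma rising_arrow_iff:
  "rising p \<Longrightarrow> rising q \<Longrightarrow> arrow p q \<longleftrightarrow> un p < un q \<and> ov p < ov q"
  by (auto simp: rising_def arrow_def)

lemma falling_arrow_iff:
  "falling p \<Longrightarrow> falling q \<Longrightarrow> arrow p q \<longleftrightarrow> ov p < ov q \<and> un p < un q"
  by (auto simp: falling_def arrow_def)

lemma inside_arrow:
  assumes "x \<in> S" "q \<in> S"
  shows "inside x (ov q) \<and> \<not> inside x (un q) \<longleftrightarrow> (if ov x < un x then arrow x q else arrow q x)"
    and "inside x (un q) \<and> \<not> inside x (ov q) \<longleftrightarrow> (if ov x < un x then arrow q x else arrow x q)"
proof -
  have "(inside x (ov q) \<and> \<not> inside x (un q) \<longleftrightarrow> (if ov x < un x then arrow x q else arrow q x)) \<and>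
    (inside x (un q) \<and> \<not> inside x (ov q) \<longleftrightarrow> (if ov x < un x then arrow q x else arrow x q))"
  proof (cases "q = x")
    case True
    then show ?thesis by (simp add: inside_def)
  next
    case False
    have "ov x \<noteq> ov q" "un x \<noteq> un q" "ov x \<noteq> un q" "ov q \<noteq> un x" "ov x \<noteq> un x" "ov q \<noteq> un q"
      using ov_inj[OF assms] un_inj[OF assms] False ov_un assms by auto
    then show ?thesis unfolding inside_def arrow_def by (smt (verit) nat_neq_iff order_less_trans order_less_asym)
  qed
  then show "inside x (ov q) \<and> \<not> inside x (un q) \<longleftrightarrow> (if ov x < un x then arrow x q else arrow q x)"
    and "inside x (un q) \<and> \<not> inside x (ov q) \<longleftrightarrow> (if ov x < un x then arrow q x else arrow x q)"
    by blast+
qed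

lemma arrow_rising:
  assumes "x \<in> S" "q \<in> S" "rising x"
  shows "arrow x q \<longleftrightarrow> inside x (un q) \<and> \<not> inside x (ov q)"
    and "arrow q x \<longleftrightarrow> inside x (ov q) \<and> \<not> inside x (un q)"
  using inside_arrow[OF assms(1,2)] assms(3) by (simp_all add: rising_def)

lemma arrow_falling:
  assumes "x \<in> S" "q \<in> S" "falling x"
  shows "arrow x q \<longleftrightarrow> inside x (ov q) \<and> \<not> inside x (un q)"
    and "arrow q x \<longleftrightarrow> inside x (un q) \<and> \<not> inside x (ov q)"
  using inside_arrow[OF assms(1,2)] assms(3) by (simp_all add: falling_def)

end

text \<open>
  The assumptions are the intersection numbers on the sphere of the loop of a chord with the knot, of
  the loop of \<open>c\<close> with the knot, of the loops of two chords that are not interlaced, and of the loop of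
  \<open>c\<close> with that of a chord interlaced with it.
\<close>

locale unknot_chords = almost_positive_chords +
  assumes balanced: "x \<in> S \<Longrightarrow>
      (\<Sum>q\<in>S. of_bool (inside x (ov q)) - of_bool (inside x (un q)) :: int) + of_bool (inside x m) = 0"
    and balanced_c: "(\<Sum>q\<in>S. of_bool (ov q < m) - of_bool (un q < m) :: int) = 0"
    and disjoint_loops: "x \<in> S \<Longrightarrow> y \<in> S \<Longrightarrow> x \<noteq> y \<Longrightarrow> \<not> arrow x y \<Longrightarrow> \<not> arrow y x \<Longrightarrow>
      (\<Sum>q\<in>S. of_bool (inside x (ov q) \<and> inside y (un q)) - of_bool (inside x (un q) \<and> inside y (ov q)) :: int) = 0"
    and crossing_loops: "x \<in> S \<Longrightarrow> inside x m \<Longrightarrow>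
      (\<Sum>q\<in>S. of_bool (ov q < m \<and> inside x (un q)) - of_bool (un q < m \<and> inside x (ov q)) :: int)
      + of_bool (ov x < m) = 1"
begin

definition outs :: "nat \<Rightarrow> nat set" where "outs x = {q \<in> S. arrow x q}"

definition ins :: "nat \<Rightarrow> nat set" where "ins x = {q \<in> S. arrow q x}"

lemma finite_outs [simp]: "finite (outs x)" and finite_ins [simp]: "finite (ins x)"
  using finite_S by (simp_all add: outs_def ins_def)

lemma sum_of_bool_card: "(\<Sum>q\<in>S. of_bool (P q) :: int) = int (card {q \<in> S. P q})"
  using finite_S by (simp add: of_bool_def sum.If_cases Int_def)

text \<open>
  Apart from the contribution of \<open>c\<close>, the intersection number of the loop at \<open>x\<close> with the knot counts
  the arrows from \<open>x\<close> minus the arrows to \<open>x\<close>, up to sign.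
\<close>

lemma outs_ins_balance:
  assumes x: "x \<in> S"
  shows "int (card (outs x)) - int (card (ins x)) = of_bool (rising x) - of_bool (falling x)"
proof -
  have "of_bool (inside x (ov q)) - of_bool (inside x (un q)) =
      (if ov x < un x then of_bool (arrow x q) - of_bool (arrow q x)
       else of_bool (arrow q x) - of_bool (arrow x q) :: int)" if "q \<in> S" for q
    using inside_arrow[OF x that] arrow_asym[of x q]
    by (cases "inside x (ov q)"; cases "inside x (un q)") (auto split: if_splits)
  then have "(\<Sum>q\<in>S. of_bool (inside x (ov q)) - of_bool (inside x (un q)) :: int) =
      (if ov x < un x then int (card (outs x)) - int (card (ins x)) else int (card (ins x)) - int (card (outs x)))"
    by (simp add: sum_subtractf sum_of_bool_card outs_def ins_def)
  moreover have "of_bool (inside x m) = (if ov x < un x then of_bool (falling x) else of_bool (rising x) :: int)"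
    "ov x < un x \<Longrightarrow> \<not> rising x" "\<not> ov x < un x \<Longrightarrow> \<not> falling x"
    by (auto simp: inside_def rising_def falling_def)
  ultimately show ?thesis
    using balanced[OF x] by (cases "ov x < un x") auto
qed

lemma card_rising_falling: "card {q \<in> S. rising q} = card {q \<in> S. falling q}"
proof -
  have "of_bool (ov q < m) - of_bool (un q < m) = (of_bool (falling q) - of_bool (rising q) :: int)"
    if "q \<in> S" for q
    using range[OF that] by (auto simp: rising_def falling_def)
  then show ?thesis
    using balanced_c by (simp add: sum_subtractf sum_of_bool_card)
qed

text \<open>
  The loop of \<open>y\<close> has intersection number zero with the loop of \<open>x\<close> and with the knot, hence also with
  the rest of the knot outside the loop of \<open>x\<close>. The \<open>1\<close> is the contribution of \<open>c\<close> to the latter.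
\<close>

lemma nested_loops:
  assumes x: "x \<in> S" and y: "y \<in> S" "x \<noteq> y" "\<not> arrow x y" "\<not> arrow y x" and m: "inside y m"
  shows "int (card {q \<in> S. inside y (un q) \<and> \<not> inside x (ov q)})
    - int (card {q \<in> S. inside y (ov q) \<and> \<not> inside x (un q)}) = 1"
proof -
  have "(\<Sum>q\<in>S. of_bool (inside x (ov q) \<and> inside y (un q)) - of_bool (inside x (un q) \<and> inside y (ov q)) :: int)
    + (\<Sum>q\<in>S. of_bool (inside y (ov q)) - of_bool (inside y (un q)) :: int) =
    (\<Sum>q\<in>S. of_bool (inside y (ov q) \<and> \<not> inside x (un q)) - of_bool (inside y (un q) \<and> \<not> inside x (ov q)))"
    unfolding sum.distrib[symmetric] by (intro sum.cong) auto
  then show ?thesis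
    using disjoint_loops[OF x y] balanced[OF y(1)] m by (simp add: sum_subtractf sum_of_bool_card)
qed

definition loop_within :: "nat \<Rightarrow> nat \<Rightarrow> bool" where
  "loop_within y x \<longleftrightarrow> (\<forall>p. inside y p \<longrightarrow> inside x p)"

lemma loop_within_total:
  assumes "x \<in> S" "y \<in> S" "\<not> arrow x y" "\<not> arrow y x" "inside x m" "inside y m"
  shows "loop_within y x \<or> loop_within x y"
proof (cases "inside x (ov y)")
  case True
  then have "inside x (un y)"
    using inside_arrow[OF assms(1,2)] assms(3,4) by (auto split: if_splits)
  then have "loop_within y x" using True unfolding loop_within_def inside_def by linarith
  then show ?thesis ..
next
  case False
  then have "\<not> inside x (un y)"
    using inside_arrow[OF assms(1,2)] assms(3,4) by (auto split: if_splits)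
  then have "loop_within x y" using False assms(5,6) unfolding loop_within_def inside_def by linarith
  then show ?thesis ..
qed

text \<open>
  The common shape of the neighbourhoods of rising and falling chords: the neighbours with their
  underpass, respectively overpass, inside the loop that contains the underpass of \<open>c\<close>.
\<close>

definition toward :: "nat \<Rightarrow> nat set" where "toward x = (if rising x then outs x else ins x)"

definition away :: "nat \<Rightarrow> nat set" where "away x = (if rising x then ins x else outs x)"

lemma toward_away_inside:
  assumes "x \<in> S" "rising x \<or> falling x"
  shows "toward x = {q \<in> S. inside x (un q) \<and> \<not> inside x (ov q)}"
    "away x = {q \<in> S. inside x (ov q) \<and> \<not> inside x (un q)}"
proof -
  have "toward x = {q \<in> S. inside x (un q) \<and> \<not> inside x (ov q)} \<and>
    away x = {q \<in> S. inside x (ov q) \<and> \<not> inside x (un q)}"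
  proof (cases "rising x")
    case True
    then show ?thesis
      using arrow_rising[OF assms(1)] by (simp add: toward_def away_def outs_def ins_def cong: conj_cong)
  next
    case False
    then show ?thesis
      using arrow_falling[OF assms(1)] assms(2)
      by (simp add: toward_def away_def outs_def ins_def cong: conj_cong)
  qed
  then show "toward x = {q \<in> S. inside x (un q) \<and> \<not> inside x (ov q)}"
    "away x = {q \<in> S. inside x (ov q) \<and> \<not> inside x (un q)}" by auto
qed

text \<open>
  Two chords that are interlaced with \<open>c\<close> but not with each other have nested loops, and the chords
  between the smaller loop and the complement of the larger one are their common neighbours. They
  balance the contribution of \<open>c\<close>, which is itself such a neighbour.
\<close>

lemma straddling_common:
  assumes x: "x \<in> S" "rising x \<or> falling x" and y: "y \<in> S" "rising y \<or> falling y"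
    and ne: "x \<noteq> y" "\<not> arrow x y" "\<not> arrow y x"
  shows "int (card (toward x \<inter> toward y)) - int (card (away x \<inter> away y)) = 1"
proof -
  have main: "int (card (toward x \<inter> toward y)) - int (card (away x \<inter> away y)) = 1"
    if x: "x \<in> S" "rising x \<or> falling x" and y: "y \<in> S" "rising y \<or> falling y" "inside y m"
      and ne: "x \<noteq> y" "\<not> arrow x y" "\<not> arrow y x" and w: "loop_within y x" for x y
  proof -
    have "{q \<in> S. inside y (un q) \<and> \<not> inside x (ov q)} = toward x \<inter> toward y"
      "{q \<in> S. inside y (ov q) \<and> \<not> inside x (un q)} = away x \<inter> away y"
      using w unfolding toward_away_inside[OF x] toward_away_inside[OF y(1,2)] loop_within_def by auto
    then show ?thesis using nested_loops[OF x(1) y(1) ne y(3)] by simp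
  qed
  have "inside x m" "inside y m" using x(2) y(2) by (auto simp: rising_def falling_def inside_def)
  then show ?thesis
    using loop_within_total[OF x(1) y(1) ne(2,3)] main[OF x y _ ne] main[OF y x _ ne(1)[symmetric] ne(3,2)]
    by (auto simp: Int_commute)
qed

lemma rising_common:
  assumes "x \<in> S" "rising x" "y \<in> S" "rising y" "x \<noteq> y" "\<not> arrow x y" "\<not> arrow y x"
  shows "int (card (outs x \<inter> outs y)) - int (card (ins x \<inter> ins y)) = 1"
  using straddling_common[of x y] assms by (simp add: toward_def away_def)

lemma falling_common:
  assumes "x \<in> S" "falling x" "y \<in> S" "falling y" "x \<noteq> y" "\<not> arrow x y" "\<not> arrow y x"
  shows "int (card (ins x \<inter> ins y)) - int (card (outs x \<inter> outs y)) = 1"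
proof -
  have "\<not> rising x" "\<not> rising y" using assms rising_not_falling by blast+
  then show ?thesis using straddling_common[of x y] assms by (simp add: toward_def away_def)
qed

lemma rising_falling_common:
  assumes x: "x \<in> S" "rising x" and y: "y \<in> S" "falling y" and ne: "\<not> arrow x y"
  shows "card (outs x \<inter> ins y) = 1"
proof -
  have "\<not> rising y" "x \<noteq> y" "\<not> arrow y x"
    using x y rising_not_falling arrow_into_rising[OF y(1) x(1)] by auto
  moreover have "ins x \<inter> outs y = {}"
    using arrow_into_rising[OF _ x(1) _ x(2)] arrow_from_falling[OF y(1) _ _ y(2)] rising_not_falling
    by (auto simp: ins_def outs_def)
  ultimately show ?thesis
    using straddling_common[of x y] x y ne by (simp add: toward_def away_def)
qed

end

section \<open>The hub of the digraph\<close>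

context unknot_chords
begin

definition risings :: "nat set" where "risings = {q \<in> S. rising q}"

definition fallings :: "nat set" where "fallings = {q \<in> S. falling q}"

definition local_chords :: "nat set" where "local_chords = {q \<in> S. \<not> rising q \<and> \<not> falling q}"

lemma card_risings_fallings: "card risings = card fallings"
  using card_rising_falling by (simp add: risings_def fallings_def)

lemma finite_risings [simp]: "finite risings" and finite_fallings [simp]: "finite fallings"
  using finite_S by (simp_all add: risings_def fallings_def)

lemma kinds: "S = risings \<union> fallings \<union> local_chords" "risings \<inter> fallings = {}"
  "risings \<inter> local_chords = {}" "fallings \<inter> local_chords = {}"
  using rising_not_falling by (auto simp: risings_def fallings_def local_chords_def)

lemma ins_rising: "a \<in> risings \<Longrightarrow> ins a \<subseteq> risings"
  using arrow_into_rising by (auto simp: risings_def ins_def)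

lemma outs_falling: "b \<in> fallings \<Longrightarrow> outs b \<subseteq> fallings"
  using arrow_from_falling by (auto simp: fallings_def outs_def)

lemma outs_subset: "outs p \<subseteq> S" and ins_subset: "ins p \<subseteq> S"
  by (auto simp: outs_def ins_def)

lemma in_ins: "q \<in> ins p \<longleftrightarrow> q \<in> S \<and> arrow q p" and in_outs: "q \<in> outs p \<longleftrightarrow> q \<in> S \<and> arrow p q"
  by (simp_all add: outs_def ins_def)

lemma risings_balance: "a \<in> risings \<Longrightarrow> card (outs a) = card (ins a) + 1"
  using outs_ins_balance[of a] rising_not_falling[of a] by (simp add: risings_def)

lemma fallings_balance: "b \<in> fallings \<Longrightarrow> card (ins b) = card (outs b) + 1"
  using outs_ins_balance[of b] rising_not_falling[of b]
  by (cases "rising b") (auto simp: fallings_def)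

lemma local_balance: "p \<in> local_chords \<Longrightarrow> card (outs p) = card (ins p)"
  using outs_ins_balance[of p] by (simp add: local_chords_def)

text \<open>
  On rising chords the arrows form a partial order, in which \<open>ov\<close> is increasing.
\<close>

lemma first_rising_source:
  assumes "X \<subseteq> risings" "X \<noteq> {}"
    and closed: "\<And>p q. p \<in> X \<Longrightarrow> q \<in> risings \<Longrightarrow> arrow q p \<Longrightarrow> q \<in> X"
  obtains a where "a \<in> X" "ins a = {}" "card (outs a) = 1"
proof -
  have fin: "finite X" using assms(1) finite_risings by (rule finite_subset)
  define a where "a = arg_min_on ov X"
  have a: "a \<in> X" "\<And>q. q \<in> X \<Longrightarrow> \<not> ov q < ov a"
    using arg_min_if_finite[OF fin assms(2), of ov] unfolding a_def by auto
  have "ins a = {}"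
  proof (rule ccontr)
    assume "ins a \<noteq> {}"
    then obtain q where q: "q \<in> ins a" by auto
    have "a \<in> risings" using a(1) assms(1) by blast
    then have "q \<in> risings" "arrow q a" using ins_rising[of a] q by (auto simp: in_ins)
    moreover from this have "ov q < ov a"
      using rising_arrow_iff[of q a] a(1) assms(1) by (auto simp: risings_def)
    ultimately show False using closed[OF a(1)] a(2) by blast
  qed
  then show thesis using that[OF a(1)] risings_balance[of a] a(1) assms(1) by auto
qed

lemma last_falling_sink:
  assumes "X \<subseteq> fallings" "X \<noteq> {}"
    and closed: "\<And>p q. p \<in> X \<Longrightarrow> q \<in> fallings \<Longrightarrow> arrow p q \<Longrightarrow> q \<in> X"
  obtains b where "b \<in> X" "outs b = {}" "card (ins b) = 1"
proof -
  have fin: "finite X" using assms(1) finite_fallings by (rule finite_subset)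
  have "Max (ov ` X) \<in> ov ` X" using fin assms(2) by (intro Max_in) auto
  then obtain b where b: "b \<in> X" "ov b = Max (ov ` X)" by auto
  have max: "\<not> ov b < ov q" if "q \<in> X" for q using that fin by (simp add: b(2) not_less)
  have "outs b = {}"
  proof (rule ccontr)
    assume "outs b \<noteq> {}"
    then obtain q where q: "q \<in> outs b" by auto
    have "b \<in> fallings" using b(1) assms(1) by blast
    then have "q \<in> fallings" "arrow b q" using outs_falling[of b] q by (auto simp: in_outs)
    moreover from this have "ov b < ov q"
      using falling_arrow_iff[of b q] b(1) assms(1) by (auto simp: fallings_def)
    ultimately show False using closed[OF b(1)] max by blast
  qed
  then show thesis using that[OF b(1)] fallings_balance[of b] b(1) assms(1) by auto
qed

text \<open>
  A rising chord \<open>a\<close> without predecessors has a single successor \<open>d\<close>. Any other rising chord \<open>x\<close> is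
  \<open>d\<close> itself or shares a successor with \<open>a\<close>, by \<open>rising_common\<close>, and thus has an arrow to \<open>d\<close>. In the
  same way a falling chord \<open>b\<close> without successors has a single predecessor \<open>e\<close>, which has an arrow to
  every other falling chord. If \<open>a\<close> and \<open>b\<close> are not interlaced, \<open>rising_falling_common\<close> gives \<open>d = e\<close>;
  otherwise \<open>d = b\<close>, and \<open>a\<close> and \<open>b\<close> are the only rising and falling chords.
\<close>

lemma hub_exists:
  assumes ne: "risings \<noteq> {}"
  obtains d where "d \<in> S" "\<And>a. a \<in> risings - {d} \<Longrightarrow> arrow a d" "\<And>b. b \<in> fallings - {d} \<Longrightarrow> arrow d b"
proof -
  have "fallings \<noteq> {}" using ne card_risings_fallings by auto
  obtain a where a: "a \<in> risings" "ins a = {}" "card (outs a) = 1"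
    using first_rising_source[OF subset_refl ne] by blast
  obtain b where b: "b \<in> fallings" "outs b = {}" "card (ins b) = 1"
    using last_falling_sink[OF subset_refl \<open>fallings \<noteq> {}\<close>] by blast
  obtain d where d: "outs a = {d}" using a(3) card_1_singletonE by blast
  obtain e where e: "ins b = {e}" using b(3) card_1_singletonE by blast
  have dS: "d \<in> S" "e \<in> S" using d e by (auto simp: in_outs in_ins set_eq_iff)
  have abS: "a \<in> S" "b \<in> S" "rising a" "falling b" using a b by (auto simp: risings_def fallings_def)
  have to_d: "arrow x d" if x: "x \<in> risings - {d}" for x
  proof (cases "x = a")
    case True
    then show ?thesis using d by (auto simp: in_outs set_eq_iff)
  next
    case False
    have xS: "x \<in> S" "rising x" using x by (auto simp: risings_def)
    have "\<not> arrow a x" "\<not> arrow x a"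
      using x xS d a(2) by (auto simp: in_outs in_ins set_eq_iff)
    then have "int (card (outs a \<inter> outs x)) - int (card (ins a \<inter> ins x)) = 1"
      using abS xS False by (intro rising_common) auto
    then have "outs a \<inter> outs x \<noteq> {}" using a(2) by auto
    then show ?thesis using d by (auto simp: in_outs)
  qed
  have from_e: "arrow e x" if x: "x \<in> fallings - {e}" for x
  proof (cases "x = b")
    case True
    then show ?thesis using e by (auto simp: in_ins set_eq_iff)
  next
    case False
    have xS: "x \<in> S" "falling x" using x by (auto simp: fallings_def)
    have "\<not> arrow b x" "\<not> arrow x b"
      using x xS e b(2) by (auto simp: in_outs in_ins set_eq_iff)
    then have "int (card (ins b \<inter> ins x)) - int (card (outs b \<inter> outs x)) = 1"
      using abS xS False by (intro falling_common) auto
    then have "ins b \<inter> ins x \<noteq> {}" using b(2) by auto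
    then show ?thesis using e by (auto simp: in_ins)
  qed
  show thesis
  proof (cases "arrow a b")
    case False
    then have "card (outs a \<inter> ins b) = 1" using abS by (intro rising_falling_common) auto
    then have "outs a \<inter> ins b \<noteq> {}" by auto
    then have "d = e" using d e by auto
    then show thesis using that[OF dS(1)] to_d from_e by blast
  next
    case True
    then have "b \<in> outs a" "a \<in> ins b" using abS by (auto simp: in_outs in_ins)
    then have db: "d = b" "e = a" using d e by auto
    have "x = a" if "x \<in> risings" for x
    proof -
      have "x \<noteq> b" using that b(1) kinds(2) by auto
      then have "arrow x b" using to_d[of x] that unfolding db(1) by blast
      then have "x \<in> ins b" using that unfolding in_ins risings_def by blast
      then show ?thesis using e unfolding db(2) by blast
    qed
    then have "risings = {a}" using a(1) by blast
    then have "card fallings = 1" using card_risings_fallings by simp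
    then have "fallings = {b}" using b(1) by (auto simp: card_1_singleton_iff)
    then show thesis using that[OF dS(1) to_d] unfolding db(1) by blast
  qed
qed

lemma local_arrow_less:
  assumes "p \<in> local_chords" "q \<in> local_chords" "arrow p q"
  shows "ov p < ov q"
proof -
  have S: "p \<in> S" "q \<in> S" and kinds: "\<not> rising p" "\<not> falling p" "\<not> rising q" "\<not> falling q"
    using assms by (simp_all add: local_chords_def)
  have "un p > m" if "ov p > m" using that kinds(1) range[OF S(1)] unfolding rising_def by linarith
  moreover have "un q < m" if "ov q < m" using that kinds(4) range[OF S(2)] unfolding falling_def by linarith
  ultimately show ?thesis using arrow_cases[OF S assms(3)] by linarith
qed

text \<open>
  The arrows among these chords point to later overpasses, so the first chord with an arrow would have
  arrows going out but none coming in.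
\<close>

lemma local_chords_unlinked:
  assumes bal: "\<And>p. p \<in> local_chords \<Longrightarrow> card (outs p \<inter> local_chords) = card (ins p \<inter> local_chords)"
    and p: "p \<in> local_chords"
  shows "outs p \<inter> local_chords = {}" "ins p \<inter> local_chords = {}"
proof -
  have "outs p \<inter> local_chords = {} \<and> ins p \<inter> local_chords = {}"
    using p
  proof (induction "ov p" arbitrary: p rule: less_induct)
    case less
    have "ins p \<inter> local_chords = {}"
    proof (rule ccontr)
      assume "ins p \<inter> local_chords \<noteq> {}"
      then obtain q where q: "q \<in> local_chords" "arrow q p" by (auto simp: in_ins)
      then have "outs q \<inter> local_chords = {}" using less local_arrow_less by blast
      then show False using q less.prems by (auto simp: in_outs local_chords_def)
    qed
    then show ?case using bal[OF less.prems] by simp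
  qed
  then show "outs p \<inter> local_chords = {}" "ins p \<inter> local_chords = {}" by auto
qed

lemma no_arrows:
  assumes "risings = {}" "p \<in> S"
  shows "outs p = {}" "ins p = {}"
proof -
  have "fallings = {}" using assms(1) card_risings_fallings by simp
  then have S: "S = local_chords" using kinds assms(1) by auto
  then have "outs p \<subseteq> local_chords" "ins p \<subseteq> local_chords" for p using outs_subset ins_subset by auto
  then have "outs p \<inter> local_chords = outs p" "ins p \<inter> local_chords = ins p" for p by auto
  then show "outs p = {}" "ins p = {}"
    using local_chords_unlinked[of p] local_balance assms(2) S by auto
qed

end

text \<open>
  The hub \<open>d\<close> turns out to be the second crossing of the clasp, and the rising and falling chords
  other than \<open>d\<close> the row of half-twists.
\<close>

locale hub_chords = unknot_chords +
  fixes d :: nat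
  assumes d: "d \<in> S" and to_hub: "a \<in> risings - {d} \<Longrightarrow> arrow a d"
    and from_hub: "b \<in> fallings - {d} \<Longrightarrow> arrow d b"
    and ne: "risings \<noteq> {}"
begin

lemma risings_into_hub: "risings - {d} \<subseteq> ins d"
proof
  fix a assume "a \<in> risings - {d}"
  then show "a \<in> ins d" using to_hub[of a] by (simp add: in_ins risings_def)
qed

lemma fallings_from_hub: "fallings - {d} \<subseteq> outs d"
proof
  fix b assume "b \<in> fallings - {d}"
  then show "b \<in> outs d" using from_hub[of b] by (simp add: in_outs fallings_def)
qed

text \<open>
  A predecessor \<open>x\<close> of \<open>a\<close> that is minimal has only one successor; but both \<open>a\<close> and the hub are
  successors of \<open>x\<close>.
\<close>

lemma rising_arrows:
  assumes a: "a \<in> risings - {d}"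
  shows "ins a = {}" "outs a = {d}"
proof -
  have aS: "a \<in> S" using a by (auto simp: risings_def)
  show ins: "ins a = {}"
  proof (rule ccontr)
    assume ne: "ins a \<noteq> {}"
    have "ins a \<subseteq> risings" using ins_rising a by auto
    moreover have "q \<in> ins a" if "p \<in> ins a" "q \<in> risings" "arrow q p" for p q
    proof -
      have "rising p" "rising q" "rising a" "arrow p a" "q \<in> S"
        using that a ins_rising[of a] by (auto simp: risings_def in_ins)
      then show ?thesis
        using that(3) rising_arrow_iff[of q p] rising_arrow_iff[of p a] rising_arrow_iff[of q a]
        by (auto simp: in_ins)
    qed
    ultimately obtain x where x: "x \<in> ins a" "ins x = {}" "card (outs x) = 1"
      using first_rising_source[OF _ ne] by blast
    have "x \<in> risings" using ins_rising a x(1) by auto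
    have "a \<in> outs x" using x(1) aS by (auto simp: in_ins in_outs)
    have "x \<noteq> d"
    proof
      assume "x = d"
      then have "arrow d a" "arrow a d" using x(1) to_hub[OF a] by (auto simp: in_ins)
      then show False using arrow_asym by blast
    qed
    then have "d \<in> outs x" using to_hub[of x] \<open>x \<in> risings\<close> d by (auto simp: in_outs)
    then show False using \<open>a \<in> outs x\<close> a x(3) by (auto simp: card_1_singleton_iff)
  qed
  have "card (outs a) = 1" using risings_balance[of a] a ins by simp
  moreover have "d \<in> outs a" using to_hub[OF a] d by (simp add: in_outs)
  ultimately show "outs a = {d}" by (auto simp: card_1_singleton_iff)
qed

lemma falling_arrows:
  assumes b: "b \<in> fallings - {d}"
  shows "outs b = {}" "ins b = {d}"
proof -
  have bS: "b \<in> S" using b by (auto simp: fallings_def)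
  show outs: "outs b = {}"
  proof (rule ccontr)
    assume ne: "outs b \<noteq> {}"
    have "outs b \<subseteq> fallings" using outs_falling b by auto
    moreover have "q \<in> outs b" if "p \<in> outs b" "q \<in> fallings" "arrow p q" for p q
    proof -
      have "falling p" "falling q" "falling b" "arrow b p" "q \<in> S"
        using that b outs_falling[of b] by (auto simp: fallings_def in_outs)
      then show ?thesis
        using that(3) falling_arrow_iff[of p q] falling_arrow_iff[of b p] falling_arrow_iff[of b q]
        by (auto simp: in_outs)
    qed
    ultimately obtain x where x: "x \<in> outs b" "outs x = {}" "card (ins x) = 1"
      using last_falling_sink[OF _ ne] by blast
    have "x \<in> fallings" using outs_falling b x(1) by auto
    have "b \<in> ins x" using x(1) bS by (auto simp: in_ins in_outs)
    have "x \<noteq> d"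
    proof
      assume "x = d"
      then have "arrow b d" "arrow d b" using x(1) from_hub[OF b] by (auto simp: in_outs)
      then show False using arrow_asym by blast
    qed
    then have "d \<in> ins x" using from_hub[of x] \<open>x \<in> fallings\<close> d by (auto simp: in_ins)
    then show False using \<open>b \<in> ins x\<close> b x(3) by (auto simp: card_1_singleton_iff)
  qed
  have "card (ins b) = 1" using fallings_balance[of b] b outs by simp
  moreover have "d \<in> ins b" using from_hub[OF b] d by (simp add: in_ins)
  ultimately show "ins b = {d}" by (auto simp: card_1_singleton_iff)
qed

lemma hub_rising:
  assumes "d \<in> risings"
  shows "outs d = fallings"
proof -
  note risings_into_hub
  moreover have "ins d \<subseteq> risings - {d}" using ins_rising[OF assms] by (auto simp: in_ins)
  ultimately have "card (outs d) = card fallings"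
    using risings_balance[OF assms] card_risings_fallings assms card_Suc_Diff1[of risings d] by auto
  moreover have "fallings \<subseteq> outs d"
    using fallings_from_hub assms kinds(2) by auto
  ultimately show ?thesis using card_subset_eq[of "outs d" fallings] by auto
qed

lemma hub_falling:
  assumes "d \<in> fallings"
  shows "ins d = risings"
proof -
  note fallings_from_hub
  moreover have "outs d \<subseteq> fallings - {d}" using outs_falling[OF assms] by (auto simp: in_outs)
  ultimately have "card (ins d) = card risings"
    using fallings_balance[OF assms] card_risings_fallings assms card_Suc_Diff1[of fallings d] by auto
  moreover have "risings \<subseteq> ins d"
    using risings_into_hub assms kinds(2) by auto
  ultimately show ?thesis using card_subset_eq[of "ins d" risings] by auto
qed

lemma local_arrows:
  assumes p: "p \<in> local_chords" "p \<noteq> d"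
  shows "outs p \<subseteq> local_chords" "ins p \<subseteq> local_chords"
proof -
  have pS: "p \<in> S" using p by (simp add: local_chords_def)
  show "outs p \<subseteq> local_chords"
  proof
    fix q assume q: "q \<in> outs p"
    then have qS: "q \<in> S" "p \<in> ins q" using pS by (auto simp: in_outs in_ins)
    show "q \<in> local_chords"
    proof (rule ccontr)
      assume "q \<notin> local_chords"
      then consider "q \<in> risings" | "q \<in> fallings - {d}" | "q \<in> fallings" "q = d" using qS kinds(1) by auto
      then show False
      proof cases
        case 1
        then show ?thesis using ins_rising qS p kinds(3) by auto
      next
        case 2
        then show ?thesis using falling_arrows(2)[OF 2] qS p by auto
      next
        case 3
        then show ?thesis using hub_falling qS p kinds(3) by auto
      qed
    qed
  qed
  show "ins p \<subseteq> local_chords"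
  proof
    fix q assume q: "q \<in> ins p"
    then have qS: "q \<in> S" "p \<in> outs q" using pS by (auto simp: in_outs in_ins)
    show "q \<in> local_chords"
    proof (rule ccontr)
      assume "q \<notin> local_chords"
      then consider "q \<in> fallings" | "q \<in> risings - {d}" | "q \<in> risings" "q = d" using qS kinds(1) by auto
      then show False
      proof cases
        case 1
        then show ?thesis using outs_falling qS p kinds(4) by auto
      next
        case 2
        then show ?thesis using rising_arrows(2)[OF 2] qS p by auto
      next
        case 3
        then show ?thesis using hub_rising qS p kinds(4) by auto
      qed
    qed
  qed
qed

text \<open>
  For a chord that misses \<open>c\<close>, as many arrows come in as go out. If the hub is such a chord, it has as
  many arrows from rising chords as to falling ones, and the rest balances again.
\<close>

lemma local_isolated:
  assumes p: "p \<in> local_chords" "p \<noteq> d"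
  shows "outs p = {}" "ins p = {}"
proof -
  have "card (outs q \<inter> local_chords) = card (ins q \<inter> local_chords)" if q: "q \<in> local_chords" for q
  proof (cases "q = d")
    case False
    then have "outs q \<inter> local_chords = outs q" "ins q \<inter> local_chords = ins q"
      using local_arrows[OF q] by auto
    then show ?thesis using local_balance[OF q] by simp
  next
    case True
    have dn: "d \<notin> risings" "d \<notin> fallings" using q True kinds by auto
    have "outs d \<inter> risings = {}"
      using rising_arrows(1) dn d by (auto simp: in_outs in_ins set_eq_iff risings_def)
    moreover have "fallings \<subseteq> outs d" using fallings_from_hub dn by auto
    ultimately have o: "outs d = (outs d \<inter> local_chords) \<union> fallings" using outs_subset[of d] kinds(1) by auto
    have "ins d \<inter> fallings = {}"
      using falling_arrows(1) dn d by (auto simp: in_outs in_ins set_eq_iff fallings_def)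
    moreover have "risings \<subseteq> ins d" using risings_into_hub dn by auto
    ultimately have i: "ins d = (ins d \<inter> local_chords) \<union> risings" using ins_subset[of d] kinds(1) by auto
    have "card (outs d) = card (outs d \<inter> local_chords) + card fallings"
      using kinds(4) by (subst o, subst card_Un_disjoint) auto
    moreover have "card (ins d) = card (ins d \<inter> local_chords) + card risings"
      using kinds(3) by (subst i, subst card_Un_disjoint) auto
    ultimately show ?thesis using local_balance[OF q] card_risings_fallings True by simp
  qed
  then have "outs p \<inter> local_chords = {}" "ins p \<inter> local_chords = {}"
    using local_chords_unlinked p(1) by blast+
  then show "outs p = {}" "ins p = {}" using local_arrows[OF p] by auto
qed

end

section \<open>The row of half-twists\<close>

context hub_chords
begin

definition row :: "nat set" where "row = (risings \<union> fallings) - {d}"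

definition first_end :: "nat \<Rightarrow> nat" where "first_end r = min (ov r) (un r)"

definition second_end :: "nat \<Rightarrow> nat" where "second_end r = max (ov r) (un r)"

lemma row_S: "r \<in> row \<Longrightarrow> r \<in> S"
  by (auto simp: row_def risings_def fallings_def)

lemma row_cases:
  assumes "r \<in> row"
  obtains "rising r" "\<not> falling r" "r \<in> risings - {d}" "first_end r = un r" "second_end r = ov r" |
    "falling r" "\<not> rising r" "r \<in> fallings - {d}" "first_end r = ov r" "second_end r = un r"
proof (cases "r \<in> risings")
  case True
  then show thesis
    using assms that(1) rising_not_falling[of r]
    by (auto simp: row_def risings_def rising_def first_end_def second_end_def)
next
  case False
  then have r: "r \<in> fallings - {d}" using assms by (auto simp: row_def)
  then show thesis
    using that(2) rising_not_falling[of r]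
    by (auto simp: fallings_def falling_def first_end_def second_end_def)
qed

lemma row_ends:
  assumes "r \<in> row"
  shows "0 < first_end r" "first_end r < m" "m < second_end r" "second_end r < N"
    "inside r p \<longleftrightarrow> first_end r < p \<and> p < second_end r"
  using assms by (cases rule: row_cases; use range[OF row_S[OF assms]] in
    \<open>auto simp: rising_def falling_def inside_def\<close>)+

lemma row_first_end_inj: "r \<in> row \<Longrightarrow> r' \<in> row \<Longrightarrow> first_end r = first_end r' \<longleftrightarrow> r = r'"
  using ov_inj[of r r'] un_inj[of r r'] ov_un[of r r'] ov_un[of r' r] row_S[of r] row_S[of r']
  unfolding first_end_def min_def by (auto split: if_splits)

lemma row_no_arrow:
  assumes "r \<in> row" "r' \<in> row"
  shows "\<not> arrow r r'"
proof
  assume arr: "arrow r r'"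
  have "r' \<in> outs r" "r \<in> ins r'" using arr row_S assms by (simp_all add: in_outs in_ins)
  moreover have "r' \<noteq> d" "r \<noteq> d" using assms by (auto simp: row_def)
  ultimately have ends: "r' \<in> outs r" "r' \<noteq> d" by simp_all
  from assms(1) show False
    by (cases rule: row_cases) (use ends rising_arrows(2)[of r] falling_arrows(1)[of r] in auto)
qed

text \<open>
  Chords of the row are not interlaced, so the knot runs through the row backwards the second time.
\<close>

lemma row_nested:
  assumes r: "r \<in> row" "r' \<in> row" and less: "first_end r < first_end r'"
  shows "second_end r' < second_end r"
proof -
  have S: "r \<in> S" "r' \<in> S" using r row_S by auto
  have "inside r (ov r') \<longleftrightarrow> inside r (un r')"
    using inside_arrow[OF S] row_no_arrow[OF r] row_no_arrow[OF r(2,1)] by (auto split: if_splits)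
  moreover have "inside r (first_end r')" using less row_ends[OF r(1)] row_ends[OF r(2)] by simp
  ultimately have "inside r (second_end r')"
    unfolding first_end_def second_end_def min_def max_def by (auto split: if_splits)
  then show ?thesis using row_ends(5)[OF r(1)] by simp
qed

text \<open>
  In the cyclic order the overpasses of \<open>c\<close> and \<open>d\<close> are neighbours up to isolated chords, and so are
  their underpasses; the row is traversed between the two pairs.
\<close>

lemma hub_ends:
  assumes r: "r \<in> row"
  shows "ov d < m \<and> ov d < first_end r \<or> m < ov d \<and> second_end r < ov d"
    and "un d < m \<and> first_end r < un d \<or> m < un d \<and> un d < second_end r"
proof -
  have S: "r \<in> S" by (rule row_S[OF r])
  from r have "(ov d < m \<and> ov d < first_end r \<or> m < ov d \<and> second_end r < ov d) \<and>
    (un d < m \<and> first_end r < un d \<or> m < un d \<and> un d < second_end r)"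
  proof (cases rule: row_cases)
    case 1
    have "arrow r d" using to_hub 1 by blast
    from arrow_cases[OF S d this] show ?thesis
      using 1(1) range[OF d] unfolding 1(4,5) rising_def by linarith
  next
    case 2
    have "arrow d r" using from_hub 2 by blast
    from arrow_cases[OF d S this] show ?thesis
      using 2(1) range[OF d] unfolding 2(4,5) falling_def by linarith
  qed
  then show "ov d < m \<and> ov d < first_end r \<or> m < ov d \<and> second_end r < ov d"
    and "un d < m \<and> first_end r < un d \<or> m < un d \<and> un d < second_end r" by auto
qed

definition core :: "nat set" where "core = insert d row"

lemma outside_core: "p \<in> S \<Longrightarrow> p \<notin> core \<Longrightarrow> p \<in> local_chords \<and> p \<noteq> d"
  using kinds by (auto simp: core_def row_def)

lemma isolated:
  assumes p: "p \<in> S" "p \<notin> core" and q: "q \<in> S"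
  shows "inside p (ov q) \<longleftrightarrow> inside p (un q)" "inside q (ov p) \<longleftrightarrow> inside q (un p)"
proof -
  have "\<not> arrow p q" "\<not> arrow q p"
    using local_isolated[of p] outside_core[OF p] q by (auto simp: in_outs in_ins set_eq_iff)
  then show "inside p (ov q) \<longleftrightarrow> inside p (un q)" "inside q (ov p) \<longleftrightarrow> inside q (un p)"
    using inside_arrow[OF p(1) q] inside_arrow[OF q p(1)] by (auto split: if_splits)
qed

lemma isolated_one_side:
  assumes p: "p \<in> S" "p \<notin> core"
  shows "ov p < m \<and> un p < m \<or> m < ov p \<and> m < un p"
  using outside_core[OF p] range[OF p(1)] unfolding local_chords_def rising_def falling_def
  by auto

lemma row_nonempty: "row \<noteq> {}"
proof
  assume "row = {}"
  then have "risings \<subseteq> {d}" "fallings \<subseteq> {d}" by (auto simp: row_def)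
  moreover have "fallings \<noteq> {}" using ne card_risings_fallings by auto
  ultimately show False using ne kinds(2) by auto
qed

text \<open>
  The core lies on one side of every isolated chord, the side that contains \<open>c\<close>. For the row this
  holds because its chords are interlaced with \<open>c\<close>, for the hub because it is interlaced with the row.
\<close>

lemma core_outside_isolated:
  assumes p: "p \<in> S" "p \<notin> core" and q: "q \<in> core"
  shows "\<not> inside p (ov q)" "\<not> inside p (un q)"
proof -
  have row: "\<not> inside p (first_end r) \<and> \<not> inside p (second_end r)" if r: "r \<in> row" for r
  proof -
    have "inside p (first_end r) \<longleftrightarrow> inside p (second_end r)"
      using isolated(1)[OF p row_S[OF r]] unfolding first_end_def second_end_def min_def max_def
      by (auto split: if_splits)
    moreover have "\<not> (inside p (first_end r) \<and> inside p (second_end r))"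
      using isolated_one_side[OF p] row_ends[OF r] unfolding inside_def by linarith
    ultimately show ?thesis by auto
  qed
  have "\<not> inside p (ov q) \<and> \<not> inside p (un q)"
  proof (cases "q = d")
    case False
    then have qr: "q \<in> row" using q by (simp add: core_def)
    then show ?thesis
      by (cases rule: row_cases) (use row[OF qr] in auto)
  next
    case True
    obtain r where r: "r \<in> row" using row_nonempty by auto
    have "\<not> (inside p (ov d) \<and> inside p (un d))"
      using row[OF r] hub_ends[OF r] isolated_one_side[OF p] row_ends[OF r] unfolding inside_def by linarith
    then show ?thesis using isolated(1)[OF p d] True by auto
  qed
  then show "\<not> inside p (ov q)" "\<not> inside p (un q)" by auto
qed

text \<open>
  The contribution of \<open>q\<close> to the intersection number of the loop of \<open>c\<close> with the loop of \<open>r\<close>.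
\<close>

definition loop_weight :: "nat \<Rightarrow> nat \<Rightarrow> int" where
  "loop_weight r q = of_bool (ov q < m \<and> inside r (un q)) - of_bool (un q < m \<and> inside r (ov q))"

lemma loop_weight_sum:
  assumes r: "r \<in> row"
  shows "(\<Sum>q\<in>S. loop_weight r q) + of_bool (falling r) = 1"
proof -
  have "inside r m" using row_ends[OF r] by simp
  moreover have "ov r < m \<longleftrightarrow> falling r"
    using r by (cases rule: row_cases) (auto simp: rising_def falling_def)
  ultimately show ?thesis
    using crossing_loops[OF row_S[OF r]] by (simp add: loop_weight_def)
qed

lemma loop_weight_row:
  assumes r: "r \<in> row" and q: "q \<in> row"
  shows "loop_weight r q = (if first_end r < first_end q then of_bool (falling q) - of_bool (rising q) else 0)"
proof -
  have "inside r (second_end q) \<longleftrightarrow> first_end r < first_end q"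
  proof
    assume "inside r (second_end q)"
    then have "second_end q < second_end r" using row_ends(5)[OF r] by simp
    then show "first_end r < first_end q"
      using row_nested[OF q r] row_first_end_inj[OF r q] by (metis less_asym less_irrefl linorder_neqE_nat)
  next
    assume "first_end r < first_end q"
    then show "inside r (second_end q)"
      using row_nested[OF r q] row_ends[OF r] row_ends[OF q] by simp
  qed
  with q show ?thesis
    by (cases rule: row_cases) (auto simp: loop_weight_def rising_def falling_def)
qed

lemma loop_weight_hub:
  assumes r: "r \<in> row"
  shows "loop_weight r d = of_bool (ov d < m)"
proof -
  have "inside r (un d)" "\<not> inside r (ov d)"
    unfolding row_ends(5)[OF r] using hub_ends[OF r] row_ends(1-4)[OF r] by linarith+
  then show ?thesis by (simp add: loop_weight_def)
qed

lemma loop_weight_isolated: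
  assumes r: "r \<in> row" and p: "p \<in> S" "p \<notin> core"
  shows "loop_weight r p = 0"
  using isolated(2)[OF p row_S[OF r]] isolated_one_side[OF p] by (auto simp: loop_weight_def)

text \<open>
  Compare the intersection numbers of the loop of \<open>c\<close> with the loops of two successive chords of the
  row. Only \<open>r'\<close> contributes differently to them, by a sign that depends on its kind, and this has to
  make up for the difference of the corner terms.
\<close>

lemma row_alternates:
  assumes r: "r \<in> row" "r' \<in> row" and less: "first_end r < first_end r'"
    and consecutive: "\<And>q. q \<in> row \<Longrightarrow> \<not> (first_end r < first_end q \<and> first_end q < first_end r')"
  shows "falling r \<longleftrightarrow> rising r'"
proof -
  have "loop_weight r q - loop_weight r' q = (if q = r' then of_bool (falling r') - of_bool (rising r') else 0)"
    if q: "q \<in> S" for q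
  proof -
    consider "q \<in> row" | "q = d" | "q \<notin> core" by (auto simp: core_def)
    then show ?thesis
    proof cases
      case 1
      have "first_end q = first_end r' \<longleftrightarrow> q = r'" using row_first_end_inj[OF 1 r(2)] .
      then show ?thesis
        using consecutive[OF 1] less by (auto simp: loop_weight_row[OF r(1) 1] loop_weight_row[OF r(2) 1])
    next
      case 2
      have "d \<noteq> r'" using r(2) by (auto simp: row_def)
      then show ?thesis using 2 loop_weight_hub[OF r(1)] loop_weight_hub[OF r(2)] by simp
    next
      case 3
      then have "q \<noteq> r'" using r(2) by (auto simp: core_def)
      then show ?thesis using loop_weight_isolated[OF r(1) q 3] loop_weight_isolated[OF r(2) q 3] by simp
    qed
  qed
  then have "(\<Sum>q\<in>S. loop_weight r q - loop_weight r' q) = of_bool (falling r') - of_bool (rising r')"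
    using finite_S row_S[OF r(2)] by simp
  then have "of_bool (falling r') - of_bool (rising r') + of_bool (falling r) = (of_bool (falling r') :: int)"
    using loop_weight_sum[OF r(1)] loop_weight_sum[OF r(2)] by (simp add: sum_subtractf)
  then show ?thesis by (cases "falling r"; cases "rising r'") auto
qed

lemma row_last:
  assumes r: "r \<in> row" and last: "\<And>q. q \<in> row \<Longrightarrow> \<not> first_end r < first_end q"
  shows "falling r \<longleftrightarrow> m < ov d"
proof -
  have "loop_weight r q = (if q = d then of_bool (ov d < m) else 0)" if q: "q \<in> S" for q
  proof -
    consider "q \<in> row" "q \<noteq> d" | "q = d" | "q \<notin> core" "q \<noteq> d" by (auto simp: core_def row_def)
    then show ?thesis
      using loop_weight_row[OF r] last loop_weight_hub[OF r] loop_weight_isolated[OF r q]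
      by cases auto
  qed
  then have "(\<Sum>q\<in>S. loop_weight r q) = of_bool (ov d < m)" using finite_S d by simp
  then show ?thesis using loop_weight_sum[OF r] range[OF d] by (cases "falling r") (auto simp: of_bool_def split: if_splits)
qed

lemma card_row: "odd (card row) \<longleftrightarrow> (ov d < m \<longleftrightarrow> m < un d)"
proof -
  have disj: "risings \<inter> fallings = {}" by (rule kinds)
  have c: "card (risings \<union> fallings) = 2 * card risings"
    using card_risings_fallings card_Un_disjoint[OF finite_risings finite_fallings disj] by simp
  have pos: "card risings > 0" using ne by (simp add: card_gt_0_iff)
  have "d \<in> risings \<union> fallings \<longleftrightarrow> (ov d < m \<longleftrightarrow> m < un d)"
    using d range[OF d] by (auto simp: risings_def fallings_def rising_def falling_def)
  moreover have "odd (card row) \<longleftrightarrow> d \<in> risings \<union> fallings"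
    using c pos by (auto simp: row_def card_Diff_singleton_if)
  ultimately show ?thesis by simp
qed

end

section \<open>From codes to chords\<close>

lemma filter_eq_map_nth:
  assumes "sorted_wrt (<) is" "set is = {i. i < length D \<and> P (D ! i)}"
  shows "filter P D = map ((!) D) is"
proof -
  have "filter P D = filter P (map ((!) D) [0..<length D])" by (simp add: map_nth)
  also have "\<dots> = map ((!) D) (filter (\<lambda>i. P (D ! i)) [0..<length D])" by (simp add: filter_map comp_def)
  also have "filter (\<lambda>i. P (D ! i)) [0..<length D] = is"
    using assms by (intro strict_sorted_equal) (auto simp: sorted_wrt_filter)
  finally show ?thesis .
qed

text \<open>
  With the base point at \<open>c\<close>, a pair counted by the formula cannot involve \<open>c\<close>, because its first
  passage has the wrong level to be the first one of the pattern. All contributions come from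
  positive crossings and are nonnegative, so none is positive.
\<close>

lemma casson_zero_no_pattern:
  assumes wf: "well_formed E" and zero: "casson l E = 0" and hd: "E \<noteq> []" "E ! 0 = (c, other_level l, e)"
    and pos: "\<And>q l' f. (q, l', f) \<in> set E \<Longrightarrow> q \<noteq> c \<Longrightarrow> f = Positive"
    and lt: "i1 < i2" "i2 < i3" "i3 < i4" "i4 < length E"
    and E1: "E ! i1 = (q, l, Positive)" and E2: "E ! i2 = (p, other_level l, Positive)"
    and E3: "E ! i3 = (q, other_level l, Positive)" and E4: "E ! i4 = (p, l, Positive)"
  shows False
proof -
  have dist: "distinct E" by (rule well_formed_distinct[OF wf])
  have pq: "q \<noteq> p" using E1 E4 lt dist nth_eq_iff_index_eq[OF dist, of i1 i4] by auto
  have nonneg: "interlacing l a b (restrict_to {a, b} E) \<ge> 0" for a b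
  proof (cases "interlacing l a b (restrict_to {a, b} E) = 0")
    case False
    then obtain e1 e2 where W: "restrict_to {a, b} E = [(a, l, e1), (b, other_level l, e2), (a, other_level l, e1), (b, l, e2)]"
      by (rule interlacing_nonzeroD)
    have "a \<noteq> b" using False by auto
    obtain t where "E = (c, other_level l, e) # t" using hd by (cases E) auto
    then have "c \<notin> {a, b}" using W by auto
    have "set (restrict_to {a, b} E) \<subseteq> set E" by (auto simp: restrict_to_def)
    then have "(a, l, e1) \<in> set E" "(b, l, e2) \<in> set E" unfolding W by auto
    then have "e1 = Positive" "e2 = Positive" using pos \<open>c \<notin> {a, b}\<close> by blast+
    then show ?thesis unfolding W interlacing_word by (simp add: crossing_sign_def)
  qed simp
  have "set [i1, i2, i3, i4] = {i. i < length E \<and> fst (E ! i) \<in> {q, p}}"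
  proof (rule set_eqI)
    fix i
    have "i \<in> {i1, i2, i3, i4}" if i: "i < length E" "fst (E ! i) \<in> {q, p}"
    proof -
      have "partner E i1 = i3" "partner E i2 = i4"
        using E1 E2 E3 E4 lt by (auto intro!: partner_eqI[OF wf])
      moreover have "i = i1 \<or> partner E i1 = i" if "fst (E ! i) = q"
        using that i E1 lt partner_eqI[OF wf, of i1 i] by auto
      moreover have "i = i2 \<or> partner E i2 = i" if "fst (E ! i) = p"
        using that i E2 lt partner_eqI[OF wf, of i2 i] by auto
      ultimately show ?thesis using i(2) by auto
    qed
    then show "i \<in> set [i1, i2, i3, i4] \<longleftrightarrow> i \<in> {i. i < length E \<and> fst (E ! i) \<in> {q, p}}"
      using lt E1 E2 E3 E4 by auto
  qed
  then have "restrict_to {q, p} E = map ((!) E) [i1, i2, i3, i4]"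
    unfolding restrict_to_def using lt by (intro filter_eq_map_nth) auto
  then have one: "interlacing l q p (restrict_to {q, p} E) = 1"
    using E1 E2 E3 E4 pq by (simp add: interlacing_word crossing_sign_def)
  have mem: "q \<in> crossings E" "p \<in> crossings E"
    using E1 E2 lt nth_mem[of i1 E] nth_mem[of i2 E] by (auto simp: crossings_iff simp del: nth_mem)
  have "(\<Sum>b\<in>crossings E. interlacing l q b (restrict_to {q, b} E)) = 0"
    using zero nonneg mem(1) unfolding casson_def
    by (subst (asm) sum_nonneg_eq_0_iff) (auto intro: sum_nonneg)
  then have "interlacing l q p (restrict_to {q, p} E) = 0"
    using nonneg mem(2) by (subst (asm) sum_nonneg_eq_0_iff) auto
  then show False using one by simp
qed

definition passage_pos :: "gauss_code \<Rightarrow> level \<Rightarrow> nat \<Rightarrow> nat" where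
  "passage_pos D l q = (THE p. p < length D \<and> fst (D ! p) = q \<and> fst (snd (D ! p)) = l)"

lemma passage_pos:
  assumes wf: "well_formed D" and q: "q \<in> crossings D"
  shows "passage_pos D l q < length D" "fst (D ! passage_pos D l q) = q" "fst (snd (D ! passage_pos D l q)) = l"
    and "p < length D \<Longrightarrow> fst (D ! p) = q \<Longrightarrow> fst (snd (D ! p)) = l \<Longrightarrow> passage_pos D l q = p"
proof -
  obtain l' e where "(q, l', e) \<in> set D" using q by (auto simp: crossings_iff)
  then have "(q, l, e) \<in> set D" using well_formed_mate[OF wf, of q l' e] by (cases "l' = l") (auto simp: level_neq_iff)
  then obtain r where r: "r < length D" "D ! r = (q, l, e)" by (metis in_set_conv_nth)
  have uniq: "p = r" if "p < length D" "fst (D ! p) = q" "fst (snd (D ! p)) = l" for p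
    using partner_unique(2)[OF wf r, of p] that by (cases "p = r") auto
  have pp: "passage_pos D l q = r"
    unfolding passage_pos_def
  proof (rule the_equality)
    show "r < length D \<and> fst (D ! r) = q \<and> fst (snd (D ! r)) = l" using r by simp
    show "p = r" if "p < length D \<and> fst (D ! p) = q \<and> fst (snd (D ! p)) = l" for p
      using that by (intro uniq) auto
  qed
  show "passage_pos D l q < length D" "fst (D ! passage_pos D l q) = q" "fst (snd (D ! passage_pos D l q)) = l"
    using r by (simp_all add: pp)
  show "p < length D \<Longrightarrow> fst (D ! p) = q \<Longrightarrow> fst (snd (D ! p)) = l \<Longrightarrow> passage_pos D l q = p"
    using uniq[of p] pp by simp
qed

text \<open>
  The word starts at the overpass of the negative crossing \<open>c\<close>, and the unknot enters through its
  Casson invariant.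
\<close>

locale based_unknot =
  fixes D :: gauss_code and c :: nat
  assumes knot: "knot_diagram D" and unknot: "casson l D = 0"
    and base: "D \<noteq> []" "D ! 0 = (c, Over, Negative)" and neg: "negative_crossings D = {c}"
begin

lemma wf: "well_formed D"
  using knot by (simp add: knot_diagram_def)

definition positives :: "nat set" where "positives = crossings D - {c}"

definition over_at :: "nat \<Rightarrow> nat" where "over_at = passage_pos D Over"

definition under_at :: "nat \<Rightarrow> nat" where "under_at = passage_pos D Under"

definition mid :: nat where "mid = partner D 0"

lemma len: "0 < length D"
  using base(1) by simp

lemma mid: "mid < length D" "0 < mid" "D ! mid = (c, Under, Negative)" "partner D mid = 0" "partner D 0 = mid"
  using partner_props[OF wf len] nth_partner[OF wf len base(2)] partner_partner[OF wf len]
  by (auto simp: mid_def)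

lemma positive_sign: "(q, l, e) \<in> set D \<Longrightarrow> q \<noteq> c \<Longrightarrow> e = Positive"
  using neg by (cases e) (auto simp: negative_crossings_def)

lemma at:
  assumes "q \<in> positives"
  shows "over_at q < length D" "under_at q < length D"
    "D ! over_at q = (q, Over, Positive)" "D ! under_at q = (q, Under, Positive)"
    "partner D (over_at q) = under_at q" "partner D (under_at q) = over_at q"
proof -
  have q: "q \<in> crossings D" "q \<noteq> c" using assms by (auto simp: positives_def)
  note o = passage_pos[OF wf q(1), where l = Over] and u = passage_pos[OF wf q(1), where l = Under]
  show lt: "over_at q < length D" "under_at q < length D" using o(1) u(1) by (simp_all add: over_at_def under_at_def)
  have letter: "D ! p = (q, l, Positive)" if "p < length D" "fst (D ! p) = q" "fst (snd (D ! p)) = l" for p l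
    using that nth_mem[OF that(1)] positive_sign q(2) by (cases "D ! p") auto
  show eq: "D ! over_at q = (q, Over, Positive)" "D ! under_at q = (q, Under, Positive)"
    using letter o(1-3) u(1-3) by (simp_all add: over_at_def under_at_def)
  then have "over_at q \<noteq> under_at q" by auto
  then show "partner D (over_at q) = under_at q" "partner D (under_at q) = over_at q"
    using lt eq by (auto intro!: partner_eqI[OF wf])
qed

lemma position_cases:
  assumes "p < length D"
  obtains "p = 0" | "p = mid" | q where "q \<in> positives" "p = over_at q" | q where "q \<in> positives" "p = under_at q"
proof -
  obtain q l e where q: "D ! p = (q, l, e)" by (cases "D ! p") auto
  have qD: "q \<in> crossings D" using nth_mem[OF assms] q by (auto simp: crossings_iff)
  show thesis
  proof (cases "q = c")
    case True
    then have "p = 0 \<or> p = mid" using partner_eqI[OF wf len assms] q base(2) mid(5) by (cases "p = 0") auto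
    then show thesis using that(1,2) by blast
  next
    case False
    then have "q \<in> positives" using qD by (simp add: positives_def)
    moreover have "passage_pos D l q = p" using passage_pos(4)[OF wf qD assms] q by simp
    ultimately show thesis
      using that(3,4) by (cases l) (auto simp: over_at_def under_at_def)
  qed
qed

lemma at_inj:
  assumes "p \<in> positives" "q \<in> positives"
  shows "over_at p = over_at q \<longleftrightarrow> p = q" "under_at p = under_at q \<longleftrightarrow> p = q" "over_at p \<noteq> under_at q"
    "over_at p \<noteq> 0" "under_at p \<noteq> 0" "over_at p \<noteq> mid" "under_at p \<noteq> mid"
proof -
  have pc: "p \<noteq> c" using assms by (simp add: positives_def)
  have *: "D ! over_at p = (p, Over, Positive)" "D ! over_at q = (q, Over, Positive)"
    "D ! under_at p = (p, Under, Positive)" "D ! under_at q = (q, Under, Positive)"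
    using at assms by simp_all
  show "over_at p = over_at q \<longleftrightarrow> p = q" "under_at p = under_at q \<longleftrightarrow> p = q" "over_at p \<noteq> under_at q"
    "over_at p \<noteq> 0" "under_at p \<noteq> 0" "over_at p \<noteq> mid" "under_at p \<noteq> mid"
    using * base(2) mid(3) pc by (metis prod.inject level.distinct(1))+
qed

lemma at_avoid:
  assumes "q \<in> positives"
  shows "over_at q \<noteq> 0" "under_at q \<noteq> 0" "over_at q \<noteq> mid" "under_at q \<noteq> mid"
  using at_inj(4-7)[OF assms assms] by simp_all

lemma finite_positives [simp]: "finite positives"
  by (simp add: positives_def)

text \<open>
  Turns the intersection numbers, which are sums over positions, into sums over chords.
\<close>

lemma sum_positions:
  fixes F :: "nat \<Rightarrow> int"
  shows "(\<Sum>p<length D. F p) = F 0 + F mid + (\<Sum>q\<in>positives. F (over_at q) + F (under_at q))"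
proof -
  have "{..<length D} = {0, mid} \<union> (over_at ` positives \<union> under_at ` positives)"
    using len mid(1) at by (auto elim: position_cases)
  moreover have "{0, mid} \<inter> (over_at ` positives \<union> under_at ` positives) = {}"
    using at_avoid by force
  ultimately have "(\<Sum>p<length D. F p) = (\<Sum>p\<in>{0, mid}. F p) + (\<Sum>p\<in>over_at ` positives \<union> under_at ` positives. F p)"
    by (simp only: sum.union_disjoint finite_positives finite_imageI finite_UnI finite.intros)
  also have "(\<Sum>p\<in>over_at ` positives \<union> under_at ` positives. F p) =
      (\<Sum>p\<in>over_at ` positives. F p) + (\<Sum>p\<in>under_at ` positives. F p)"
    by (intro sum.union_disjoint finite_imageI finite_positives) (use at_inj(3) in blast)
  also have "\<dots> = (\<Sum>q\<in>positives. F (over_at q) + F (under_at q))"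
    using at_inj(1,2) by (subst (1 2) sum.reindex) (auto simp: inj_on_def sum.distrib)
  finally show ?thesis using mid by simp
qed

lemma sum_between:
  fixes F :: "nat \<Rightarrow> int"
  assumes "j \<le> length D"
  shows "(\<Sum>p\<in>{i<..<j}. F p) = (\<Sum>p<length D. of_bool (i < p \<and> p < j) * F p)"
proof -
  have "{i<..<j} = {..<length D} \<inter> {p. i < p \<and> p < j}" using assms by auto
  then show ?thesis
    by (simp add: sum.inter_restrict of_bool_def if_distrib[where f = "\<lambda>x. x * _"] cong: if_cong)
qed

lemma sign_at:
  "passage_sign (D ! mid) = 1" "q \<in> positives \<Longrightarrow> passage_sign (D ! over_at q) = 1"
  "q \<in> positives \<Longrightarrow> passage_sign (D ! under_at q) = - 1"
  using mid(3) at(3,4)[of q] by (simp_all add: passage_sign_def from_right_Pair)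

lemma unknot_rotate: "casson l (rotate n D) = 0"
  using casson_rotate[OF knot] unknot by simp

sublocale almost_positive_chords positives over_at under_at mid "length D"
proof
  show "finite positives" "0 < mid" "mid < length D" using mid by simp_all
  fix p q assume q: "q \<in> positives"
  show "0 < over_at q \<and> over_at q < length D \<and> over_at q \<noteq> mid \<and> 0 < under_at q \<and> under_at q < length D \<and> under_at q \<noteq> mid"
    using at(1,2)[OF q] at_avoid[OF q] by simp
  assume p: "p \<in> positives"
  show "over_at p = over_at q \<longleftrightarrow> p = q" "under_at p = under_at q \<longleftrightarrow> p = q" "over_at p \<noteq> under_at q"
    using at_inj[OF p q] by simp_all
  show "\<not> (under_at q < over_at p \<and> over_at p < over_at q \<and> over_at q < under_at p)"
  proof
    assume lt: "under_at q < over_at p \<and> over_at p < over_at q \<and> over_at q < under_at p"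
    show False
      by (rule casson_zero_no_pattern[OF wf unknot[of Under], of c Negative "under_at q" "over_at p" "over_at q" "under_at p" q p])
        (use lt base positive_sign at[OF p] at[OF q] in auto)
  qed
  let ?E = "rotate mid D" and ?s = "\<lambda>x. (x + (length D - mid)) mod length D"
  have nth: "?E ! ?s x = D ! x" if "x < length D" for x
  proof -
    have "(mid + ?s x) mod length D = (mid + (x + (length D - mid))) mod length D" by presburger
    also have "mid + (x + (length D - mid)) = x + length D" using mid(1) by simp
    finally show ?thesis using that len by (simp add: nth_rotate)
  qed
  have less: "?s x < length ?E" for x using len by simp
  show "\<not> (?s (over_at q) < ?s (under_at p) \<and> ?s (under_at p) < ?s (under_at q) \<and> ?s (under_at q) < ?s (over_at p))"
  proof
    assume lt: "?s (over_at q) < ?s (under_at p) \<and> ?s (under_at p) < ?s (under_at q) \<and> ?s (under_at q) < ?s (over_at p)"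
    have E: "?E \<noteq> []" "?E ! 0 = (c, Under, Negative)" using mid(1,3) len by (simp_all add: nth_rotate)
    have wfE: "well_formed ?E" using knot_diagram_rotate[OF knot] by (simp add: knot_diagram_def)
    show False
      by (rule casson_zero_no_pattern[OF wfE unknot_rotate[of Over], of c Negative
            "?s (over_at q)" "?s (under_at p)" "?s (under_at q)" "?s (over_at p)" q p])
        (use lt E positive_sign at[OF p] at[OF q] less nth in auto)
  qed
qed

lemma inside_less: "inside x p \<longleftrightarrow> min (over_at x) (under_at x) < p \<and> p < max (over_at x) (under_at x)"
  by (auto simp: inside_def min_def max_def)

lemma chord_loop:
  assumes "x \<in> positives"
  defines "i \<equiv> min (over_at x) (under_at x)" and "j \<equiv> max (over_at x) (under_at x)"
  shows "i < j" "j < length D" "partner D i = j"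
  using at[OF assms(1)] at_inj(3)[OF assms(1,1)] unfolding i_def j_def min_def max_def by auto

lemma chord_loop_sum:
  fixes F :: "nat \<Rightarrow> int"
  assumes x: "x \<in> positives"
  shows "(\<Sum>p\<in>{min (over_at x) (under_at x)<..<max (over_at x) (under_at x)}. F p) =
    of_bool (inside x mid) * F mid +
    (\<Sum>q\<in>positives. of_bool (inside x (over_at q)) * F (over_at q) + of_bool (inside x (under_at q)) * F (under_at q))"
  using chord_loop(2)[OF x] by (simp add: sum_between inside_less sum_positions)

sublocale unknot_chords positives over_at under_at mid "length D"
proof
  fix x assume x: "x \<in> positives"
  let ?i = "min (over_at x) (under_at x)" and ?j = "max (over_at x) (under_at x)"
  show "(\<Sum>q\<in>positives. of_bool (inside x (over_at q)) - of_bool (inside x (under_at q)) :: int) + of_bool (inside x mid) = 0"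
    using loop_balanced[OF knot chord_loop[OF x]] unfolding chord_loop_sum[OF x]
    by (simp add: sign_at cong: sum.cong)
  show "(\<Sum>q\<in>positives. of_bool (over_at q < mid \<and> inside x (under_at q)) - of_bool (under_at q < mid \<and> inside x (over_at q)) :: int)
      + of_bool (over_at x < mid) = 1" if m: "inside x mid"
  proof -
    have "(\<Sum>p\<in>{0<..<mid}. passage_sign (D ! p) * of_bool (?i < partner D p \<and> partner D p < ?j))
      + of_bool (from_right (D ! ?i)) = (of_bool (from_right (D ! mid)) :: int)"
      using m at_avoid[OF x]
      by (intro crossing_loops_intersection[OF knot mid(2,1,5) chord_loop[OF x]])
        (auto simp: inside_less)
    moreover have "from_right (D ! mid)" using mid(3) by (simp add: from_right_Pair)
    moreover have "from_right (D ! ?i) \<longleftrightarrow> over_at x < mid"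
      using m at(3,4)[OF x] by (auto simp: inside_def min_def from_right_Pair)
    moreover have "(\<Sum>p\<in>{0<..<mid}. passage_sign (D ! p) * of_bool (?i < partner D p \<and> partner D p < ?j)) =
      (\<Sum>q\<in>positives. of_bool (over_at q < mid \<and> inside x (under_at q)) - of_bool (under_at q < mid \<and> inside x (over_at q)) :: int)"
    proof -
      have "mid \<le> length D" using mid(1) by simp
      then show ?thesis
        using at_avoid unfolding sum_between[OF \<open>mid \<le> length D\<close>] sum_positions inside_less[symmetric]
        by (simp, intro sum.cong refl) (auto simp: sign_at at(1,2,5,6))
    qed
    ultimately show ?thesis by simp
  qed
  fix y assume y: "y \<in> positives" and ne: "x \<noteq> y" "\<not> arrow x y" "\<not> arrow y x"
  let ?k = "min (over_at y) (under_at y)" and ?n = "max (over_at y) (under_at y)"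
  have "inside x (over_at y) \<longleftrightarrow> inside x (under_at y)" "inside y (over_at x) \<longleftrightarrow> inside y (under_at x)"
    using inside_arrow[OF x y] inside_arrow[OF y x] ne by (auto split: if_splits)
  moreover have "over_at x \<noteq> over_at y" "under_at x \<noteq> under_at y" "over_at x \<noteq> under_at y" "over_at y \<noteq> under_at x"
    using at_inj[OF x y] at_inj[OF y x] ne by auto
  ultimately have "?j < ?k \<or> ?n < ?i \<or> (?i < ?k \<and> ?n < ?j) \<or> (?k < ?i \<and> ?j < ?n)"
    unfolding inside_less min_def max_def by (smt (verit) nat_neq_iff order_less_trans)
  then have "(\<Sum>p\<in>{?i<..<?j}. passage_sign (D ! p) * of_bool (?k < partner D p \<and> partner D p < ?n)) = 0"
    by (intro disjoint_loops_intersection[OF knot chord_loop[OF x] chord_loop[OF y]])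
  moreover have "\<not> inside y 0" by (simp add: inside_def)
  moreover have "(\<Sum>q\<in>positives. of_bool (inside x (over_at q)) * (passage_sign (D ! over_at q) * of_bool (inside y (partner D (over_at q))))
      + of_bool (inside x (under_at q)) * (passage_sign (D ! under_at q) * of_bool (inside y (partner D (under_at q)))))
    = (\<Sum>q\<in>positives. of_bool (inside x (over_at q) \<and> inside y (under_at q)) - of_bool (inside x (under_at q) \<and> inside y (over_at q)))"
    by (intro sum.cong refl) (auto simp: sign_at at(1,2,5,6))
  ultimately show "(\<Sum>q\<in>positives. of_bool (inside x (over_at q) \<and> inside y (under_at q)) - of_bool (inside x (under_at q) \<and> inside y (over_at q)) :: int) = 0"
    unfolding inside_less[symmetric] chord_loop_sum[OF x] by (simp add: mid(4))
next
  have "(\<Sum>p\<in>{0<..<mid}. passage_sign (D ! p)) = 0"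
    by (rule loop_balanced[OF knot mid(2,1,5)])
  moreover have "mid \<le> length D" using mid(1) by simp
  moreover have "(\<Sum>q\<in>positives. of_bool (0 < over_at q \<and> over_at q < mid) * passage_sign (D ! over_at q)
      + of_bool (0 < under_at q \<and> under_at q < mid) * passage_sign (D ! under_at q)) =
    (\<Sum>q\<in>positives. of_bool (over_at q < mid) - of_bool (under_at q < mid))"
    using at_avoid by (intro sum.cong refl) (auto simp: sign_at)
  ultimately show "(\<Sum>q\<in>positives. of_bool (over_at q < mid) - of_bool (under_at q < mid) :: int) = 0"
    by (simp add: sum_between sum_positions)
qed

end

section \<open>Kinks as connected summands\<close>

lemma rename_crossings_id [simp]: "rename_crossings (\<lambda>x. x) D = D"
  by (simp add: rename_crossings_def case_prod_beta)

lemma isotopic_rotate: "isotopic D (rotate n D)"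
  unfolding isotopic_def by (rule exI[of _ "\<lambda>x. x"], rule exI[of _ n]) (simp add: inj_on_def)

lemma isotopic_refl [simp]: "isotopic D D"
  using isotopic_rotate[of D 0] by simp

lemma isotopic_trans:
  assumes "isotopic D E" "isotopic E F"
  shows "isotopic D F"
proof -
  obtain f n where f: "inj_on f (crossings D)" "E = rotate n (rename_crossings f D)"
    using assms(1) by (auto simp: isotopic_def)
  obtain g k where g: "inj_on g (crossings E)" "F = rotate k (rename_crossings g E)"
    using assms(2) by (auto simp: isotopic_def)
  have "crossings E = f ` crossings D"
    using f(2) by (simp add: crossings_rename[symmetric]) (simp add: crossings_def)
  then have "inj_on (g \<circ> f) (crossings D)" using f(1) g(1) by (simp add: comp_inj_on)
  moreover have "F = rotate (k + n) (rename_crossings (g \<circ> f) D)"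
    using f(2) g(2) by (simp add: rename_crossings_def rotate_map rotate_rotate comp_def case_prod_beta)
  ultimately show ?thesis unfolding isotopic_def by blast
qed

definition kink :: "nat \<Rightarrow> level \<Rightarrow> gauss_code" where
  "kink p l = [(p, l, Positive), (p, other_level l, Positive)]"

lemma one_crossing_kink: "one_crossing_diagram Positive (kink p l)"
proof -
  have "kink p l = rotate (if l = Over then 0 else 1) (rename_crossings (\<lambda>_. p) [(0, Over, Positive), (0, Under, Positive)])"
    by (cases l) (simp_all add: kink_def rename_crossings_def)
  then show ?thesis
    unfolding one_crossing_diagram_def isotopic_def by (intro exI[of _ "\<lambda>_. p"] exI) auto
qed

text \<open>
  Adding a kink at an edge is the connected sum with a diagram with one positive crossing.
\<close>

inductive kink_extension :: "gauss_code \<Rightarrow> gauss_code \<Rightarrow> bool" for C where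
  base: "kink_extension C C"
| kink: "kink_extension C (u @ v) \<Longrightarrow> p \<notin> crossings (u @ v) \<Longrightarrow> kink_extension C (u @ kink p l @ v)"

lemma kink_extension_connected_sum:
  assumes "kink_extension C D" "isotopic D E"
  shows "\<exists>Ks. iterated_connected_sum (Ks @ [C]) E \<and> (\<forall>K\<in>set Ks. \<exists>p l. K = kink p l)"
  using assms
proof (induction arbitrary: E)
  case base
  then show ?case using iterated_connected_sum.single[of C E] by (intro exI[of _ "[]"]) simp
next
  case (kink u v p l)
  obtain Ks where Ks: "iterated_connected_sum (Ks @ [C]) (u @ v)" "\<forall>K\<in>set Ks. \<exists>p l. K = kink p l"
    using kink.IH[OF isotopic_refl] by blast
  have "isotopic (kink p l @ v @ u) (rotate (length (kink p l @ v)) (kink p l @ v @ u))" by (rule isotopic_rotate)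
  then have "isotopic (kink p l @ v @ u) (u @ kink p l @ v)" by (simp only: append_assoc[symmetric] rotate_append)
  then have "isotopic (kink p l @ v @ u) E" using kink.prems by (rule isotopic_trans)
  moreover have "isotopic (u @ v) (v @ u)" using isotopic_rotate[of "u @ v" "length u"] by (simp add: rotate_append)
  moreover have "crossings (kink p l) \<inter> crossings (v @ u) = {}" using kink.hyps(2) by (auto simp: kink_def)
  ultimately have "connected_sum (kink p l) (u @ v) E"
    unfolding connected_sum_def using isotopic_refl by blast
  then have "iterated_connected_sum ([kink p l] @ (Ks @ [C])) E"
    by (rule iterated_connected_sum.join[OF iterated_connected_sum.single[OF isotopic_refl] Ks(1)])
  then show ?case using Ks(2) by (intro exI[of _ "kink p l # Ks"]) auto
qed

text \<open>
  Every crossing outside \<open>K\<close> cuts off a part of the word that avoids \<open>K\<close> and contains both passages of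
  each of its crossings, as with matching parentheses. The word is linear: the letters of \<open>K\<close> are meant
  to include its first one, so that the part between the two passages is the one away from \<open>K\<close>.
\<close>

definition nested_outside :: "nat set \<Rightarrow> gauss_code \<Rightarrow> bool" where
  "nested_outside K w \<longleftrightarrow> distinct w \<and>
     (\<forall>p l e. (p, l, e) \<in> set w \<longrightarrow> p \<notin> K \<longrightarrow> e = Positive \<and> (p, other_level l, Positive) \<in> set w) \<and>
     (\<forall>u x v y z. w = u @ [x] @ v @ [y] @ z \<longrightarrow> fst x = fst y \<longrightarrow> fst x \<notin> K \<longrightarrow>
        crossings v \<inter> (K \<union> crossings (u @ z)) = {})"

lemma nested_outside_loops:
  "nested_outside K w \<Longrightarrow> w = u @ [x] @ v @ [y] @ z \<Longrightarrow> fst x = fst y \<Longrightarrow> fst x \<notin> K \<Longrightarrow>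
    crossings v \<inter> (K \<union> crossings (u @ z)) = {}"
  unfolding nested_outside_def by blast

lemma nested_outside_mate:
  "nested_outside K w \<Longrightarrow> (p, l, e) \<in> set w \<Longrightarrow> p \<notin> K \<Longrightarrow> e = Positive \<and> (p, other_level l, Positive) \<in> set w"
  unfolding nested_outside_def by blast

lemma nested_outside_part:
  assumes "nested_outside K (a @ w @ b)" and closed: "(crossings w - K) \<inter> crossings (a @ b) = {}"
  shows "nested_outside K w"
  unfolding nested_outside_def
proof (intro conjI allI impI)
  show "distinct w" using assms by (simp add: nested_outside_def)
  fix p l e assume p: "(p, l, e) \<in> set w" "p \<notin> K"
  then show "e = Positive" using nested_outside_mate[OF assms(1), of p l e] by simp
  have "(p, other_level l, Positive) \<in> set (a @ w @ b)"
    using nested_outside_mate[OF assms(1), of p l e] p by simp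
  moreover have "p \<in> crossings w" using p(1) by (auto simp: crossings_iff)
  then have "p \<notin> crossings (a @ b)" using closed p(2) by blast
  ultimately show "(p, other_level l, Positive) \<in> set w" by (auto simp: crossings_iff)
next
  fix u x v y z assume w: "w = u @ [x] @ v @ [y] @ z" and "fst x = fst y" "fst x \<notin> K"
  then have "crossings v \<inter> (K \<union> crossings ((a @ u) @ (z @ b))) = {}"
    by (intro nested_outside_loops[OF assms(1), of _ x v y]) auto
  then show "crossings v \<inter> (K \<union> crossings (u @ z)) = {}" by auto
qed

text \<open>
  If the first letter belongs to a crossing outside \<open>K\<close>, the word is \<open>x v y z\<close> with \<open>x\<close> and \<open>y\<close> the
  passages of this crossing. Insert \<open>z\<close> first, then the kink \<open>x y\<close>, and finally the kinks of \<open>v\<close> inside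
  it. The context \<open>a\<close>, \<open>b\<close> is there for the recursion.
\<close>

lemma kink_extension_nested:
  assumes "nested_outside K w" "kink_extension C (a @ restrict_to K w @ b)"
    "(crossings w - K) \<inter> crossings (a @ b) = {}"
  shows "kink_extension C (a @ w @ b)"
  using assms
proof (induction "length w" arbitrary: w a b rule: less_induct)
  case less
  show ?case
  proof (cases w)
    case Nil
    then show ?thesis using less.prems by simp
  next
    case (Cons x t)
    show ?thesis
    proof (cases "fst x \<in> K")
      case True
      have "nested_outside K t"
        using less.prems(1) True by (intro nested_outside_part[of K "[x]" t "[]"]) (auto simp: Cons)
      then have "kink_extension C ((a @ [x]) @ t @ b)"
      proof (rule less.hyps[rotated])
        show "length t < length w" by (simp add: Cons)
        show "kink_extension C ((a @ [x]) @ restrict_to K t @ b)"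
          using less.prems(2) True by (simp add: Cons)
        show "(crossings t - K) \<inter> crossings ((a @ [x]) @ b) = {}"
          using less.prems(3) True by (auto simp: Cons)
      qed
      then show ?thesis by (simp add: Cons)
    next
      case False
      obtain p l e where x: "x = (p, l, e)" by (cases x)
      have pK: "p \<notin> K" using False x by simp
      have mate: "e = Positive" "(p, other_level l, Positive) \<in> set t"
        using nested_outside_mate[OF less.prems(1), of p l e] pK by (auto simp: Cons x)
      obtain v z where t: "t = v @ (p, other_level l, Positive) # z" using mate(2) by (meson split_list)
      let ?y = "(p, other_level l, Positive)"
      have w: "w = [x] @ v @ [?y] @ z" by (simp add: Cons t)
      have v: "crossings v \<inter> (K \<union> crossings z) = {}"
        using nested_outside_loops[OF less.prems(1), of "[]" x v ?y z] pK by (simp add: w x)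
      have p: "p \<notin> crossings v" "p \<notin> crossings z"
      proof -
        have "distinct w" using less.prems(1) by (simp add: nested_outside_def)
        have "(p, l', e') \<notin> set v \<union> set z" for l' e'
        proof
          assume q: "(p, l', e') \<in> set v \<union> set z"
          then have "e' = Positive" using nested_outside_mate[OF less.prems(1), of p l' e'] pK by (auto simp: w)
          moreover have "l' = l \<or> l' = other_level l" by (auto simp: level_neq_iff[symmetric])
          ultimately show False using q \<open>distinct w\<close> mate(1) by (auto simp: w x)
        qed
        then show "p \<notin> crossings v" "p \<notin> crossings z" by (auto simp: crossings_iff)
      qed
      have restrict: "restrict_to K w = restrict_to K z"
        using pK v by (simp add: w x) (intro restrict_to_empty, auto)
      have "nested_outside K z"
        using less.prems(1) v p by (intro nested_outside_part[of K "[x] @ v @ [?y]" z "[]"]) (auto simp: w x)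
      then have "kink_extension C (a @ z @ b)"
      proof (rule less.hyps[rotated])
        show "length z < length w" by (simp add: w)
        show "kink_extension C (a @ restrict_to K z @ b)" using less.prems(2) by (simp add: restrict)
        show "(crossings z - K) \<inter> crossings (a @ b) = {}" using less.prems(3) by (auto simp: w)
      qed
      moreover have "p \<notin> crossings (a @ z @ b)"
        using less.prems(3) pK p by (auto simp: w x)
      ultimately have step: "kink_extension C (a @ kink p l @ z @ b)"
        by (intro kink_extension.kink)
      have "nested_outside K v"
        using less.prems(1) v p by (intro nested_outside_part[of K "[x]" v "[?y] @ z"]) (auto simp: w x)
      then have "kink_extension C ((a @ [x]) @ v @ ([?y] @ z @ b))"
      proof (rule less.hyps[rotated])
        show "length v < length w" by (simp add: w)
        have "restrict_to K v = []" using v by (intro restrict_to_empty) auto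
        then show "kink_extension C ((a @ [x]) @ restrict_to K v @ [?y] @ z @ b)"
          using step mate(1) by (simp add: kink_def x)
        show "(crossings v - K) \<inter> crossings ((a @ [x]) @ [?y] @ z @ b) = {}"
          using less.prems(3) v p by (auto simp: w x)
      qed
      then show ?thesis by (simp add: w)
    qed
  qed
qed

lemma kink_extension_restrict:
  "nested_outside K D \<Longrightarrow> kink_extension (restrict_to K D) D"
  using kink_extension_nested[of K D "restrict_to K D" "[]" "[]"] by (simp add: kink_extension.base)

context based_unknot
begin

lemma at_cases:
  assumes "p < length D" "fst (D ! p) = q" "q \<noteq> c"
  shows "q \<in> positives" "p = over_at q \<or> p = under_at q"
proof -
  have "q \<in> positives \<and> (p = over_at q \<or> p = under_at q)"
    using assms(1)
  proof (cases rule: position_cases)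
    case 1
    then show ?thesis using assms base by simp
  next
    case 2
    then show ?thesis using assms mid by simp
  next
    case (3 r)
    then show ?thesis using assms at(3)[of r] by simp
  next
    case (4 r)
    then show ?thesis using assms at(4)[of r] by simp
  qed
  then show "q \<in> positives" "p = over_at q \<or> p = under_at q" by auto
qed

lemma nested_outsideI:
  assumes cK: "c \<in> K"
    and iso: "\<And>p q. p \<in> positives - K \<Longrightarrow> q \<in> positives \<Longrightarrow> inside p (over_at q) \<longleftrightarrow> inside p (under_at q)"
    and mid_out: "\<And>p. p \<in> positives - K \<Longrightarrow> \<not> inside p mid"
    and out: "\<And>p q. p \<in> positives - K \<Longrightarrow> q \<in> positives \<inter> K \<Longrightarrow> \<not> inside p (over_at q)"
  shows "nested_outside K D"
  unfolding nested_outside_def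
proof (intro conjI allI impI)
  show "distinct D" by (rule well_formed_distinct[OF wf])
  fix p l e assume p: "(p, l, e) \<in> set D" "p \<notin> K"
  then show "e = Positive" using positive_sign cK by blast
  then show "(p, other_level l, Positive) \<in> set D" using well_formed_mate[OF wf p(1)] by simp
next
  fix u x v y z assume D: "D = u @ [x] @ v @ [y] @ z" and xy: "fst x = fst y" and xK: "fst x \<notin> K"
  define i j where "i = length u" and "j = Suc (length u + length v)"
  have ij: "i < j" "j < length D" by (auto simp: i_def j_def D)
  have Dij: "D ! i = x" "D ! j = y" by (auto simp: i_def j_def D nth_append)
  define p where "p = fst x"
  have pc: "p \<noteq> c" using xK cK by (auto simp: p_def)
  have "p \<in> positives" "i = over_at p \<or> i = under_at p" "j = over_at p \<or> j = under_at p"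
    using at_cases[of i p] at_cases[of j p] ij Dij xy pc by (auto simp: p_def)
  then have p: "p \<in> positives - K" and inside_iff: "inside p t \<longleftrightarrow> i < t \<and> t < j" for t
    using ij(1) xK by (auto simp: p_def inside_def)
  show "crossings v \<inter> (K \<union> crossings (u @ z)) = {}"
  proof (rule ccontr)
    assume "crossings v \<inter> (K \<union> crossings (u @ z)) \<noteq> {}"
    then obtain q where q: "q \<in> crossings v" "q \<in> K \<or> q \<in> crossings (u @ z)" by auto
    obtain t0 where t0: "t0 < length v" "fst (v ! t0) = q"
      using q(1) by (auto simp: crossings_def in_set_conv_nth)
    define t where "t = Suc (length u + t0)"
    have t: "t < length D" "fst (D ! t) = q" "inside p t"
      using t0 unfolding inside_iff by (auto simp: t_def D i_def j_def nth_append)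
    have qc: "q \<noteq> c"
    proof
      assume "q = c"
      then have "t = 0 \<or> t = mid"
        using partner_eqI[OF wf len t(1)] t(2) base(2) mid(5) by (cases "t = 0") auto
      then show False using t(3) mid_out[OF p] by (auto simp: inside_iff)
    qed
    note qt = at_cases[OF t(1,2) qc]
    have both: "inside p (over_at q)" "inside p (under_at q)" using iso[OF p qt(1)] qt(2) t(3) by auto
    then have "q \<notin> K" using out[OF p] qt(1) by auto
    then have "q \<in> crossings (u @ z)" using q(2) by simp
    then obtain s where s: "s < length D" "fst (D ! s) = q" "s < i \<or> j < s"
    proof -
      assume thesis: "\<And>s. s < length D \<Longrightarrow> fst (D ! s) = q \<Longrightarrow> s < i \<or> j < s \<Longrightarrow> thesis"
      consider "q \<in> crossings u" | "q \<in> crossings z" using \<open>q \<in> crossings (u @ z)\<close> by auto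
      then show thesis
      proof cases
        case 1
        then obtain s where "s < length u" "fst (u ! s) = q" by (auto simp: crossings_def in_set_conv_nth)
        then show thesis by (intro thesis[of s]) (auto simp: D i_def nth_append)
      next
        case 2
        then obtain s where s: "s < length z" "fst (z ! s) = q" by (auto simp: crossings_def in_set_conv_nth)
        have "D = (u @ [x] @ v @ [y]) @ z" by (simp add: D)
        then have "D ! (Suc j + s) = z ! s" by (simp only: nth_append_length_plus[of "u @ [x] @ v @ [y]" z s, symmetric]) (simp add: j_def)
        then show thesis using s by (intro thesis[of "Suc j + s"]) (auto simp: D j_def)
      qed
    qed
    then have "\<not> inside p s" by (auto simp: inside_iff)
    then show False using at_cases(2)[OF s(1,2) qc] both by auto
  qed
qed

end

section \<open>Recognising the twist knot diagrams\<close>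

definition row_letters :: "bool \<Rightarrow> nat list \<Rightarrow> gauss_code" where
  "row_letters s R = map (\<lambda>i. (R ! i, if even i = s then Over else Under, Positive)) [0..<length R]"

text \<open>
  The code of an unknotted twist knot diagram with row \<open>R\<close>, negative crossing \<open>c\<close> and other clasp
  crossing \<open>d\<close>, in the form in which it arises from the analysis of chords. It is the alternating
  diagram with one clasp crossing switched: the switched crossing is \<open>c\<close> if \<open>R\<close> has odd length and
  \<open>d\<close> otherwise, since for an even row the clasp of the alternating diagram is negative.
\<close>

definition twist_word :: "nat list \<Rightarrow> nat \<Rightarrow> nat \<Rightarrow> gauss_code" where
  "twist_word R c d = row_letters True R @ [(d, Under, Positive), (c, Under, Negative)] @
     rev (row_letters False R) @
     (if odd (length R) then [(d, Over, Positive), (c, Over, Negative)]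
      else [(c, Over, Negative), (d, Over, Positive)])"

lemma length_row_letters [simp]: "length (row_letters s R) = length R"
  by (simp add: row_letters_def)

lemma nth_row_letters: "i < length R \<Longrightarrow>
    row_letters s R ! i = (R ! i, if even i = s then Over else Under, Positive)"
  by (simp add: row_letters_def)

lemma nth_twist_knot_word:
  assumes "p < 2 * k + 4"
  shows "twist_knot_word k ! p =
    (if p < k then p else if p = k then (if odd k then k else Suc k)
     else if p = Suc k then (if odd k then Suc k else k)
     else if p < 2 * k + 2 then 2 * k + 1 - p
     else if p = 2 * k + 2 then k else Suc k)"
proof -
  consider "p < k" | "p = k" | "p = Suc k" | "k + 2 \<le> p" "p < 2 * k + 2" | "p = 2 * k + 2" | "p = 2 * k + 3"
    using assms by linarith
  then show ?thesis
    by cases (auto simp: twist_knot_word_def nth_append rev_nth)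
qed

lemma nth_twist_word:
  assumes "p < 2 * k + 4" "length R = k"
  shows "twist_word R c d ! p =
    (if p < k then (R ! p, if even p then Over else Under, Positive)
     else if p = k then (d, Under, Positive)
     else if p = Suc k then (c, Under, Negative)
     else if p < 2 * k + 2 then (R ! (2 * k + 1 - p), if even p then Over else Under, Positive)
     else if p = 2 * k + 2 then (if odd k then (d, Over, Positive) else (c, Over, Negative))
     else (if odd k then (c, Over, Negative) else (d, Over, Positive)))"
proof -
  consider "p < k" | "p = k" | "p = Suc k" | "k + 2 \<le> p" "p < 2 * k + 2" | "p = 2 * k + 2" | "p = 2 * k + 3"
    using assms by linarith
  then show ?thesis
  proof cases
    case 4
    then have "p - k - 2 < k" and i: "k - Suc (p - k - 2) = 2 * k + 1 - p" by auto
    moreover have "even (2 * k + 1 - p) \<longleftrightarrow> odd p"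
      using 4 by (subst even_diff_nat) auto
    ultimately show ?thesis
      using 4 assms(2) by (auto simp: twist_word_def nth_append rev_nth nth_row_letters)
  qed (use assms(2) in \<open>auto simp: twist_word_def nth_append rev_nth nth_row_letters\<close>)
qed

lemma crossings_twist: "crossings (switch_crossing a (twist_knot_diagram k e)) \<subseteq> {..Suc k}"
proof -
  have "twist_knot_word k ! p \<le> Suc k" if "p < 2 * k + 4" for p
    using that by (auto simp: nth_twist_knot_word)
  then show ?thesis
    by (auto simp: crossings_def switch_crossing_def twist_knot_diagram_def Let_def)
qed

text \<open>
  In the numbering of the twist knot diagram the switched crossing is always the last one.
\<close>

lemma twist_word_rename:
  assumes dist: "distinct R" "c \<notin> set R" "d \<notin> set R" "c \<noteq> d"
  defines "k \<equiv> length R"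
  obtains f where "inj_on f (crossings (switch_crossing (Suc k) (twist_knot_diagram k Positive)))"
    "rename_crossings f (switch_crossing (Suc k) (twist_knot_diagram k Positive)) = twist_word R c d"
proof
  have lenR: "length R = k" by (simp add: k_def)
  define f where "f i = (if i < k then R ! i else if (i = k) = odd k then d else c)" for i
  have "inj_on f {..Suc k}"
  proof (rule inj_onI)
    fix i j assume ij: "i \<in> {..Suc k}" "j \<in> {..Suc k}" "f i = f j"
    have mem: "R ! i \<in> set R" if "i < k" for i using that by (simp add: k_def)
    consider "i < k" "j < k" | "i < k" "k \<le> j" | "k \<le> i" "j < k" | "k \<le> i" "k \<le> j" by linarith
    then show "i = j"
    proof cases
      case 1
      then show ?thesis using ij dist(1) by (simp add: f_def k_def nth_eq_iff_index_eq)
    next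
      case 2
      then show ?thesis using ij mem[of i] dist by (auto simp: f_def split: if_splits)
    next
      case 3
      then show ?thesis using ij mem[of j] dist by (auto simp: f_def split: if_splits)
    next
      case 4
      then show ?thesis using ij dist(4) by (auto simp: f_def le_Suc_eq split: if_splits)
    qed
  qed
  then show "inj_on f (crossings (switch_crossing (Suc k) (twist_knot_diagram k Positive)))"
    using crossings_twist by (rule inj_on_subset)
  show "rename_crossings f (switch_crossing (Suc k) (twist_knot_diagram k Positive)) = twist_word R c d"
  proof (rule nth_equalityI)
    show "length (rename_crossings f (switch_crossing (Suc k) (twist_knot_diagram k Positive))) = length (twist_word R c d)"
      by (simp add: rename_crossings_def switch_crossing_def twist_knot_diagram_def twist_word_def k_def)
    fix p assume "p < length (rename_crossings f (switch_crossing (Suc k) (twist_knot_diagram k Positive)))"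
    then have p: "p < 2 * k + 4"
      by (simp add: rename_crossings_def switch_crossing_def twist_knot_diagram_def)
    consider "p < k" | "p = k" | "p = Suc k" | "k + 2 \<le> p" "p < 2 * k + 2" | "p = 2 * k + 2" | "p = 2 * k + 3"
      using p by linarith
    then show "rename_crossings f (switch_crossing (Suc k) (twist_knot_diagram k Positive)) ! p = twist_word R c d ! p"
      unfolding nth_twist_word[OF p lenR] using p
      by cases (auto simp: rename_crossings_def switch_crossing_def twist_knot_diagram_def Let_def
          nth_twist_knot_word f_def)
  qed
qed

lemma unknotted_twist_knot_diagramI:
  assumes dist: "distinct R" "R \<noteq> []" "c \<notin> set R" "d \<notin> set R" "c \<noteq> d"
    and C: "C = rotate n (twist_word R c d) \<or> C = rotate n (rev (twist_word R c d))"
  shows "unknotted_twist_knot_diagram C"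
proof -
  define k where "k = length R"
  let ?T = "switch_crossing (Suc k) (twist_knot_diagram k Positive)"
  obtain f where f: "inj_on f (crossings ?T)" "rename_crossings f ?T = twist_word R c d"
    using twist_word_rename[OF dist(1,3-5)] unfolding k_def by blast
  have "isotopic ?T C \<or> isotopic (rev ?T) C"
    using C
  proof
    assume "C = rotate n (twist_word R c d)"
    then have "C = rotate n (rename_crossings f ?T)" by (simp only: f(2))
    then show ?thesis using f(1) unfolding isotopic_def by blast
  next
    assume "C = rotate n (rev (twist_word R c d))"
    moreover have "rename_crossings f (rev ?T) = rev (twist_word R c d)"
      by (simp add: f(2)[symmetric] rename_crossings_def rev_map)
    moreover have "inj_on f (crossings (rev ?T))" using f(1) by (simp add: crossings_def)
    ultimately have "inj_on f (crossings (rev ?T)) \<and> C = rotate n (rename_crossings f (rev ?T))" by simp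
    then show ?thesis unfolding isotopic_def by blast
  qed
  moreover have "negative_crossings C = {c}"
  proof -
    have set_C: "set C = set (twist_word R c d)" using C by auto
    show ?thesis
      unfolding negative_crossings_def set_C by (auto simp: twist_word_def row_letters_def)
  qed
  moreover have "k \<ge> 1" using dist(2) by (simp add: k_def Suc_le_eq)
  ultimately show ?thesis
    unfolding unknotted_twist_knot_diagram_def almost_positive_def by (auto intro!: exI[of _ k])
qed

lemma sorted_enumeration:
  fixes f :: "nat \<Rightarrow> nat"
  assumes "finite A" "inj_on f A"
  obtains xs where "set xs = A" "sorted_wrt (\<lambda>x y. f x < f y) xs" "distinct xs"
proof
  define g where "g = inv_into A f"
  define xs where "xs = map g (sorted_list_of_set (f ` A))"
  have fg: "f (g y) = y" if "y \<in> f ` A" for y using that by (simp add: g_def f_inv_into_f)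
  have gA: "g ` f ` A = A" using assms(2) by (auto simp: g_def inv_into_f_f image_iff)
  show "set xs = A" using assms(1) gA by (simp add: xs_def)
  have "sorted_wrt (<) (sorted_list_of_set (f ` A))" by (rule strict_sorted_list_of_set)
  then show sorted: "sorted_wrt (\<lambda>x y. f x < f y) xs"
    unfolding xs_def sorted_wrt_map
    by (rule sorted_wrt_mono_rel[rotated]) (use assms(1) fg in auto)
  have "inj_on g (f ` A)" by (rule inj_on_inverseI[of _ f]) (use fg in auto)
  then show "distinct xs" using assms(1) by (simp add: xs_def distinct_map)
qed

section \<open>The core of an almost positive unknot diagram\<close>

locale based_hub = based_unknot + hub_chords positives over_at under_at mid "length D" d for d
begin

lemma core_outside_c: "c \<notin> core" "core \<subseteq> positives"
proof -
  show "core \<subseteq> positives" using d row_S by (auto simp: core_def)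
  then show "c \<notin> core" by (auto simp: positives_def)
qed

lemma d_notin_row: "d \<notin> row"
  by (simp add: row_def)

lemma core_kink_extension: "kink_extension (restrict_to (insert c core) D) D"
proof (rule kink_extension_restrict, rule nested_outsideI)
  fix p assume "p \<in> positives - insert c core"
  then have p: "p \<in> positives" "p \<notin> core" by auto
  show "\<not> inside p mid" using isolated_one_side[OF p] by (auto simp: inside_def)
  fix q
  show "inside p (over_at q) \<longleftrightarrow> inside p (under_at q)" if "q \<in> positives"
    using isolated(1)[OF p that] .
  show "\<not> inside p (over_at q)" if "q \<in> positives \<inter> insert c core"
    using core_outside_isolated(1)[OF p, of q] that by (auto simp: positives_def)
qed simp

text \<open>
  The hub is interlaced with \<open>c\<close> iff exactly one of its passages lies before the underpass of \<open>c\<close>; these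
  are the cases in which the row has odd length.
\<close>

definition core_positions :: "nat list \<Rightarrow> nat list" where
  "core_positions R = [0] @ (if over_at d < mid then [over_at d] else []) @ map first_end R @
     (if under_at d < mid then [under_at d] else []) @ [mid] @
     (if mid < under_at d then [under_at d] else []) @ rev (map second_end R) @
     (if mid < over_at d then [over_at d] else [])"

lemma core_positions_sorted:
  assumes R: "set R = row" "sorted_wrt (\<lambda>x y. first_end x < first_end y) R"
  shows "sorted_wrt (<) (core_positions R)"
proof -
  have first: "sorted_wrt (<) (map first_end R)" using R(2) by (simp add: sorted_wrt_map)
  have "sorted_wrt (\<lambda>x y. second_end y < second_end x) R"
    using R(2) by (rule sorted_wrt_mono_rel[rotated]) (use R(1) row_nested in auto)
  then have second: "sorted_wrt (<) (rev (map second_end R))"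
    by (simp add: sorted_wrt_rev sorted_wrt_map)
  have ends: "0 < first_end r" "first_end r < mid" "mid < second_end r" "0 < second_end r"
    "first_end r < under_at d" "under_at d < second_end r"
    "over_at d < mid \<Longrightarrow> over_at d < first_end r" "over_at d < mid \<Longrightarrow> over_at d < second_end r"
    "mid < over_at d \<Longrightarrow> first_end r < over_at d" "mid < over_at d \<Longrightarrow> second_end r < over_at d"
    if "r \<in> row" for r
    using row_ends(1-4)[OF that] hub_ends[OF that] by linarith+
  have across: "first_end r < second_end r'" if "r \<in> row" "r' \<in> row" for r r'
    using ends(2)[OF that(1)] ends(3)[OF that(2)] by simp
  obtain r0 where r0: "r0 \<in> row" using row_nonempty by auto
  have hub: "over_at d < mid \<Longrightarrow> over_at d < under_at d" "mid < over_at d \<Longrightarrow> under_at d < over_at d"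
    using ends[OF r0] by linarith+
  have "0 < over_at d" "0 < under_at d" "over_at d \<noteq> mid" "under_at d \<noteq> mid" using range[OF d] by auto
  then show ?thesis
    using mid(2) unfolding core_positions_def
    by (cases "over_at d < mid"; cases "under_at d < mid")
      (simp_all add: sorted_wrt_append R(1) first second ends across hub ball_Un)
qed

lemma row_letter:
  assumes r: "r \<in> row"
  shows "D ! first_end r = (r, if falling r then Over else Under, Positive)"
    "D ! second_end r = (r, if falling r then Under else Over, Positive)"
  using r by (cases rule: row_cases; simp add: at(3,4)[OF row_S[OF r]])+

lemma core_positions_set:
  assumes R: "set R = row"
  shows "set (core_positions R) = {i. i < length D \<and> fst (D ! i) \<in> insert c core}"
proof (rule set_eqI)
  fix i
  have ends: "first_end ` row \<union> second_end ` row = over_at ` row \<union> under_at ` row"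
    by (auto simp: first_end_def second_end_def min_def max_def)
  have "set (core_positions R) = {0, mid, over_at d, under_at d} \<union> (first_end ` row \<union> second_end ` row)"
    using range[OF d] by (auto simp: core_positions_def R)
  then have set: "set (core_positions R) = {0, mid} \<union> over_at ` core \<union> under_at ` core"
    unfolding ends core_def by blast
  show "i \<in> set (core_positions R) \<longleftrightarrow> i \<in> {i. i < length D \<and> fst (D ! i) \<in> insert c core}"
  proof
    assume "i \<in> set (core_positions R)"
    then show "i \<in> {i. i < length D \<and> fst (D ! i) \<in> insert c core}"
      unfolding set using len base mid at core_outside_c(2) by auto
  next
    assume i: "i \<in> {i. i < length D \<and> fst (D ! i) \<in> insert c core}"
    then have "i < length D" by simp
    then show "i \<in> set (core_positions R)"
      unfolding set using i at(3,4) by (cases rule: position_cases) (auto simp: positives_def)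
  qed
qed

text \<open>
  Alternation propagates the kind of the last chord of the row, known from \<open>row_last\<close>, to the others;
  the parity of the length of the row turns a statement on \<open>over_at d\<close> into one on \<open>under_at d\<close>.
\<close>

lemma row_alternating:
  assumes R: "set R = row" "sorted_wrt (\<lambda>x y. first_end x < first_end y) R" and i: "i < length R"
  shows "falling (R ! i) \<longleftrightarrow> (even i \<longleftrightarrow> under_at d < mid)"
proof -
  define k where "k = length R"
  have less: "first_end (R ! i) < first_end (R ! j)" if "i < j" "j < k" for i j
    using R(2) that by (simp add: sorted_wrt_iff_nth_less k_def)
  have mem: "R ! i \<in> row" if "i < k" for i
    using nth_mem[of i R] that unfolding R(1) k_def by simp
  have row_nth: "\<exists>j<k. q = R ! j" if "q \<in> row" for q
  proof -
    have "q \<in> set R" using that R(1) by simp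
    then obtain j where "j < length R" "R ! j = q" by (meson in_set_conv_nth)
    then show ?thesis unfolding k_def by blast
  qed
  have card: "card row = k"
  proof -
    have "R ! i \<noteq> R ! j" if "i < k" "j < k" "i \<noteq> j" for i j
      using that less[of i j] less[of j i] by (cases i j rule: linorder_cases) auto
    then have "distinct R" unfolding distinct_conv_nth k_def by blast
    then show ?thesis using distinct_card[of R] unfolding R(1) k_def by simp
  qed
  have step: "falling (R ! i) \<longleftrightarrow> \<not> falling (R ! Suc i)" if i: "Suc i < k" for i
  proof -
    have "\<not> (first_end (R ! i) < first_end q \<and> first_end q < first_end (R ! Suc i))" if q: "q \<in> row" for q
    proof -
      obtain j where j: "j < k" "q = R ! j" using row_nth[OF q] by blast
      consider "j < i" | "j = i" | "j = Suc i" | "Suc i < j" by linarith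
      then show ?thesis
        by cases (use less[of j i] less[of "Suc i" j] i j in auto)
    qed
    then have "falling (R ! i) \<longleftrightarrow> rising (R ! Suc i)"
      using row_alternates[OF mem mem less] i by simp
    moreover have "rising (R ! Suc i) \<longleftrightarrow> \<not> falling (R ! Suc i)"
      using mem[OF i] by (cases rule: row_cases) auto
    ultimately show ?thesis by simp
  qed
  have last: "falling (R ! (k - 1)) \<longleftrightarrow> mid < over_at d"
  proof (rule row_last)
    show "R ! (k - 1) \<in> row" using i by (intro mem) (simp add: k_def)
    fix q assume "q \<in> row"
    then obtain j where j: "j < k" "q = R ! j" using row_nth by blast
    then have "j = k - 1 \<or> j < k - 1" by linarith
    then show "\<not> first_end (R ! (k - 1)) < first_end q"
      using less[of j "k - 1"] j by auto
  qed
  have down: "falling (R ! (k - 1 - j)) \<longleftrightarrow> (even j \<longleftrightarrow> mid < over_at d)" if "j < k" for j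
    using that
  proof (induction j)
    case (Suc j)
    have "Suc (k - 1 - Suc j) = k - 1 - j" using Suc.prems by simp
    then show ?case using step[of "k - 1 - Suc j"] Suc by (auto simp: less_imp_le)
  qed (use last in simp)
  have "falling (R ! i) \<longleftrightarrow> (even (k - 1 - i) \<longleftrightarrow> mid < over_at d)"
    using down[of "k - 1 - i"] i by (simp add: k_def)
  moreover have "even (k - 1 - i) \<longleftrightarrow> (odd k \<longleftrightarrow> even i)"
    using i by (simp add: k_def even_diff_nat) (auto simp: even_diff_nat)
  moreover have "odd k \<longleftrightarrow> (over_at d < mid \<longleftrightarrow> mid < under_at d)" using card_row card by simp
  moreover have "over_at d \<noteq> mid" "under_at d \<noteq> mid" using range[OF d] by auto
  ultimately show ?thesis by (cases "even i"; cases "odd k") (auto simp: not_less_iff_gr_or_eq)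
qed

lemma map_row_letters:
  assumes R: "set R = row" "sorted_wrt (\<lambda>x y. first_end x < first_end y) R"
  shows "map (\<lambda>r. D ! first_end r) R = row_letters (under_at d < mid) R"
    "map (\<lambda>r. D ! second_end r) R = row_letters (\<not> under_at d < mid) R"
proof -
  have mem: "R ! i \<in> row" if "i < length R" for i using that R(1) nth_mem by blast
  show "map (\<lambda>r. D ! first_end r) R = row_letters (under_at d < mid) R"
    "map (\<lambda>r. D ! second_end r) R = row_letters (\<not> under_at d < mid) R"
    using row_alternating[OF R] by (auto intro!: nth_equalityI simp: nth_row_letters row_letter[OF mem])
qed

text \<open>
  If the underpass of the hub precedes that of \<open>c\<close>, the word read from the row on is that of a twist
  knot; otherwise it is read backwards, which corresponds to the opposite orientation.
\<close>

lemma core_unknotted_twist: "unknotted_twist_knot_diagram (restrict_to (insert c core) D)"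
proof -
  have "finite row" using finite_risings finite_fallings by (simp add: row_def)
  moreover have "inj_on first_end row" using row_first_end_inj by (auto simp: inj_on_def)
  ultimately obtain R where R: "set R = row" "sorted_wrt (\<lambda>x y. first_end x < first_end y) R" and "distinct R"
    using sorted_enumeration by blast
  define C where "C = restrict_to (insert c core) D"
  have C: "C = map ((!) D) (core_positions R)"
    unfolding C_def restrict_to_def
    by (rule filter_eq_map_nth[OF core_positions_sorted[OF R] core_positions_set[OF R(1)]])
  have parity: "odd (length R) \<longleftrightarrow> (over_at d < mid \<longleftrightarrow> mid < under_at d)"
    using card_row R(1) \<open>distinct R\<close> by (simp add: distinct_card[symmetric])
  let ?W = "twist_word R c d"
  note letters = map_row_letters[OF R] at(3,4)[OF d] base(2) mid(3)
  have ne: "over_at d \<noteq> mid" "under_at d \<noteq> mid" using range[OF d] by auto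
  have "\<exists>n. C = rotate n ?W \<or> C = rotate n (rev ?W)"
  proof (cases "under_at d < mid")
    case under: True
    show ?thesis
    proof (cases "over_at d < mid")
      case True
      have W: "?W = (row_letters True R @ [(d, Under, Positive), (c, Under, Negative)] @ rev (row_letters False R)) @
          [(c, Over, Negative), (d, Over, Positive)]" (is "_ = ?U @ ?V")
        using True under parity by (simp add: twist_word_def)
      have "C = ?V @ ?U"
        using True under letters by (simp add: C core_positions_def rev_map[symmetric] comp_def)
      then have "C = rotate (length ?U) ?W" unfolding W by (simp only: rotate_append)
      then show ?thesis by blast
    next
      case False
      have W: "?W = (row_letters True R @ [(d, Under, Positive), (c, Under, Negative)] @ rev (row_letters False R) @
          [(d, Over, Positive)]) @ [(c, Over, Negative)]" (is "_ = ?U @ ?V")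
        using False under parity by (simp add: twist_word_def)
      have "C = ?V @ ?U"
        using False under letters ne by (simp add: C core_positions_def rev_map[symmetric] comp_def)
      then have "C = rotate (length ?U) ?W" unfolding W by (simp only: rotate_append)
      then show ?thesis by blast
    qed
  next
    case under: False
    show ?thesis
    proof (cases "over_at d < mid")
      case True
      have "C = rev ?W"
        using True under letters ne parity by (simp add: C core_positions_def twist_word_def rev_map[symmetric] comp_def)
      then have "C = rotate 0 (rev ?W)" by simp
      then show ?thesis by blast
    next
      case False
      have W: "rev ?W = [(d, Over, Positive)] @ ([(c, Over, Negative)] @ row_letters False R @
          [(c, Under, Negative), (d, Under, Positive)] @ rev (row_letters True R))" (is "_ = ?U @ ?V")
        using False under parity ne by (simp add: twist_word_def)
      have "C = ?V @ ?U"
        using False under letters ne by (simp add: C core_positions_def rev_map[symmetric] comp_def)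
      then have "C = rotate (length ?U) (rev ?W)" unfolding W by (simp only: rotate_append)
      then show ?thesis by blast
    qed
  qed
  then obtain n where "C = rotate n ?W \<or> C = rotate n (rev ?W)" by blast
  then have "unknotted_twist_knot_diagram C"
    using \<open>distinct R\<close> R(1) row_nonempty d_notin_row core_outside_c
    by (intro unknotted_twist_knot_diagramI[of R c d C n]) (auto simp: core_def)
  then show ?thesis by (simp add: C_def)
qed

end

section \<open>The decomposition\<close>

context based_unknot
begin

text \<open>
  Without rising chords nothing is interlaced at all, and \<open>c\<close> is a kink as well.
\<close>

lemma core_decomposition:
  "\<exists>C. kink_extension C D \<and> (one_crossing_diagram Negative C \<or> unknotted_twist_knot_diagram C)"
proof (cases "risings = {}")
  case True
  have arrows: "\<not> arrow p q" if "p \<in> positives" "q \<in> positives" for p q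
    using no_arrows[OF True that(1)] that by (auto simp: outs_def)
  have local: "\<not> rising p \<and> \<not> falling p" if "p \<in> positives" for p
  proof -
    have "fallings = {}" using True card_risings_fallings by simp
    then show ?thesis using True that by (auto simp: risings_def fallings_def)
  qed
  have nested: "nested_outside {c} D"
  proof (rule nested_outsideI)
    fix p assume p: "p \<in> positives - {c}"
    show "\<not> inside p mid" using local[of p] p by (auto simp: inside_def rising_def falling_def)
    fix q
    show "inside p (over_at q) \<longleftrightarrow> inside p (under_at q)" if "q \<in> positives"
      using inside_arrow[of p q] arrows[of p q] arrows[of q p] p that by (auto split: if_splits)
    show "\<not> inside p (over_at q)" if "q \<in> positives \<inter> {c}" using that by (auto simp: positives_def)
  qed simp
  have "set [0, mid] = {i. i < length D \<and> fst (D ! i) \<in> {c}}"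
  proof (rule set_eqI)
    fix i
    have "i = 0 \<or> i = mid" if "i < length D" "fst (D ! i) = c"
      using that(1) by (cases rule: position_cases) (use that at(3,4) in \<open>auto simp: positives_def\<close>)
    then show "i \<in> set [0, mid] \<longleftrightarrow> i \<in> {i. i < length D \<and> fst (D ! i) \<in> {c}}"
      using len base mid by auto
  qed
  then have "restrict_to {c} D = [(c, Over, Negative), (c, Under, Negative)]"
    unfolding restrict_to_def using mid base by (subst filter_eq_map_nth[of "[0, mid]"]) auto
  also have "\<dots> = rotate 0 (rename_crossings (\<lambda>_. c) [(0, Over, Negative), (0, Under, Negative)])"
    by (simp add: rename_crossings_def)
  finally have "one_crossing_diagram Negative (restrict_to {c} D)"
    unfolding one_crossing_diagram_def isotopic_def by (intro exI[of _ "\<lambda>_. c"] exI[of _ 0]) auto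
  then show ?thesis using kink_extension_restrict[OF nested] by blast
next
  case False
  obtain d where d: "d \<in> positives" "\<And>a. a \<in> risings - {d} \<Longrightarrow> arrow a d" "\<And>b. b \<in> fallings - {d} \<Longrightarrow> arrow d b"
    using hub_exists[OF False] by blast
  interpret based_hub D c d
    by unfold_locales (use d False in auto)
  show ?thesis using core_kink_extension core_unknotted_twist by blast
qed

end

lemma kink_not_special: "\<not> one_crossing_diagram Negative (kink p l)" "\<not> unknotted_twist_knot_diagram (kink p l)"
proof -
  show "\<not> one_crossing_diagram Negative (kink p l)"
  proof
    assume "one_crossing_diagram Negative (kink p l)"
    then obtain f n where "kink p l = rotate n (rename_crossings f [(0, Over, Negative), (0, Under, Negative)])"
      by (auto simp: one_crossing_diagram_def isotopic_def)
    from arg_cong[OF this, of set]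
    have "{(p, l, Positive), (p, other_level l, Positive)} = {(f 0, Over, Negative), (f 0, Under, Negative)}"
      by (simp add: kink_def rename_crossings_def)
    then have "(p, l, Positive) \<in> {(f 0, Over, Negative), (f 0, Under, Negative)}"
      by (rule subst) simp
    then show False by simp
  qed
  have "negative_crossings (kink p l) = {}" by (auto simp: negative_crossings_def kink_def)
  then show "\<not> unknotted_twist_knot_diagram (kink p l)"
    by (simp add: unknotted_twist_knot_diagram_def almost_positive_def)
qed

theorem corollary3p2:
  fixes D :: gauss_code
  assumes "unknot_diagram D" and "almost_positive D"
  shows "\<exists>Ds. iterated_connected_sum Ds D \<and>
    (\<forall>E \<in> set Ds. one_crossing_diagram Positive E \<or> one_crossing_diagram Negative E \<or>
                  unknotted_twist_knot_diagram E) \<and>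
    length (filter (\<lambda>E. one_crossing_diagram Negative E \<or> unknotted_twist_knot_diagram E) Ds) = 1"
proof -
  have D: "knot_diagram D" using assms(1) by (simp add: unknot_diagram_def)
  then have wf: "well_formed D" by (simp add: knot_diagram_def)
  obtain c where c: "negative_crossings D = {c}"
    using assms(2) by (auto simp: almost_positive_def card_1_singleton_iff)
  then obtain l where "(c, l, Negative) \<in> set D" by (auto simp: negative_crossings_def)
  then have "(c, Over, Negative) \<in> set D" using well_formed_mate[OF wf, of c l Negative] by (cases l) auto
  then obtain n where n: "n < length D" "D ! n = (c, Over, Negative)" by (metis in_set_conv_nth)
  define D0 where "D0 = rotate n D"
  have "D \<noteq> []" using n(1) by auto
  interpret based_unknot D0 c
  proof
    show "knot_diagram D0" using D by (simp add: D0_def knot_diagram_rotate)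
    show "casson l D0 = 0" for l using casson_rotate[OF D] casson_unknot[OF assms(1)] by (simp add: D0_def)
    show "D0 \<noteq> []" "D0 ! 0 = (c, Over, Negative)" using n \<open>D \<noteq> []\<close> by (simp_all add: D0_def nth_rotate)
    show "negative_crossings D0 = {c}" using c by (simp add: negative_crossings_def D0_def)
  qed
  obtain C where C: "kink_extension C D0" "one_crossing_diagram Negative C \<or> unknotted_twist_knot_diagram C"
    using core_decomposition by blast
  obtain k where "rotate k D0 = D" using rotate_back[of n D] D0_def by blast
  then have "isotopic D0 D" using isotopic_rotate[of D0 k] by simp
  then obtain Ks where Ks: "iterated_connected_sum (Ks @ [C]) D" "\<forall>K\<in>set Ks. \<exists>p l. K = kink p l"
    using kink_extension_connected_sum[OF C(1)] by blast
  have "filter (\<lambda>E. one_crossing_diagram Negative E \<or> unknotted_twist_knot_diagram E) Ks = []"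
    using Ks(2) kink_not_special by (auto simp: filter_empty_conv)
  then show ?thesis
    using Ks C(2) one_crossing_kink by (intro exI[of _ "Ks @ [C]"]) auto
qed

end
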